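(* Let $E$ be a finite directed graph without sinks in which every loop has an exit, let $k\ge1$, and let $u\in\mathcal P_E^k\cap\mathcal U_E$. Then Condition (b) holds for $u$ (and hence $\lambda_u|_{\mathcal D_E}$ is an automorphism of $\mathcal D_E$) if and only if there exists a partial order $\le$ on $\bigcup_{v\in E^0}E^{k-1}_{*,v}\times E^{k-1}_{*,v}$ such that: 1. if $v\in E^0\setminus r(E^1)$ then each element of $E^{k-1}_{*,v}\times E^{k-1}_{*,v}$ is minimal, each diagonal element $(\alpha,\alpha)$ is minimal, and there are no other minimal elements; 2. if $e\in E^1$ and $\alpha\ne\beta\in E^{k-1}_{*,r(e)}$ then $(f^u_e(\alpha),f^u_e(\beta))\le(\alpha,\beta)$.
   Context: A directed graph $E=(E^0,E^1,r,s)$ has vertex set $E^0$, edge set $E^1$, and range and source maps $r,s:E^1\to E^0$; it is finite if $E^0$ and $E^1$ are finite. $C^*(E)$ is the universal $C^*$-algebra generated by mutually orthogonal projections $P_v$ ($v\in E^0$) and partial isometries $S_e$ ($e\in E^1$) with $S_e^*S_e=P_{r(e)}$, $S_e^*S_f=0$ for $e\ne f$, $S_eS_e^*\le P_{s(e)}$, and $P_v=\sum_{s(e)=v}S_eS_e^*$ whenever $v$ emits finitely many and at least one edge. A path of length $k\ge1$ is $\mu=(\mu_1,\ldots,\mu_k)$ with $\mu_j\in E^1$ and $r(\mu_j)=s(\mu_{j+1})$; vertices are the paths of length $0$ (with $r(v)=s(v)=v$); $E^k$ is the set of paths of length $k$; put $s(\mu)=s(\mu_1)$, $r(\mu)=r(\mu_k)$,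 $S_\mu=S_{\mu_1}\cdots S_{\mu_k}$, $S_v=P_v$, $P_\mu=S_\mu S_\mu^*$. A sink is a vertex emitting no edges. A loop is a path $\mu$ of length at least $1$ with $s(\mu)=r(\mu)$; it has an exit if some $s(\mu_j)$ emits at least two distinct edges. $\mathcal D_E$ is the $C^*$-subalgebra generated by all $P_\mu$. $\mathcal U_E$ is the group of unitaries in $C^*(E)$ commuting with all $P_v$. For $u\in\mathcal U_E$, $\lambda_u$ is the unital $*$-endomorphism of $C^*(E)$ with $\lambda_u(S_e)=uS_e$, $\lambda_u(P_v)=P_v$. $\mathcal P_E^k$ is the group of unitaries in $C^*(E)$ of the form $\sum S_\alpha S_\beta^*$ with $\alpha,\beta\in E^k$. Each $u\in\mathcal P_E^k\cap\mathcal U_E$ has the form $u=\sum_{\alpha\in E^k}S_{\sigma(\alpha)}S_\alpha^*$ for a permutation $\sigma$ of $E^k$ preserving both the source and the range of each path. Put $E^{k-1}_{*,v}=\{\alpha\in E^{k-1}:s(\alpha)=v\}$. For $e\in E^1$ the map $f^u_e:E^{k-1}_{*,r(e)}\to E^{k-1}_{*,s(e)}$ is defined by: $f^u_e(\alpha)=\beta$ if and only if there is $g\in E^1$ with $\sigma(e,\alpha)=(\beta,g)$, where $(e,\alpha)$ and $(\beta,g)$ denote concatenated paths of length $k$. Condition (b) for $u$: there exists a positive integer $m$ such that for all $e_1,\ldots,e_m\in E^1$ either (i) the composition of partially defined maps $f^u_{e_1}\circ\cdots\circ f^u_{e_m}$ has empty domain, or (ii) its domain equals $E^{k-1}_{*,r(e_m)}$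 and its range consists of exactly one element.
   Formalization: In item 2 the inequality is taken strictly: (f_e(α), f_e(β)) < (α, β). With ≤ the claim fails: one vertex, two edges, k = 2, σ(e,f) = (f,e) makes every f_e the identity, so (b) fails, yet an order satisfying 1 and 2 exists. *)

theory Defs
  imports
    "HOL-Analysis.Analysis"
    "HOL-Library.Poly_Mapping"
    "HOL-Combinatorics.Permutations"
    "Graph_Theory.Arc_Walk"
begin

section \<open>C*-algebras\<close>

class star_op =
  fixes adj :: "'a \<Rightarrow> 'a"  (\<open>(_\<^sup>\<star>)\<close> [1000] 999)

text \<open>
  C*-algebras, unital or not; the zero algebra is admitted (it is the algebra of the empty graph).
\<close>

class cstar_algebra = real_normed_algebra + complete_space + star_op +
  fixes scaleC :: "complex \<Rightarrow> 'a \<Rightarrow> 'a"  (infixr \<open>*\<^sub>C\<close> 75)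
  assumes scaleR_scaleC: "r *\<^sub>R x = complex_of_real r *\<^sub>C x"
    and scaleC_add_right: "c *\<^sub>C (x + y) = c *\<^sub>C x + c *\<^sub>C y"
    and scaleC_add_left: "(c + d) *\<^sub>C x = c *\<^sub>C x + d *\<^sub>C x"
    and scaleC_scaleC: "c *\<^sub>C (d *\<^sub>C x) = (c * d) *\<^sub>C x"
    and mult_scaleC_left: "(c *\<^sub>C x) * y = c *\<^sub>C (x * y)"
    and mult_scaleC_right: "x * (c *\<^sub>C y) = c *\<^sub>C (x * y)"
    and norm_scaleC: "norm (c *\<^sub>C x) = cmod c * norm x"
    and adj_add: "(x + y)\<^sup>\<star> = x\<^sup>\<star> + y\<^sup>\<star>"
    and adj_scaleC: "(c *\<^sub>C x)\<^sup>\<star> = cnj c *\<^sub>C x\<^sup>\<star>"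
    and adj_mult: "(x * y)\<^sup>\<star> = y\<^sup>\<star> * x\<^sup>\<star>"
    and adj_adj: "(x\<^sup>\<star>)\<^sup>\<star> = x"
    and cstar_identity: "norm (x\<^sup>\<star> * x) = (norm x)\<^sup>2"

definition cstar_subalgebra :: "'a::cstar_algebra set \<Rightarrow> bool" where
  "cstar_subalgebra B \<longleftrightarrow> closed B \<and> 0 \<in> B \<and>
     (\<forall>x\<in>B. \<forall>y\<in>B. x + y \<in> B \<and> x * y \<in> B) \<and>
     (\<forall>x\<in>B. x\<^sup>\<star> \<in> B \<and> (\<forall>c. c *\<^sub>C x \<in> B))"

text \<open>
  A *-homomorphism between C*-algebras is automatically contractive; continuity is included for
  convenience only.
\<close>

definition cstar_hom :: "('a::cstar_algebra \<Rightarrow> 'b::cstar_algebra) \<Rightarrow> bool" where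
  "cstar_hom \<phi> \<longleftrightarrow> continuous_on UNIV \<phi> \<and>
     (\<forall>x y. \<phi> (x + y) = \<phi> x + \<phi> y \<and> \<phi> (x * y) = \<phi> x * \<phi> y) \<and>
     (\<forall>x. \<phi> (x\<^sup>\<star>) = (\<phi> x)\<^sup>\<star> \<and> (\<forall>c. \<phi> (c *\<^sub>C x) = c *\<^sub>C \<phi> x))"

text \<open>The restriction of \<open>\<phi>\<close> to the C*-subalgebra \<open>D\<close> is a *-automorphism of \<open>D\<close>.\<close>

definition cstar_automorphism_on :: "'a::cstar_algebra set \<Rightarrow> ('a \<Rightarrow> 'a) \<Rightarrow> bool" where
  "cstar_automorphism_on D \<phi> \<longleftrightarrow> cstar_subalgebra D \<and> bij_betw \<phi> D D \<and>
     (\<forall>x\<in>D. \<forall>y\<in>D. \<phi> (x + y) = \<phi> x + \<phi> y \<and> \<phi> (x * y) = \<phi> x * \<phi> y) \<and>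
     (\<forall>x\<in>D. \<phi> (x\<^sup>\<star>) = (\<phi> x)\<^sup>\<star> \<and> (\<forall>c. \<phi> (c *\<^sub>C x) = c *\<^sub>C \<phi> x))"

definition is_identity :: "'a::cstar_algebra \<Rightarrow> bool" where
  "is_identity i \<longleftrightarrow> (\<forall>x. i * x = x \<and> x * i = x)"

definition is_unitary :: "'a::cstar_algebra \<Rightarrow> bool" where
  "is_unitary u \<longleftrightarrow> is_identity (u\<^sup>\<star> * u) \<and> is_identity (u * u\<^sup>\<star>)"

section \<open>The free *-algebra on the vertices and edges\<close>

text \<open>
  A letter is a generator (vertex \<open>Inl v\<close> or edge \<open>Inr e\<close>) together with a flag telling whether it is
  starred. Finitely supported functions on words form the (unital) free complex *-algebra, with the
  convolution product of \<^theory>\<open>HOL-Library.Poly_Mapping\<close>; only the ideal of combinations of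
  nonempty words in the letters of the graph, \<open>free_star_algebra\<close> below, is used.
\<close>

datatype ('v, 'e) word = Word (letters: "(('v + 'e) \<times> bool) list")

instantiation word :: (type, type) "{monoid_add, star_op}"
begin
definition "0 = Word []"
definition "x + y = Word (letters x @ letters y)"
definition "x\<^sup>\<star> = Word (rev (map (\<lambda>(l, b). (l, \<not> b)) (letters x)))"
instance
  by standard (simp_all add: zero_word_def plus_word_def)
end

instantiation complex :: star_op
begin
definition "z\<^sup>\<star> = cnj z"
instance ..
end

instantiation poly_mapping :: (star_op, "{star_op, comm_monoid_add}") star_op
begin
definition
  "x\<^sup>\<star> = (\<Sum>w\<in>Poly_Mapping.keys x. Poly_Mapping.single (w\<^sup>\<star>) ((Poly_Mapping.lookup x w)\<^sup>\<star>))"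
instance ..
end

type_synonym ('v, 'e) free_star = "('v, 'e) word \<Rightarrow>\<^sub>0 complex"

definition gen :: "'v + 'e \<Rightarrow> ('v, 'e) free_star" where
  "gen l = Poly_Mapping.single (Word [(l, False)]) 1"

definition free_star_algebra :: "('v, 'e) pre_digraph \<Rightarrow> ('v, 'e) free_star set" where
  "free_star_algebra G =
     {x. \<forall>w\<in>Poly_Mapping.keys x. w \<noteq> 0 \<and> fst ` set (letters w) \<subseteq> verts G <+> arcs G}"

definition cstar_seminorm_on :: "('v, 'e) free_star set \<Rightarrow> (('v, 'e) free_star \<Rightarrow> real) \<Rightarrow> bool" where
  "cstar_seminorm_on F p \<longleftrightarrow>
     (\<forall>x\<in>F. \<forall>y\<in>F. p (x + y) \<le> p x + p y \<and> p (x * y) \<le> p x * p y) \<and>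
     (\<forall>x\<in>F. p (x\<^sup>\<star> * x) = (p x)\<^sup>2 \<and> (\<forall>c. p (Poly_Mapping.map ((*) c) x) = cmod c * p x))"

fun eval_letter :: "('v \<Rightarrow> 'a) \<Rightarrow> ('e \<Rightarrow> 'a::star_op) \<Rightarrow> ('v + 'e) \<times> bool \<Rightarrow> 'a" where
  "eval_letter P S (Inl v, b) = (if b then (P v)\<^sup>\<star> else P v)"
| "eval_letter P S (Inr e, b) = (if b then (S e)\<^sup>\<star> else S e)"

text \<open>The value on the empty list is irrelevant: there need not be an identity.\<close>

fun list_product :: "'a::ring list \<Rightarrow> 'a" where
  "list_product [] = 0"
| "list_product [x] = x"
| "list_product (x # y # zs) = x * list_product (y # zs)"

abbreviation eval_word :: "('v \<Rightarrow> 'a) \<Rightarrow> ('e \<Rightarrow> 'a::cstar_algebra) \<Rightarrow> ('v, 'e) word \<Rightarrow> 'a" where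
  "eval_word P S w \<equiv> list_product (map (eval_letter P S) (letters w))"

definition eval :: "('v \<Rightarrow> 'a) \<Rightarrow> ('e \<Rightarrow> 'a::cstar_algebra) \<Rightarrow> ('v, 'e) free_star \<Rightarrow> 'a" where
  "eval P S x = (\<Sum>w\<in>Poly_Mapping.keys x.
     Poly_Mapping.lookup x w *\<^sub>C eval_word P S w)"

section \<open>The graph C*-algebra\<close>

text \<open>
  \<open>tail\<close> is the source map and \<open>head\<close> the range map. The Cuntz--Krieger relations are stated up to a
  predicate \<open>Z\<close> of elements regarded as zero, so that they can be imposed both in a C*-algebra and,
  modulo the kernel of a seminorm, in the free *-algebra. For projections, \<open>q \<le> p\<close> means \<open>p * q = q\<close>;
  that the \<open>S e\<close> are partial isometries follows, as \<open>(S e)\<^sup>\<star> * S e\<close> is a projection.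
\<close>

definition cuntz_krieger_mod ::
    "('a::{ring, star_op} \<Rightarrow> bool) \<Rightarrow> ('v, 'e) pre_digraph \<Rightarrow> ('v \<Rightarrow> 'a) \<Rightarrow> ('e \<Rightarrow> 'a) \<Rightarrow> bool" where
  "cuntz_krieger_mod Z G P S \<longleftrightarrow>
     (\<forall>v\<in>verts G. Z ((P v)\<^sup>\<star> - P v) \<and> Z (P v * P v - P v)) \<and>
     (\<forall>v\<in>verts G. \<forall>w\<in>verts G. v \<noteq> w \<longrightarrow> Z (P v * P w)) \<and>
     (\<forall>e\<in>arcs G. Z ((S e)\<^sup>\<star> * S e - P (head G e))) \<and>
     (\<forall>e\<in>arcs G. \<forall>f\<in>arcs G. e \<noteq> f \<longrightarrow> Z ((S e)\<^sup>\<star> * S f)) \<and>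
     (\<forall>e\<in>arcs G. Z (P (tail G e) * (S e * (S e)\<^sup>\<star>) - S e * (S e)\<^sup>\<star>)) \<and>
     (\<forall>v\<in>verts G. finite (out_arcs G v) \<and> out_arcs G v \<noteq> {} \<longrightarrow>
        Z (P v - (\<Sum>e\<in>out_arcs G v. S e * (S e)\<^sup>\<star>)))"

abbreviation cuntz_krieger_family ::
    "('v, 'e) pre_digraph \<Rightarrow> ('v \<Rightarrow> 'a::cstar_algebra) \<Rightarrow> ('e \<Rightarrow> 'a) \<Rightarrow> bool" where
  "cuntz_krieger_family \<equiv> cuntz_krieger_mod (\<lambda>x. x = 0)"

text \<open>
  The type \<open>'a\<close> with the generators \<open>P\<close>, \<open>S\<close> is the universal C*-algebra \<open>C*(G)\<close>: a Cuntz--Krieger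
  family in a C*-algebra \<open>B\<close> is, up to isomorphism of the C*-algebra it generates, the same thing as a
  C*-seminorm on the free *-algebra vanishing on the relations (pull back the norm of \<open>B\<close>; conversely
  complete the quotient by the kernel). So universality among all C*-algebras \<open>B\<close> says that the norm
  of \<open>'a\<close> pulls back to the largest such seminorm, i.e. that \<open>'a\<close> is the completion of the
  free *-algebra in the universal C*-seminorm.
\<close>

definition graph_cstar_algebra ::
    "('v, 'e) pre_digraph \<Rightarrow> ('v \<Rightarrow> 'a::cstar_algebra) \<Rightarrow> ('e \<Rightarrow> 'a) \<Rightarrow> bool" where
  "graph_cstar_algebra G P S \<longleftrightarrow>
     cuntz_krieger_family G P S \<and>
     cstar_subalgebra hull (P ` verts G \<union> S ` arcs G) = UNIV \<and>
     (\<forall>p. cstar_seminorm_on (free_star_algebra G) p \<and>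
          cuntz_krieger_mod (\<lambda>x. p x = 0) G (\<lambda>v. gen (Inl v)) (\<lambda>e. gen (Inr e)) \<longrightarrow>
        (\<forall>x\<in>free_star_algebra G. p x \<le> norm (eval P S x)))"

subsection \<open>Universality\<close>

lemma scaleC_zero_left[simp]: "0 *\<^sub>C (x::'a::cstar_algebra) = 0"
  using norm_scaleC[of 0 x] by simp
lemma scaleC_zero_right[simp]: "c *\<^sub>C (0::'a::cstar_algebra) = 0"
  using norm_scaleC[of c "0::'a"] by simp
lemma adj_zero[simp]: "(0::'a::cstar_algebra)\<^sup>\<star> = 0"
  using adj_add[of "0::'a" 0] by simp
lemma adj_sum: "(sum f A)\<^sup>\<star> = (\<Sum>a\<in>A. (f a :: 'a::cstar_algebra)\<^sup>\<star>)"
  by (induction A rule: infinite_finite_induct) (auto simp: adj_add)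
lemma scaleC_sum: "c *\<^sub>C sum f A = (\<Sum>a\<in>A. c *\<^sub>C (f a :: 'a::cstar_algebra))"
  by (induction A rule: infinite_finite_induct) (auto simp: scaleC_add_right)

lemma eval_superset: "finite A \<Longrightarrow> Poly_Mapping.keys x \<subseteq> A \<Longrightarrow> eval P S x = (\<Sum>w\<in>A. Poly_Mapping.lookup x w *\<^sub>C eval_word P S w)"
  unfolding eval_def by (rule sum.mono_neutral_left) (auto simp: in_keys_iff)

lemma eval_add: "eval P S (x + y) = eval P S x + eval P S y"
proof -
  let ?A = "Poly_Mapping.keys x \<union> Poly_Mapping.keys y"
  have "Poly_Mapping.keys (x+y) \<subseteq> ?A" by (rule keys_add)
  then show ?thesis
    by (simp add: eval_superset[of ?A] lookup_add scaleC_add_left sum.distrib)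
qed

lemma eval_zero[simp]: "eval P S 0 = 0" by (simp add: eval_def)
lemma eval_sum: "eval P S (sum f A) = (\<Sum>a\<in>A. eval P S (f a))"
  by (induction A rule: infinite_finite_induct) (auto simp: eval_add)
lemma eval_single: "eval P S (Poly_Mapping.single w c) = c *\<^sub>C eval_word P S w"
  by (subst eval_superset[of "{w}"]) auto
lemma eval_minus: "eval P S (x - y) = eval P S x - eval P S y"
  using eval_add[of P S "x - y" y] by simp

lemma list_product_append: "xs \<noteq> [] \<Longrightarrow> ys \<noteq> [] \<Longrightarrow> list_product (xs @ ys) = list_product xs * list_product ys"
proof (induction xs rule: list_product.induct)
  case (2 x) then show ?case by (cases ys) auto
qed (auto simp: mult.assoc)

lemma adj_list_product: "(list_product xs :: 'a::cstar_algebra)\<^sup>\<star> = list_product (rev (map adj xs))"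
proof (induction xs rule: list_product.induct)
  case (3 x y zs) then show ?case
    using list_product_append[of "rev (map adj zs) @ [y\<^sup>\<star>]" "[x\<^sup>\<star>]"]
    by (subst list_product.simps, subst adj_mult) simp
qed auto

lemma eval_word_add: "w \<noteq> 0 \<Longrightarrow> w' \<noteq> 0 \<Longrightarrow> eval_word P S (w + w') = eval_word P S w * eval_word P S w'"
  by (cases w; cases w') (auto simp: plus_word_def zero_word_def list_product_append)

lemma eval_letter_adj: "eval_letter P S ((\<lambda>(l, b). (l, \<not> b)) l) = (eval_letter P S l :: 'a::cstar_algebra)\<^sup>\<star>"
  by (cases l; cases "fst l"; cases "snd l") (auto simp: adj_adj)

lemma eval_word_adj: "eval_word P S (w\<^sup>\<star>) = (eval_word P S w :: 'a::cstar_algebra)\<^sup>\<star>"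
  by (simp add: adj_word_def adj_list_product rev_map[symmetric] o_def eval_letter_adj)

lemma eval_adj: "eval P S (x\<^sup>\<star>) = (eval P S x)\<^sup>\<star>"
  unfolding adj_poly_mapping_def eval_sum eval_single eval_word_adj
  by (simp add: eval_def adj_sum adj_scaleC adj_complex_def)

lemma sum_of_monomials: "x = (\<Sum>w\<in>Poly_Mapping.keys x. Poly_Mapping.single w (Poly_Mapping.lookup x w))"
  proof (rule poly_mapping_eqI)
  fix k show "Poly_Mapping.lookup x k = Poly_Mapping.lookup (\<Sum>w\<in>Poly_Mapping.keys x. Poly_Mapping.single w (Poly_Mapping.lookup x w)) k"
    by (simp add: lookup_sum lookup_single when_def in_keys_iff)
qed

lemma eval_mult:
  assumes "\<forall>w\<in>Poly_Mapping.keys x. w \<noteq> 0" "\<forall>w\<in>Poly_Mapping.keys y. w \<noteq> 0"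
  shows "eval P S (x * y) = eval P S x * eval P S y"
proof -
  have "x * y = (\<Sum>w\<in>Poly_Mapping.keys x. \<Sum>w'\<in>Poly_Mapping.keys y. Poly_Mapping.single (w + w') (Poly_Mapping.lookup x w * Poly_Mapping.lookup y w'))"
    by (subst (1) sum_of_monomials[of x], subst (1) sum_of_monomials[of y]) (simp add: sum_product mult_single)
  then have "eval P S (x * y) = (\<Sum>w\<in>Poly_Mapping.keys x. \<Sum>w'\<in>Poly_Mapping.keys y. (Poly_Mapping.lookup x w * Poly_Mapping.lookup y w') *\<^sub>C eval_word P S (w + w'))"
    by (simp add: eval_sum eval_single)
  also have "\<dots> = (\<Sum>w\<in>Poly_Mapping.keys x. \<Sum>w'\<in>Poly_Mapping.keys y. (Poly_Mapping.lookup x w *\<^sub>C eval_word P S w) * (Poly_Mapping.lookup y w' *\<^sub>C eval_word P S w'))"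
    using assms by (intro sum.cong refl) (simp add: eval_word_add mult_scaleC_left mult_scaleC_right scaleC_scaleC mult.commute[of "Poly_Mapping.lookup y _" "Poly_Mapping.lookup x _"])
  also have "\<dots> = eval P S x * eval P S y" by (simp add: eval_def sum_product)
  finally show ?thesis .
qed

lemma eval_scale: "eval P S (Poly_Mapping.map ((*) c) x) = c *\<^sub>C eval P S x"
  by (subst eval_superset[of "Poly_Mapping.keys x"])
     (auto simp: eval_def scaleC_sum scaleC_scaleC map.rep_eq in_keys_iff when_def intro!: sum.cong)

lemma eval_gen: "eval P S (gen (Inl v)) = P v" "eval P S (gen (Inr e)) = S e"
proof -
  have one: "(1::complex) *\<^sub>C x = x" for x :: 'a using scaleR_scaleC[of 1 x] by simp
  show "eval P S (gen (Inl v)) = P v" "eval P S (gen (Inr e)) = S e"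
    by (simp_all add: gen_def eval_single one)
qed

lemma nonempty_words_adj: "\<forall>w\<in>Poly_Mapping.keys x. w \<noteq> 0 \<Longrightarrow> \<forall>w\<in>Poly_Mapping.keys ((x::('v,'e) free_star)\<^sup>\<star>). w \<noteq> 0"
proof
  fix w assume a: "\<forall>w\<in>Poly_Mapping.keys x. w \<noteq> 0" and "w \<in> Poly_Mapping.keys (x\<^sup>\<star>)"
  then obtain w' where "w' \<in> Poly_Mapping.keys x" "w = w'\<^sup>\<star>"
    unfolding adj_poly_mapping_def
    by (smt (verit) keys_sum UN_E finite_keys keys_single subset_eq singletonD empty_iff)
  with a show "w \<noteq> 0" by (cases w') (auto simp: adj_word_def zero_word_def)
qed

lemma nonempty_words_gen: "\<forall>w\<in>Poly_Mapping.keys (gen l). w \<noteq> 0" by (simp add: gen_def zero_word_def)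
lemma nonempty_words_mult: "\<forall>w\<in>Poly_Mapping.keys x. w \<noteq> 0 \<Longrightarrow> \<forall>w\<in>Poly_Mapping.keys y. w \<noteq> 0 \<Longrightarrow> \<forall>w\<in>Poly_Mapping.keys (x*y::('v,'e) free_star). w \<noteq> 0"
  using keys_mult[of x y] by (fastforce simp: plus_word_def zero_word_def word.expand)

text \<open>
  The universal property: by density, the inequality yields a unique *-homomorphism \<open>\<phi>\<close> with
  \<open>\<phi> (P v) = Q v\<close> and \<open>\<phi> (S e) = T e\<close>. The type of the target algebra is arbitrary.
\<close>

theorem norm_eval_le:
  fixes P :: "'v \<Rightarrow> 'a::cstar_algebra" and Q :: "'v \<Rightarrow> 'b::cstar_algebra"
  assumes "graph_cstar_algebra G P S" and ck: "cuntz_krieger_family G Q T"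
    and "x \<in> free_star_algebra G"
  shows "norm (eval Q T x) \<le> norm (eval P S x)"
proof -
  let ?p = "\<lambda>x. norm (eval Q T x)"
  have nz: "\<And>x. x \<in> free_star_algebra G \<Longrightarrow> \<forall>w\<in>Poly_Mapping.keys x. w \<noteq> 0" by (auto simp: free_star_algebra_def)
  have "cstar_seminorm_on (free_star_algebra G) ?p"
    unfolding cstar_seminorm_on_def
    by (auto simp: eval_add eval_mult nz eval_mult[OF nonempty_words_adj[OF nz] nz] eval_adj cstar_identity eval_scale norm_scaleC
        norm_triangle_ineq norm_mult_ineq)
  moreover have "cuntz_krieger_mod (\<lambda>x. ?p x = 0) G (\<lambda>v. gen (Inl v)) (\<lambda>e. gen (Inr e))"
    using ck unfolding cuntz_krieger_mod_def
    by (simp add: eval_mult[OF nonempty_words_gen nonempty_words_gen] eval_mult[OF nonempty_words_adj[OF nonempty_words_gen] nonempty_words_gen]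
      eval_mult[OF nonempty_words_gen nonempty_words_adj[OF nonempty_words_gen]] eval_mult[OF nonempty_words_gen nonempty_words_mult[OF nonempty_words_gen nonempty_words_adj[OF nonempty_words_gen]]]
      eval_adj eval_minus eval_sum eval_gen)
  ultimately show ?thesis using assms unfolding graph_cstar_algebra_def by blast
qed

section \<open>Paths and the diagonal subalgebra\<close>

text \<open>
  A path is a pair of its source and its list of edges, so that \<open>(v, [])\<close> is the vertex \<open>v\<close> as a path
  of length 0.
\<close>

type_synonym ('v, 'e) path = "'v \<times> 'e list"

definition paths :: "('v, 'e) pre_digraph \<Rightarrow> nat \<Rightarrow> ('v, 'e) path set" where
  "paths G n = {(v, es). length es = n \<and> (\<exists>w. pre_digraph.awalk G v es w)}"

definition path_range :: "('v, 'e) pre_digraph \<Rightarrow> ('v, 'e) path \<Rightarrow> 'v" where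
  "path_range G \<mu> = pre_digraph.awlast G (fst \<mu>) (snd \<mu>)"

definition paths_from :: "('v, 'e) pre_digraph \<Rightarrow> nat \<Rightarrow> 'v \<Rightarrow> ('v, 'e) path set" where
  "paths_from G n v = {\<alpha> \<in> paths G n. fst \<alpha> = v}"

definition path_cons :: "('v, 'e) pre_digraph \<Rightarrow> 'e \<Rightarrow> ('v, 'e) path \<Rightarrow> ('v, 'e) path" where
  "path_cons G e \<alpha> = (tail G e, e # snd \<alpha>)"

definition path_snoc :: "('v, 'e) path \<Rightarrow> 'e \<Rightarrow> ('v, 'e) path" where
  "path_snoc \<beta> g = (fst \<beta>, snd \<beta> @ [g])"

definition every_loop_has_exit :: "('v, 'e) pre_digraph \<Rightarrow> bool" where
  "every_loop_has_exit G \<longleftrightarrow> (\<forall>v \<mu>. pre_digraph.awalk G v \<mu> v \<and> \<mu> \<noteq> [] \<longrightarrow>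
     (\<exists>e\<in>set \<mu>. \<exists>f\<in>out_arcs G (tail G e). \<exists>g\<in>out_arcs G (tail G e). f \<noteq> g))"

definition path_elt :: "('v \<Rightarrow> 'a) \<Rightarrow> ('e \<Rightarrow> 'a::ring) \<Rightarrow> ('v, 'e) path \<Rightarrow> 'a" where
  "path_elt P S \<mu> = (if snd \<mu> = [] then P (fst \<mu>) else list_product (map S (snd \<mu>)))"

definition diagonal_algebra ::
    "('v, 'e) pre_digraph \<Rightarrow> ('v \<Rightarrow> 'a::cstar_algebra) \<Rightarrow> ('e \<Rightarrow> 'a) \<Rightarrow> 'a set" where
  "diagonal_algebra G P S =
     cstar_subalgebra hull (\<Union>n. (\<lambda>\<mu>. path_elt P S \<mu> * (path_elt P S \<mu>)\<^sup>\<star>) ` paths G n)"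

section \<open>Permutative unitaries and their endomorphisms\<close>

definition vertex_unitaries :: "('v, 'e) pre_digraph \<Rightarrow> ('v \<Rightarrow> 'a::cstar_algebra) \<Rightarrow> 'a set" where
  "vertex_unitaries G P = {u. is_unitary u \<and> (\<forall>v\<in>verts G. u * P v = P v * u)}"

definition permutative_unitaries ::
    "('v, 'e) pre_digraph \<Rightarrow> ('v \<Rightarrow> 'a::cstar_algebra) \<Rightarrow> ('e \<Rightarrow> 'a) \<Rightarrow> nat \<Rightarrow> 'a set" where
  "permutative_unitaries G P S k = {u. is_unitary u \<and>
     (\<exists>X \<subseteq> paths G k \<times> paths G k. u = (\<Sum>(\<alpha>, \<beta>)\<in>X. path_elt P S \<alpha> * (path_elt P S \<beta>)\<^sup>\<star>))}"

text \<open>The endomorphism \<open>\<lambda>\<^sub>u\<close>.\<close>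

definition lambda_endo ::
    "('v, 'e) pre_digraph \<Rightarrow> ('v \<Rightarrow> 'a::cstar_algebra) \<Rightarrow> ('e \<Rightarrow> 'a) \<Rightarrow> 'a \<Rightarrow> 'a \<Rightarrow> 'a" where
  "lambda_endo G P S u = (THE \<phi>. cstar_hom \<phi> \<and> (\<forall>i. is_identity i \<longrightarrow> \<phi> i = i) \<and>
     (\<forall>e\<in>arcs G. \<phi> (S e) = u * S e) \<and> (\<forall>v\<in>verts G. \<phi> (P v) = P v))"

text \<open>
  The permutation \<open>\<sigma>\<close> of \<open>paths G k\<close> with \<open>u = \<Sum>\<^sub>\<alpha> S\<^sub>\<sigma>\<^sub>(\<^sub>\<alpha>\<^sub>) S\<^sub>\<alpha>\<^sup>\<star>\<close>, extended by the identity.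
\<close>

definition path_perm ::
    "('v, 'e) pre_digraph \<Rightarrow> ('v \<Rightarrow> 'a::cstar_algebra) \<Rightarrow> ('e \<Rightarrow> 'a) \<Rightarrow> nat \<Rightarrow> 'a
      \<Rightarrow> ('v, 'e) path \<Rightarrow> ('v, 'e) path" where
  "path_perm G P S k u = (THE \<sigma>. \<sigma> permutes paths G k \<and>
     (\<forall>\<alpha>\<in>paths G k. fst (\<sigma> \<alpha>) = fst \<alpha> \<and> path_range G (\<sigma> \<alpha>) = path_range G \<alpha>) \<and>
     u = (\<Sum>\<alpha>\<in>paths G k. path_elt P S (\<sigma> \<alpha>) * (path_elt P S \<alpha>)\<^sup>\<star>))"

text \<open>The map \<open>f\<^sup>u\<^sub>e\<close>, as a partial map defined exactly on \<open>paths_from G (k - 1) (head G e)\<close>.\<close>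

definition f_map ::
    "('v, 'e) pre_digraph \<Rightarrow> ('v \<Rightarrow> 'a::cstar_algebra) \<Rightarrow> ('e \<Rightarrow> 'a) \<Rightarrow> nat \<Rightarrow> 'a \<Rightarrow> 'e
      \<Rightarrow> ('v, 'e) path \<rightharpoonup> ('v, 'e) path" where
  "f_map G P S k u e \<alpha> =
     (if \<alpha> \<in> paths_from G (k - 1) (head G e)
      then Some (THE \<beta>. \<beta> \<in> paths_from G (k - 1) (tail G e) \<and>
             (\<exists>g\<in>arcs G. path_perm G P S k u (path_cons G e \<alpha>) = path_snoc \<beta> g))
      else None)"

text \<open>\<open>f_comp G P S k u [e\<^sub>1, \<dots>, e\<^sub>m]\<close> is the composition with \<open>f_map G P S k u e\<^sub>m\<close> applied first.\<close>

definition f_comp ::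
    "('v, 'e) pre_digraph \<Rightarrow> ('v \<Rightarrow> 'a::cstar_algebra) \<Rightarrow> ('e \<Rightarrow> 'a) \<Rightarrow> nat \<Rightarrow> 'a \<Rightarrow> 'e list
      \<Rightarrow> ('v, 'e) path \<rightharpoonup> ('v, 'e) path" where
  "f_comp G P S k u es = foldr (\<lambda>e h. f_map G P S k u e \<circ>\<^sub>m h) es Some"

definition condition_b ::
    "('v, 'e) pre_digraph \<Rightarrow> ('v \<Rightarrow> 'a::cstar_algebra) \<Rightarrow> ('e \<Rightarrow> 'a) \<Rightarrow> nat \<Rightarrow> 'a \<Rightarrow> bool" where
  "condition_b G P S k u \<longleftrightarrow> (\<exists>m>0. \<forall>es. length es = m \<and> set es \<subseteq> arcs G \<longrightarrow>
     dom (f_comp G P S k u es) = {} \<or>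
     (dom (f_comp G P S k u es) = paths_from G (k - 1) (head G (last es)) \<and>
      (\<exists>\<beta>. ran (f_comp G P S k u es) = {\<beta>})))"

section \<open>Partial orders on pairs of paths\<close>

definition path_pairs ::
    "('v, 'e) pre_digraph \<Rightarrow> nat \<Rightarrow> (('v, 'e) path \<times> ('v, 'e) path) set" where
  "path_pairs G n = (\<Union>v\<in>verts G. paths_from G n v \<times> paths_from G n v)"

definition minimal_in :: "'x set \<Rightarrow> 'x rel \<Rightarrow> 'x \<Rightarrow> bool" where
  "minimal_in X r x \<longleftrightarrow> x \<in> X \<and> (\<forall>y\<in>X. (y, x) \<in> r \<longrightarrow> y = x)"

definition minimality_condition ::
    "('v, 'e) pre_digraph \<Rightarrow> nat \<Rightarrow> (('v, 'e) path \<times> ('v, 'e) path) rel \<Rightarrow> bool" where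
  "minimality_condition G n r \<longleftrightarrow>
     (\<forall>v \<in> verts G - head G ` arcs G. \<forall>x \<in> paths_from G n v \<times> paths_from G n v.
        minimal_in (path_pairs G n) r x) \<and>
     (\<forall>\<alpha>\<in>paths G n. minimal_in (path_pairs G n) r (\<alpha>, \<alpha>)) \<and>
     (\<forall>x. minimal_in (path_pairs G n) r x \<longrightarrow>
        (\<exists>v \<in> verts G - head G ` arcs G. x \<in> paths_from G n v \<times> paths_from G n v) \<or>
        (\<exists>\<alpha>\<in>paths G n. x = (\<alpha>, \<alpha>)))"

text \<open>
  The maps \<open>f\<^sup>u\<^sub>e\<close> have to move off-diagonal pairs strictly down. If equality were allowed, the condition
  would be void for pairs fixed by \<open>f\<^sup>u\<^sub>e\<close>: for the graph with one vertex and two edges \<open>a\<close>, \<open>b\<close>, with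
  \<open>k = 2\<close> and \<open>\<sigma>(e, f) = (f, e)\<close>, every \<open>f\<^sup>u\<^sub>e\<close> is the identity and Condition (b) fails, but the order
  generated by \<open>(a, a) < (a, b)\<close> and \<open>(a, a) < (b, a)\<close> would qualify.
\<close>

definition descent_condition ::
    "('v, 'e) pre_digraph \<Rightarrow> ('v \<Rightarrow> 'a::cstar_algebra) \<Rightarrow> ('e \<Rightarrow> 'a) \<Rightarrow> nat \<Rightarrow> 'a
      \<Rightarrow> (('v, 'e) path \<times> ('v, 'e) path) rel \<Rightarrow> bool" where
  "descent_condition G P S k u r \<longleftrightarrow>
     (\<forall>e\<in>arcs G. \<forall>\<alpha>\<in>paths_from G (k - 1) (head G e). \<forall>\<beta>\<in>paths_from G (k - 1) (head G e).
        \<alpha> \<noteq> \<beta> \<longrightarrow>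
        (let x = (the (f_map G P S k u e \<alpha>), the (f_map G P S k u e \<beta>))
         in (x, (\<alpha>, \<beta>)) \<in> r \<and> x \<noteq> (\<alpha>, \<beta>)))"

end

theory Submission
  imports Defs
begin

text \<open>
  The maps \<open>f e\<close> describe how \<open>u\<close> shifts paths: \<open>u * S\<^sub>e * S\<^sub>\<beta> = S\<^sub>\<gamma> * S\<^sub>g\<close> with \<open>\<gamma> = f e \<beta>\<close>, for
  \<open>\<beta>\<close> of length \<open>k - 1\<close>.

  Condition (b) and the partial order express the same finiteness. A composition of \<open>m\<close> of the maps
  takes different values at \<open>\<alpha>\<close> and \<open>\<beta>\<close> only if the pair \<open>(\<alpha>, \<beta>)\<close> admits \<open>m\<close> successive off-diagonal
  steps. If an order makes each step strictly decreasing, the number of elements below a pair bounds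
  the number of such steps, so that every composition of more maps is constant or empty
  (\<open>condition_b_if_order\<close>). Conversely, under Condition (b) the relation given by the single steps has
  no cycles, because running around a cycle would give arbitrarily long nonconstant compositions. Its
  reflexive transitive closure is the order; the minimal pairs are those from which no step starts,
  that is, the diagonal ones and those at vertices which receive no edge (\<open>order_if_condition_b\<close>).

  On \<open>\<D>\<^sub>E\<close> the endomorphism \<open>\<lambda>\<^sub>u\<close> is isometric: \<open>\<D>\<^sub>E\<close> is the closure of the increasing
  union of the spans of the \<open>P\<^sub>\<mu>\<close> with \<open>\<mu>\<close> of length \<open>n\<close>, these are nonzero orthogonal projections
  which \<open>\<lambda>\<^sub>u\<close> maps to nonzero orthogonal projections, and the norm of a combination of nonzero
  orthogonal projections depends only on the coefficients (\<open>norm_lambda_D\<close>). In particular the image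
  of \<open>\<D>\<^sub>E\<close> is closed. Condition (b) gives surjectivity. Let \<open>f\<^sub>\<mu>\<close> be the composition along a path \<open>\<mu>\<close>. The
  range of \<open>\<lambda>\<^sub>u(S\<^sub>\<mu>) * P\<^sub>\<beta>\<close> lies below \<open>P\<^sub>\<alpha>\<close> for \<open>\<alpha> = f\<^sub>\<mu> \<beta>\<close>; so when all \<open>f\<^sub>\<mu>\<close> with \<open>\<mu>\<close> of length \<open>m\<close> are
  constant, each \<open>P\<^sub>\<alpha>\<close> with \<open>\<alpha>\<close> of length \<open>k - 1\<close> is the sum of the \<open>\<lambda>\<^sub>u(P\<^sub>\<mu>)\<close> over the \<open>\<mu>\<close> with value \<open>\<alpha>\<close>
  (\<open>short_Pp_in_lambda_image\<close>). For longer paths, \<open>\<sigma>\<close> peels off one edge at a time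
  (\<open>Pp_in_lambda_image\<close>).

  All this presupposes that \<open>u\<close> determines \<open>\<sigma>\<close> (\<open>path_perm\<close>), hence that no \<open>P\<^sub>v\<close> vanishes. As the norm
  of the graph algebra dominates every C*-seminorm satisfying the relations, one representation with
  nonzero vertex projections suffices (\<open>vertex_projection_nonzero\<close>).
\<close>

section \<open>Finitely supported functions as an inner product space\<close>

text \<open>
  A C*-seminorm can be read off from operators on an inner product space, complete or not, so
  finitely supported functions can take the place of square summable ones. The inner product is the
  real one; for complex values it has the same adjoints and the same norm as the complex one.
\<close>

instantiation poly_mapping :: (type, real_vector) real_vector
begin

lift_definition scaleR_poly_mapping :: "real \<Rightarrow> ('a \<Rightarrow>\<^sub>0 'b) \<Rightarrow> ('a \<Rightarrow>\<^sub>0 'b)"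
  is "\<lambda>r h k. r *\<^sub>R h k"
  by (rule finite_subset[rotated]) auto

instance
proof
  fix f g :: "'a \<Rightarrow>\<^sub>0 'b" and r s :: real
  show "r *\<^sub>R (f + g) = r *\<^sub>R f + r *\<^sub>R g"
    by transfer (simp add: scaleR_add_right)
  show "(r + s) *\<^sub>R f = r *\<^sub>R f + s *\<^sub>R f"
    by transfer (simp add: scaleR_add_left)
  show "r *\<^sub>R s *\<^sub>R f = (r * s) *\<^sub>R f" by transfer simp
  show "1 *\<^sub>R f = f" by transfer simp
qed

end

instantiation poly_mapping :: (type, real_inner) real_inner
begin

definition inner_poly_mapping :: "('a \<Rightarrow>\<^sub>0 'b) \<Rightarrow> ('a \<Rightarrow>\<^sub>0 'b) \<Rightarrow> real" where
  "inner_poly_mapping g h = (\<Sum>k\<in>Poly_Mapping.keys g. inner (Poly_Mapping.lookup g k) (Poly_Mapping.lookup h k))"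

definition norm_poly_mapping :: "('a \<Rightarrow>\<^sub>0 'b) \<Rightarrow> real" where
  "norm_poly_mapping h = sqrt (inner h h)"

definition sgn_poly_mapping :: "('a \<Rightarrow>\<^sub>0 'b) \<Rightarrow> ('a \<Rightarrow>\<^sub>0 'b)" where
  "sgn_poly_mapping h = h /\<^sub>R norm h"

definition dist_poly_mapping :: "('a \<Rightarrow>\<^sub>0 'b) \<Rightarrow> ('a \<Rightarrow>\<^sub>0 'b) \<Rightarrow> real" where
  "dist_poly_mapping g h = norm (g - h)"

definition uniformity_poly_mapping :: "(('a \<Rightarrow>\<^sub>0 'b) \<times> ('a \<Rightarrow>\<^sub>0 'b)) filter" where
  "uniformity_poly_mapping = (INF e\<in>{0 <..}. principal {(x, y). dist x y < e})"

definition open_poly_mapping :: "('a \<Rightarrow>\<^sub>0 'b) set \<Rightarrow> bool" where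
  "open_poly_mapping U \<longleftrightarrow> (\<forall>x\<in>U. eventually (\<lambda>(x', y). x' = x \<longrightarrow> y \<in> U) uniformity)"

lemma inner_poly_mapping_superset:
  assumes "finite A" "Poly_Mapping.keys g \<subseteq> A"
  shows "inner g h = (\<Sum>k\<in>A. inner (Poly_Mapping.lookup g k) (Poly_Mapping.lookup h k))"
  unfolding inner_poly_mapping_def
  using assms by (intro sum.mono_neutral_left) (auto simp: in_keys_iff)

instance
proof
  fix f g h :: "'a \<Rightarrow>\<^sub>0 'b" and r :: real
  let ?A = "Poly_Mapping.keys f \<union> Poly_Mapping.keys g \<union> Poly_Mapping.keys h"
  have keys: "Poly_Mapping.keys (f + g) \<subseteq> ?A" using keys_add[of f g] by auto
  have inner: "inner a b = (\<Sum>k\<in>?A. inner (Poly_Mapping.lookup a k) (Poly_Mapping.lookup b k))"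
    if "Poly_Mapping.keys a \<subseteq> ?A" for a b :: "'a \<Rightarrow>\<^sub>0 'b"
    by (rule inner_poly_mapping_superset) (use that in auto)
  show "inner f g = inner g f"
    by (subst (1 2) inner) (auto simp: inner_commute)
  show "inner (f + g) h = inner f h + inner g h"
    by (subst (1 2 3) inner) (use keys in \<open>auto simp: lookup_add inner_add_left sum.distrib\<close>)
  have keys_scaleR: "Poly_Mapping.keys (r *\<^sub>R f) \<subseteq> ?A"
    by (auto simp: in_keys_iff scaleR_poly_mapping.rep_eq)
  show "inner (r *\<^sub>R f) g = r * inner f g"
    by (subst (1 2) inner)
      (use keys_scaleR in \<open>auto simp: scaleR_poly_mapping.rep_eq sum_distrib_left\<close>)
  show "0 \<le> inner f f" unfolding inner_poly_mapping_def by (rule sum_nonneg) simp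
  show "inner f f = 0 \<longleftrightarrow> f = 0"
    unfolding inner_poly_mapping_def
    by (subst sum_nonneg_eq_0_iff) (auto simp: in_keys_iff intro: poly_mapping_eqI)
  show "norm f = sqrt (inner f f)" by (rule norm_poly_mapping_def)
qed (rule sgn_poly_mapping_def dist_poly_mapping_def uniformity_poly_mapping_def open_poly_mapping_def)+

end

lemma lookup_scaleR: "Poly_Mapping.lookup (r *\<^sub>R h) k = r *\<^sub>R Poly_Mapping.lookup h k"
  by (rule fun_cong[OF scaleR_poly_mapping.rep_eq])

lemma lookup_map_times:
  "Poly_Mapping.lookup (Poly_Mapping.map ((*) c) h) k = c * Poly_Mapping.lookup h k"
  for c :: complex
  by (simp add: map.rep_eq when_def)

lemma inner_map_times:
  "inner (Poly_Mapping.map ((*) c) g) h = inner g (Poly_Mapping.map ((*) (cnj c)) h)"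
  for g h :: "'x \<Rightarrow>\<^sub>0 complex"
proof -
  have "inner (Poly_Mapping.map ((*) c) g) h
      = (\<Sum>k\<in>Poly_Mapping.keys g. inner (c * Poly_Mapping.lookup g k) (Poly_Mapping.lookup h k))"
    by (subst inner_poly_mapping_superset[of "Poly_Mapping.keys g"])
      (auto simp: lookup_map_times in_keys_iff)
  then show ?thesis
    by (simp add: inner_poly_mapping_def lookup_map_times inner_complex_def algebra_simps)
qed

lemma norm_map_times: "norm (Poly_Mapping.map ((*) c) h) = cmod c * norm h"
  for h :: "'x \<Rightarrow>\<^sub>0 complex"
proof -
  have "Poly_Mapping.map ((*) (cnj c)) (Poly_Mapping.map ((*) c) h) = (cmod c)\<^sup>2 *\<^sub>R h"
  proof (rule poly_mapping_eqI)
    fix k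
    have "cnj c * c = of_real ((cmod c)\<^sup>2)" by (subst complex_norm_square) (rule mult.commute)
    then have "cnj c * (c * z) = (cmod c)\<^sup>2 *\<^sub>R z" for z
      by (simp add: mult.assoc[symmetric] scaleR_conv_of_real)
    then show "Poly_Mapping.lookup (Poly_Mapping.map ((*) (cnj c)) (Poly_Mapping.map ((*) c) h)) k
        = Poly_Mapping.lookup ((cmod c)\<^sup>2 *\<^sub>R h) k"
      by (simp only: lookup_map_times lookup_scaleR)
  qed
  then have "inner (Poly_Mapping.map ((*) c) h) (Poly_Mapping.map ((*) c) h) = (cmod c)\<^sup>2 * inner h h"
    by (simp only: inner_map_times inner_scaleR_right)
  then show ?thesis
    by (simp add: norm_eq_sqrt_inner real_sqrt_mult)
qed

section \<open>Operators given by partial bijections\<close>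

text \<open>
  On a space of functions on a set, the generators of a graph algebra and all words in them act by
  partial bijections of the set.
\<close>
definition partial_inverses :: "('x \<rightharpoonup> 'y) \<Rightarrow> ('y \<rightharpoonup> 'x) \<Rightarrow> bool" where
  "partial_inverses \<phi> \<psi> \<longleftrightarrow> (\<forall>s t. \<phi> s = Some t \<longleftrightarrow> \<psi> t = Some s)"

text \<open>
  Only meaningful if \<open>\<phi>\<close> is injective on its domain: otherwise the support may be infinite.
\<close>
definition pull :: "('x \<rightharpoonup> 'x) \<Rightarrow> ('x \<Rightarrow>\<^sub>0 complex) \<Rightarrow> ('x \<Rightarrow>\<^sub>0 complex)" where
  "pull \<phi> h = Abs_poly_mapping (\<lambda>s. case \<phi> s of None \<Rightarrow> 0 | Some t \<Rightarrow> Poly_Mapping.lookup h t)"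

lemma lookup_pull:
  assumes "partial_inverses \<phi> \<psi>"
  shows "Poly_Mapping.lookup (pull \<phi> h) s = (case \<phi> s of None \<Rightarrow> 0 | Some t \<Rightarrow> Poly_Mapping.lookup h t)"
proof -
  have "{s. (case \<phi> s of None \<Rightarrow> 0 | Some t \<Rightarrow> Poly_Mapping.lookup h t) \<noteq> 0}
      \<subseteq> (the \<circ> \<psi>) ` Poly_Mapping.keys h"
  proof
    fix s assume "s \<in> {s. (case \<phi> s of None \<Rightarrow> 0 | Some t \<Rightarrow> Poly_Mapping.lookup h t) \<noteq> 0}"
    then obtain t where t: "\<phi> s = Some t" "Poly_Mapping.lookup h t \<noteq> 0"
      by (auto split: option.splits)
    then have "\<psi> t = Some s" using assms by (simp add: partial_inverses_def)
    with t show "s \<in> (the \<circ> \<psi>) ` Poly_Mapping.keys h"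
      by (intro image_eqI[of _ _ t]) (auto simp: in_keys_iff)
  qed
  then have "finite {s. (case \<phi> s of None \<Rightarrow> 0 | Some t \<Rightarrow> Poly_Mapping.lookup h t) \<noteq> 0}"
    by (rule finite_subset) simp
  then show ?thesis unfolding pull_def by simp
qed

lemma partial_inverses_sym: "partial_inverses \<phi> \<psi> \<Longrightarrow> partial_inverses \<psi> \<phi>"
  by (simp add: partial_inverses_def)

lemma inner_pull:
  assumes inv: "partial_inverses \<phi> \<psi>"
  shows "inner (pull \<phi> g) h = inner g (pull \<psi> h)"
proof -
  let ?I = "{s \<in> Poly_Mapping.keys (pull \<phi> g). s \<in> Poly_Mapping.keys h}"
  let ?J = "{t \<in> Poly_Mapping.keys g. t \<in> Poly_Mapping.keys (pull \<psi> h)}"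
  note lk = lookup_pull[OF inv] lookup_pull[OF partial_inverses_sym[OF inv]]
  have pi: "\<phi> s = Some t \<longleftrightarrow> \<psi> t = Some s" for s t
    using inv by (simp add: partial_inverses_def)
  have "inner (pull \<phi> g) h = (\<Sum>s\<in>?I. inner (Poly_Mapping.lookup (pull \<phi> g) s) (Poly_Mapping.lookup h s))"
    unfolding inner_poly_mapping_def by (intro sum.mono_neutral_right) (auto simp: in_keys_iff)
  also have "\<dots> = (\<Sum>t\<in>?J. inner (Poly_Mapping.lookup g t) (Poly_Mapping.lookup (pull \<psi> h) t))"
  proof (rule sum.reindex_bij_witness[where i = "the \<circ> \<psi>" and j = "the \<circ> \<phi>"])
    fix s assume "s \<in> ?I"
    then obtain t where t: "\<phi> s = Some t" "Poly_Mapping.lookup g t \<noteq> 0" "Poly_Mapping.lookup h s \<noteq> 0"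
      by (auto simp: in_keys_iff lk split: option.splits)
    then have "\<psi> t = Some s" by (simp add: pi)
    with t show "(the \<circ> \<psi>) ((the \<circ> \<phi>) s) = s" "(the \<circ> \<phi>) s \<in> ?J"
      "inner (Poly_Mapping.lookup g ((the \<circ> \<phi>) s)) (Poly_Mapping.lookup (pull \<psi> h) ((the \<circ> \<phi>) s))
        = inner (Poly_Mapping.lookup (pull \<phi> g) s) (Poly_Mapping.lookup h s)"
      by (simp_all add: in_keys_iff lk)
  next
    fix t assume "t \<in> ?J"
    then obtain s where s: "\<psi> t = Some s" "Poly_Mapping.lookup g t \<noteq> 0" "Poly_Mapping.lookup h s \<noteq> 0"
      by (auto simp: in_keys_iff lk split: option.splits)
    then have "\<phi> s = Some t" by (simp add: pi)
    with s show "(the \<circ> \<phi>) ((the \<circ> \<psi>) t) = t" "(the \<circ> \<psi>) t \<in> ?I"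
      by (simp_all add: in_keys_iff lk)
  qed
  also have "\<dots> = inner g (pull \<psi> h)"
    unfolding inner_poly_mapping_def by (intro sum.mono_neutral_left) (auto simp: in_keys_iff)
  finally show ?thesis .
qed

text \<open>
  The adjoint of \<open>pull \<phi>\<close> is \<open>pull \<psi>\<close>, and their product only restricts a function to the domain of \<open>\<psi>\<close>.
\<close>
lemma norm_pull_le:
  assumes inv: "partial_inverses \<phi> \<psi>"
  shows "norm (pull \<phi> h) \<le> norm h"
proof -
  have lookup: "Poly_Mapping.lookup (pull \<psi> (pull \<phi> h)) t
      = (if t \<in> dom \<psi> then Poly_Mapping.lookup h t else 0)" for t
  proof (cases "\<psi> t")
    case None
    then show ?thesis by (simp add: lookup_pull[OF partial_inverses_sym[OF inv]] domIff)
  next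
    case (Some s)
    then have "\<phi> s = Some t" using inv by (simp add: partial_inverses_def)
    with Some show ?thesis
      by (simp add: lookup_pull[OF inv] lookup_pull[OF partial_inverses_sym[OF inv]] domIff)
  qed
  have "inner (pull \<phi> h) (pull \<phi> h) = inner h (pull \<psi> (pull \<phi> h))"
    by (rule inner_pull[OF inv])
  also have "\<dots> \<le> inner h h"
    unfolding inner_poly_mapping_def by (intro sum_mono) (simp add: lookup)
  finally show ?thesis by (simp add: norm_eq_sqrt_inner)
qed

lemma pull_add:
  assumes "partial_inverses \<phi> \<psi>"
  shows "pull \<phi> (g + h) = pull \<phi> g + pull \<phi> h"
  by (rule poly_mapping_eqI) (simp add: lookup_pull[OF assms] lookup_add split: option.splits)

lemma pull_scaleR:
  assumes "partial_inverses \<phi> \<psi>"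
  shows "pull \<phi> (r *\<^sub>R h) = r *\<^sub>R pull \<phi> h"
  by (rule poly_mapping_eqI) (simp add: lookup_pull[OF assms] lookup_scaleR split: option.splits)

lemma pull_map_times:
  assumes "partial_inverses \<phi> \<psi>"
  shows "pull \<phi> (Poly_Mapping.map ((*) c) h) = Poly_Mapping.map ((*) c) (pull \<phi> h)"
  by (rule poly_mapping_eqI) (simp add: lookup_pull[OF assms] lookup_map_times split: option.splits)

lemma bounded_linear_pull:
  assumes "partial_inverses \<phi> \<psi>"
  shows "bounded_linear (pull \<phi>)"
  by (rule bounded_linear_intro[where K = 1])
    (simp_all add: pull_add[OF assms] pull_scaleR[OF assms] norm_pull_le[OF assms])

section \<open>The seminorm of a representation of the free *-algebra\<close>

text \<open>
  The C*-identity for a pair of adjoint operators: \<open>\<parallel>T h\<parallel>\<^sup>2\<close> is the inner product of \<open>T' (T h)\<close> and \<open>h\<close>, which bounds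
  \<open>\<parallel>T\<parallel>\<^sup>2\<close> by \<open>\<parallel>T' \<circ> T\<parallel>\<close>; by symmetry \<open>T\<close> and \<open>T'\<close> have the same norm, which is the other inequality.
\<close>
lemma onorm_adjoint_compose:
  fixes T T' :: "'h::real_inner \<Rightarrow> 'h"
  assumes T: "bounded_linear T" and T': "bounded_linear T'"
    and adjoint: "\<And>g h. inner (T' g) h = inner g (T h)"
  shows "onorm (T' \<circ> T) = (onorm T)\<^sup>2"
proof -
  have square_le: "(onorm A)\<^sup>2 \<le> onorm (B \<circ> A)"
    if A: "bounded_linear A" and B: "bounded_linear B" and adj: "\<And>g h. inner (B g) h = inner g (A h)"
    for A B :: "'h \<Rightarrow> 'h"
  proof -
    have BA: "bounded_linear (B \<circ> A)" using bounded_linear_compose[OF B A] by (simp add: o_def)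
    have "norm (A h) \<le> sqrt (onorm (B \<circ> A)) * norm h" for h
    proof (rule power2_le_imp_le)
      have "(norm (A h))\<^sup>2 = inner (B (A h)) h" by (simp add: adj power2_norm_eq_inner)
      also have "\<dots> \<le> norm (B (A h)) * norm h" by (rule norm_cauchy_schwarz)
      also have "\<dots> \<le> onorm (B \<circ> A) * norm h * norm h"
        using onorm[OF BA, of h] by (intro mult_right_mono) auto
      also have "\<dots> = (sqrt (onorm (B \<circ> A)) * norm h)\<^sup>2"
        by (simp add: power_mult_distrib onorm_pos_le[OF BA] power2_eq_square[of "norm h"])
      finally show "(norm (A h))\<^sup>2 \<le> (sqrt (onorm (B \<circ> A)) * norm h)\<^sup>2" .
    qed (simp add: onorm_pos_le[OF BA])
    then have "onorm A \<le> sqrt (onorm (B \<circ> A))"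
      by (intro onorm_bound) (simp_all add: onorm_pos_le[OF BA])
    then show ?thesis
      using power_mono[OF _ onorm_pos_le[OF A], of _ 2] onorm_pos_le[OF BA] by fastforce
  qed
  have onorm_le: "onorm A \<le> onorm B"
    if A: "bounded_linear A" and B: "bounded_linear B" and adj: "\<And>g h. inner (B g) h = inner g (A h)"
    for A B :: "'h \<Rightarrow> 'h"
  proof (cases "onorm A = 0")
    case True then show ?thesis using onorm_pos_le[OF B] by simp
  next
    case False
    then have pos: "onorm A > 0" using onorm_pos_le[OF A] by simp
    have "onorm A * onorm A \<le> onorm B * onorm A"
      using square_le[OF A B adj] onorm_compose[OF B A] by (simp add: power2_eq_square)
    then show ?thesis using pos by simp
  qed
  have adjoint': "inner (T g) h = inner g (T' h)" for g h
    using adjoint[of h g] by (simp add: inner_commute)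
  have "onorm T' = onorm T" using onorm_le[OF T T' adjoint] onorm_le[OF T' T adjoint'] by simp
  then have "onorm (T' \<circ> T) \<le> (onorm T)\<^sup>2"
    using onorm_compose[OF T' T] by (simp add: power2_eq_square)
  then show ?thesis using square_le[OF T T' adjoint] by simp
qed

lemma map_times_add:
  "Poly_Mapping.map ((*) c) (g + h) = Poly_Mapping.map ((*) c) g + Poly_Mapping.map ((*) (c::complex)) h"
  "Poly_Mapping.map ((*) (c + d)) g = Poly_Mapping.map ((*) c) g + Poly_Mapping.map ((*) (d::complex)) g"
  by (rule poly_mapping_eqI; simp add: lookup_map_times lookup_add algebra_simps)+

lemma map_times_zero [simp]:
  "Poly_Mapping.map ((*) (0::complex)) g = 0" "Poly_Mapping.map ((*) (c::complex)) 0 = 0"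
  by (rule poly_mapping_eqI; simp add: lookup_map_times)+

lemma map_times_one [simp]: "Poly_Mapping.map ((*) (1::complex)) g = g"
  by (rule poly_mapping_eqI; simp add: lookup_map_times)

lemma map_times_map_times:
  "Poly_Mapping.map ((*) (c::complex)) (Poly_Mapping.map ((*) d) g) = Poly_Mapping.map ((*) (c * d)) g"
  by (rule poly_mapping_eqI; simp add: lookup_map_times)

lemma map_times_scaleR:
  "Poly_Mapping.map ((*) (c::complex)) (r *\<^sub>R g) = r *\<^sub>R Poly_Mapping.map ((*) c) g"
  by (rule poly_mapping_eqI; simp add: lookup_map_times lookup_scaleR)

lemma map_times_sum:
  "Poly_Mapping.map ((*) (c::complex)) (sum f A) = (\<Sum>a\<in>A. Poly_Mapping.map ((*) c) (f a))"
  by (induction A rule: infinite_finite_induct) (simp_all add: map_times_add)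

lemma bounded_linear_map_times:
  "bounded_linear (Poly_Mapping.map ((*) c) :: ('x \<Rightarrow>\<^sub>0 complex) \<Rightarrow> _)"
  by (rule bounded_linear_intro[where K = "cmod c"])
    (simp_all add: map_times_add map_times_scaleR norm_map_times mult.commute)

locale partial_bijection_representation =
  fixes \<phi> :: "('v + 'e) \<times> bool \<Rightarrow> ('x \<rightharpoonup> 'x)"
  assumes inverse_letters: "partial_inverses (\<phi> (l, b)) (\<phi> (l, \<not> b))"
begin

definition act_word :: "('v, 'e) word \<Rightarrow> ('x \<Rightarrow>\<^sub>0 complex) \<Rightarrow> ('x \<Rightarrow>\<^sub>0 complex)" where
  "act_word w = foldr (\<lambda>l T. pull (\<phi> l) \<circ> T) (letters w) id"

definition rep :: "('v, 'e) free_star \<Rightarrow> ('x \<Rightarrow>\<^sub>0 complex) \<Rightarrow> ('x \<Rightarrow>\<^sub>0 complex)" where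
  "rep x h = (\<Sum>w\<in>Poly_Mapping.keys x. Poly_Mapping.map ((*) (Poly_Mapping.lookup x w)) (act_word w h))"

lemma inverse_letter: "partial_inverses (\<phi> l) (\<phi> (fst l, \<not> snd l))"
  using inverse_letters[of "fst l" "snd l"] by simp

lemma act_word_simps:
  "act_word (Word []) h = h"
  "act_word (Word (l # ls)) h = pull (\<phi> l) (act_word (Word ls) h)"
  by (simp_all add: act_word_def)

lemma act_word_append: "act_word (Word (ls @ ls')) h = act_word (Word ls) (act_word (Word ls') h)"
  by (induction ls) (simp_all add: act_word_simps)

lemma act_word_add: "act_word (w + w') h = act_word w (act_word w' h)"
  by (cases w; cases w') (simp add: plus_word_def act_word_append)

lemma bounded_linear_act_word: "bounded_linear (act_word w)"
proof (cases w)
  case (Word ls)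
  have "bounded_linear (act_word (Word ls))"
  proof (induction ls)
    case Nil
    then show ?case by (simp add: act_word_simps[abs_def] bounded_linear_ident)
  next
    case (Cons l ls)
    then show ?case
      using bounded_linear_compose[OF bounded_linear_pull[OF inverse_letter]]
      by (simp add: act_word_simps[abs_def])
  qed
  with Word show ?thesis by simp
qed

lemma act_word_map_times:
  "act_word w (Poly_Mapping.map ((*) c) h) = Poly_Mapping.map ((*) c) (act_word w h)"
proof (cases w)
  case (Word ls)
  have "act_word (Word ls) (Poly_Mapping.map ((*) c) h) = Poly_Mapping.map ((*) c) (act_word (Word ls) h)"
    by (induction ls) (simp_all add: act_word_simps pull_map_times[OF inverse_letter])
  with Word show ?thesis by simp
qed

lemma inner_act_word_adj: "inner (act_word (w\<^sup>\<star>) g) h = inner g (act_word w h)"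
proof (cases w)
  case (Word ls)
  have "inner (act_word ((Word ls)\<^sup>\<star>) g) h = inner g (act_word (Word ls) h)"
  proof (induction ls arbitrary: g)
    case Nil
    then show ?case by (simp add: adj_word_def act_word_simps)
  next
    case (Cons l ls)
    have "partial_inverses (\<phi> (fst l, \<not> snd l)) (\<phi> l)"
      using inverse_letter[of l] by (rule partial_inverses_sym)
    then show ?case
      using Cons[of "act_word (Word [(fst l, \<not> snd l)]) g"]
      by (simp add: adj_word_def act_word_append act_word_simps inner_pull split_beta)
  qed
  with Word show ?thesis by simp
qed

lemma rep_superset:
  assumes "finite A" "Poly_Mapping.keys x \<subseteq> A"
  shows "rep x h = (\<Sum>w\<in>A. Poly_Mapping.map ((*) (Poly_Mapping.lookup x w)) (act_word w h))"
  unfolding rep_def using assms by (intro sum.mono_neutral_left) (auto simp: in_keys_iff)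

lemma rep_add: "rep (x + y) h = rep x h + rep y h"
proof -
  let ?A = "Poly_Mapping.keys x \<union> Poly_Mapping.keys y"
  have "Poly_Mapping.keys (x + y) \<subseteq> ?A" by (rule keys_add)
  then show ?thesis
    by (simp add: rep_superset[of ?A] lookup_add map_times_add sum.distrib)
qed

lemma rep_zero: "rep 0 h = 0" by (simp add: rep_def)

lemma rep_minus: "rep (x - y) h = rep x h - rep y h"
  using rep_add[of "x - y" y h] by simp

lemma rep_sum: "rep (sum f A) h = (\<Sum>a\<in>A. rep (f a) h)"
  by (induction A rule: infinite_finite_induct) (auto simp: rep_add rep_zero)

lemma rep_single: "rep (Poly_Mapping.single w c) h = Poly_Mapping.map ((*) c) (act_word w h)"
  by (subst rep_superset[of "{w}"]) auto

lemma bounded_linear_rep: "bounded_linear (rep x)"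
  unfolding rep_def[abs_def]
  by (intro bounded_linear_sum bounded_linear_compose[OF bounded_linear_map_times bounded_linear_act_word])

lemma rep_mult: "rep (x * y) h = rep x (rep y h)"
proof -
  have "x * y = (\<Sum>w\<in>Poly_Mapping.keys x. \<Sum>w'\<in>Poly_Mapping.keys y.
      Poly_Mapping.single (w + w') (Poly_Mapping.lookup x w * Poly_Mapping.lookup y w'))"
    by (subst (1) sum_of_monomials[of x], subst (1) sum_of_monomials[of y])
      (simp add: sum_product mult_single)
  then have "rep (x * y) h = (\<Sum>w\<in>Poly_Mapping.keys x. \<Sum>w'\<in>Poly_Mapping.keys y.
      Poly_Mapping.map ((*) (Poly_Mapping.lookup x w * Poly_Mapping.lookup y w'))
        (act_word w (act_word w' h)))"
    by (simp add: rep_sum rep_single act_word_add)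
  also have "\<dots> = rep x (rep y h)"
    unfolding rep_def
    by (simp add: linear_sum[OF bounded_linear.linear[OF bounded_linear_act_word]]
        act_word_map_times map_times_sum map_times_map_times)
  finally show ?thesis .
qed

lemma inner_rep_adj: "inner (rep (x\<^sup>\<star>) g) h = inner g (rep x h)"
proof -
  have "inner (rep (x\<^sup>\<star>) g) h = (\<Sum>w\<in>Poly_Mapping.keys x.
      inner (Poly_Mapping.map ((*) (cnj (Poly_Mapping.lookup x w))) (act_word (w\<^sup>\<star>) g)) h)"
    by (simp add: adj_poly_mapping_def rep_sum rep_single inner_sum_left adj_complex_def)
  also have "\<dots> = inner g (rep x h)"
    by (simp add: rep_def inner_sum_right inner_map_times inner_act_word_adj act_word_map_times)
  finally show ?thesis .
qed

lemma rep_map_times: "rep (Poly_Mapping.map ((*) c) x) h = Poly_Mapping.map ((*) c) (rep x h)"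
  by (subst rep_superset[of "Poly_Mapping.keys x"])
    (auto simp: rep_def in_keys_iff lookup_map_times map_times_sum map_times_map_times)

lemma rep_gen: "rep (gen l) = pull (\<phi> (l, False))" "rep ((gen l)\<^sup>\<star>) = pull (\<phi> (l, True))"
proof -
  show "rep (gen l) = pull (\<phi> (l, False))"
    by (simp add: fun_eq_iff gen_def rep_single act_word_simps)
  have "(gen l)\<^sup>\<star> = Poly_Mapping.single (Word [(l, True)]) 1"
    by (simp add: gen_def adj_poly_mapping_def adj_word_def adj_complex_def)
  then show "rep ((gen l)\<^sup>\<star>) = pull (\<phi> (l, True))"
    by (simp add: fun_eq_iff rep_single act_word_simps)
qed

lemma cstar_seminorm_onorm_rep: "cstar_seminorm_on F (\<lambda>x. onorm (rep x))"
  unfolding cstar_seminorm_on_def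
proof (intro conjI ballI allI)
  fix x y :: "('v, 'e) free_star" and c :: complex
  have add: "rep (x + y) = (\<lambda>h. rep x h + rep y h)" by (rule ext) (rule rep_add)
  show "onorm (rep (x + y)) \<le> onorm (rep x) + onorm (rep y)"
    unfolding add by (intro onorm_triangle bounded_linear_rep)
  have mult: "rep (z * y) = rep z \<circ> rep y" for z y by (rule ext) (simp add: rep_mult)
  show "onorm (rep (x * y)) \<le> onorm (rep x) * onorm (rep y)"
    unfolding mult by (intro onorm_compose bounded_linear_rep)
  show "onorm (rep (x\<^sup>\<star> * x)) = (onorm (rep x))\<^sup>2"
    unfolding mult by (intro onorm_adjoint_compose bounded_linear_rep inner_rep_adj)
  have "onorm (rep (Poly_Mapping.map ((*) c) x)) = onorm (\<lambda>h. cmod c *\<^sub>R rep x h)"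
    by (simp add: onorm_def rep_map_times norm_map_times)
  then show "onorm (rep (Poly_Mapping.map ((*) c) x)) = cmod c * onorm (rep x)"
    by (simp add: onorm_scaleR[OF bounded_linear_rep])
qed

end

section \<open>Vertex projections are nonzero\<close>

text \<open>
  The branching system behind the representation: each vertex \<open>v\<close> owns a copy \<open>{v} \<times> \<nat>\<close> of the natural
  numbers, and \<open>\<theta> v\<close> splits this copy into one copy for each edge leaving \<open>v\<close>, on which \<open>S\<^sub>e\<close> maps the copy
  owned by the range of \<open>e\<close>. As operators act by pulling back functions, an edge acts through the
  inverse of this bijection.
\<close>
definition vertex_arc_action ::
    "('v, 'e) pre_digraph \<Rightarrow> ('v \<Rightarrow> nat \<Rightarrow> 'e \<times> nat) \<Rightarrow> ('v + 'e) \<times> bool \<Rightarrow> ('v \<times> nat \<rightharpoonup> 'v \<times> nat)"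
  where
  "vertex_arc_action G \<theta> lb = (case lb of
     (Inl v, b) \<Rightarrow> (\<lambda>(w, n). if w = v then Some (w, n) else None)
   | (Inr e, False) \<Rightarrow> (\<lambda>(w, n). if e \<in> arcs G \<and> w = tail G e \<and> fst (\<theta> w n) = e
        then Some (head G e, snd (\<theta> w n)) else None)
   | (Inr e, True) \<Rightarrow> (\<lambda>(w, n). if e \<in> arcs G \<and> w = head G e
        then Some (tail G e, the_inv (\<theta> (tail G e)) (e, n)) else None))"

text \<open>
  A finite nonempty set times \<open>\<nat>\<close> is in bijection with \<open>\<nat>\<close>, so every vertex can share out its copy of \<open>\<nat>\<close>
  among the edges leaving it. The Cuntz--Krieger relations then hold exactly, while \<open>P\<^sub>v\<close> fixes the
  point mass at \<open>(v, 0)\<close>.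
\<close>
lemma vertex_projection_nonzero:
  fixes P :: "'v \<Rightarrow> 'a::cstar_algebra"
  assumes G: "wf_digraph G" and out: "\<forall>v\<in>verts G. finite (out_arcs G v) \<and> out_arcs G v \<noteq> {}"
    and univ: "graph_cstar_algebra G P S" and v: "v \<in> verts G"
  shows "P v \<noteq> 0"
proof -
  interpret wf_digraph G by (rule G)
  have "\<exists>\<theta>. bij_betw \<theta> (UNIV :: nat set) (out_arcs G v \<times> (UNIV :: nat set))" if "v \<in> verts G" for v
  proof -
    have "countable (out_arcs G v \<times> (UNIV :: nat set))" "infinite (out_arcs G v \<times> (UNIV :: nat set))"
      using out that by (auto simp: finite_cartesian_product_iff intro: countable_finite)
    then show ?thesis using bij_betw_from_nat_into by blast
  qed
  then obtain \<theta> where bij: "bij_betw (\<theta> v) (UNIV :: nat set) (out_arcs G v \<times> (UNIV :: nat set))"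
    if "v \<in> verts G" for v
    by metis
  have \<theta>_inv: "\<theta> v (the_inv (\<theta> v) (e, n)) = (e, n)" if "v \<in> verts G" "e \<in> out_arcs G v" for v e n
    using that bij[OF that(1)] by (intro f_the_inv_into_f) (auto simp: bij_betw_def)
  have inv_\<theta>: "the_inv (\<theta> v) (\<theta> v n) = n" if "v \<in> verts G" for v n
    using that bij[OF that(1)] by (intro the_inv_f_f) (auto simp: bij_betw_def)
  have \<theta>_out: "fst (\<theta> v n) \<in> out_arcs G v" if "v \<in> verts G" for v n
    using bij_betwE[OF bij[OF that]] by (auto simp only: mem_Times_iff)
  let ?\<phi> = "vertex_arc_action G \<theta>"
  have inverse: "partial_inverses (?\<phi> (l, b)) (?\<phi> (l, \<not> b))" for l b
  proof (cases l)
    case (Inl w)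
    then show ?thesis by (auto simp: vertex_arc_action_def partial_inverses_def split: if_splits)
  next
    case (Inr e)
    have "?\<phi> (Inr e, False) (w, n) = Some (w', n') \<longleftrightarrow> ?\<phi> (Inr e, True) (w', n') = Some (w, n)" for w n w' n'
    proof (cases "e \<in> arcs G \<and> w = tail G e \<and> w' = head G e")
      case True
      then have "\<theta> w (the_inv (\<theta> w) (e, n')) = (e, n')" "the_inv (\<theta> w) (\<theta> w n) = n"
        by (auto intro!: \<theta>_inv inv_\<theta>)
      then have "\<theta> w n = (e, n') \<longleftrightarrow> the_inv (\<theta> w) (e, n') = n" by metis
      with True show ?thesis by (auto simp: vertex_arc_action_def prod_eq_iff)
    qed (auto simp: vertex_arc_action_def)
    then have "partial_inverses (?\<phi> (Inr e, False)) (?\<phi> (Inr e, True))"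
      by (auto simp: partial_inverses_def)
    with Inr show ?thesis by (cases b) (auto intro: partial_inverses_sym)
  qed
  interpret partial_bijection_representation ?\<phi>
    by standard (rule inverse)
  have lookup: "Poly_Mapping.lookup (pull (?\<phi> lb) h) s
      = (case ?\<phi> lb s of None \<Rightarrow> 0 | Some t \<Rightarrow> Poly_Mapping.lookup h t)" for lb h s
    by (rule lookup_pull[OF inverse_letter])
  have zero: "onorm (rep x) = 0" if "\<And>h w n. Poly_Mapping.lookup (rep x h) (w, n) = 0" for x
  proof -
    have "rep x = (\<lambda>h. 0)" by (rule ext, rule poly_mapping_eqI) (use that in auto)
    then show ?thesis by (simp add: onorm_zero)
  qed
  let ?V = "\<lambda>v. gen (Inl v)" and ?A = "\<lambda>e. gen (Inr e)"
  have V: "Poly_Mapping.lookup (rep (?V v) h) (w, n) = (if w = v then Poly_Mapping.lookup h (w, n) else 0)"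
      "Poly_Mapping.lookup (rep ((?V v)\<^sup>\<star>) h) (w, n) = (if w = v then Poly_Mapping.lookup h (w, n) else 0)" for v h w n
    unfolding rep_gen lookup by (simp_all add: vertex_arc_action_def)
  have A: "Poly_Mapping.lookup (rep (?A e) h) (w, n)
      = (if w = tail G e \<and> fst (\<theta> w n) = e then Poly_Mapping.lookup h (head G e, snd (\<theta> w n)) else 0)"
      "Poly_Mapping.lookup (rep ((?A e)\<^sup>\<star>) h) (w, n)
      = (if w = head G e then Poly_Mapping.lookup h (tail G e, the_inv (\<theta> (tail G e)) (e, n)) else 0)"
    if "e \<in> arcs G" for e h w n
    unfolding rep_gen lookup using that by (auto simp: vertex_arc_action_def)
  have AA: "Poly_Mapping.lookup (rep (?A e) (rep ((?A e)\<^sup>\<star>) h)) (w, n)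
      = (if w = tail G e \<and> fst (\<theta> w n) = e then Poly_Mapping.lookup h (w, n) else 0)"
    if e: "e \<in> arcs G" for e h w n
  proof (cases "w = tail G e \<and> fst (\<theta> w n) = e")
    case True
    then have "(e, snd (\<theta> (tail G e) n)) = \<theta> (tail G e) n" by (metis prod.collapse)
    with True e show ?thesis by (simp add: A inv_\<theta>)
  qed (auto simp: A e)
  have "cuntz_krieger_mod (\<lambda>x. onorm (rep x) = 0) G ?V ?A"
    unfolding cuntz_krieger_mod_def
  proof (intro conjI ballI impI; (elim conjE)?; rule zero)
    fix v h w n
    show "Poly_Mapping.lookup (rep ((?V v)\<^sup>\<star> - ?V v) h) (w, n) = 0"
      "Poly_Mapping.lookup (rep (?V v * ?V v - ?V v) h) (w, n) = 0"
      by (simp_all add: rep_minus lookup_minus rep_mult V)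
  next
    fix v v' :: 'v and h w n assume "v \<noteq> v'"
    then show "Poly_Mapping.lookup (rep (?V v * ?V v') h) (w, n) = 0" by (simp add: rep_mult V)
  next
    fix e h w n assume e: "e \<in> arcs G"
    show "Poly_Mapping.lookup (rep ((?A e)\<^sup>\<star> * ?A e - ?V (head G e)) h) (w, n) = 0"
      using e by (simp add: rep_minus lookup_minus rep_mult V A \<theta>_inv)
    show "Poly_Mapping.lookup (rep (?V (tail G e) * (?A e * (?A e)\<^sup>\<star>) - ?A e * (?A e)\<^sup>\<star>) h) (w, n) = 0"
      using e by (simp add: rep_minus lookup_minus rep_mult V AA)
    fix f assume "f \<in> arcs G" "e \<noteq> f"
    then show "Poly_Mapping.lookup (rep ((?A e)\<^sup>\<star> * ?A f) h) (w, n) = 0"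
      using e by (simp add: rep_mult A \<theta>_inv)
  next
    fix v h w n assume v: "v \<in> verts G" and fin: "finite (out_arcs G v)"
    have "(\<Sum>e\<in>out_arcs G v. Poly_Mapping.lookup (rep (?A e * (?A e)\<^sup>\<star>) h) (w, n))
        = (\<Sum>e\<in>out_arcs G v. if fst (\<theta> v n) = e then if w = v then Poly_Mapping.lookup h (w, n) else 0 else 0)"
      by (intro sum.cong refl) (auto simp: rep_mult AA)
    also have "\<dots> = (if w = v then Poly_Mapping.lookup h (w, n) else 0)"
      by (subst sum.delta'[OF fin]) (use \<theta>_out[OF v, of n] in auto)
    finally show "Poly_Mapping.lookup (rep (?V v - (\<Sum>e\<in>out_arcs G v. ?A e * (?A e)\<^sup>\<star>)) h) (w, n) = 0"
      by (simp add: rep_minus rep_sum lookup_minus lookup_sum V)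
  qed
  moreover have "?V v \<in> free_star_algebra G"
    using v by (simp add: free_star_algebra_def gen_def zero_word_def InlI)
  ultimately have "onorm (rep (?V v)) \<le> norm (eval P S (?V v))"
    using univ cstar_seminorm_onorm_rep unfolding graph_cstar_algebra_def by blast
  moreover have "onorm (rep (gen (Inl v))) \<noteq> 0"
  proof
    assume "onorm (rep (gen (Inl v))) = 0"
    then have "rep (gen (Inl v)) (Poly_Mapping.single (v, 0) 1) = 0"
      using onorm_eq_0[OF bounded_linear_rep] by metis
    moreover have "Poly_Mapping.lookup (rep (gen (Inl v)) (Poly_Mapping.single (v, 0) 1)) (v, 0) = 1"
      by (simp add: V)
    ultimately show False by simp
  qed
  ultimately show ?thesis
    using onorm_pos_le[OF bounded_linear_rep, of "gen (Inl v)"] by (auto simp: eval_gen)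
qed

section \<open>C*-algebras and their homomorphisms\<close>

lemma scaleC_one [simp]: "1 *\<^sub>C x = (x::'a::cstar_algebra)"
  using scaleR_scaleC[of 1 x] by simp

lemma adj_minus: "(x - y)\<^sup>\<star> = x\<^sup>\<star> - (y::'a::cstar_algebra)\<^sup>\<star>"
  using adj_add[of "x - y" y] by simp

lemma norm_adj [simp]: "norm (x\<^sup>\<star>) = norm (x::'a::cstar_algebra)"
proof -
  have le: "norm y \<le> norm (y\<^sup>\<star>)" for y :: 'a
  proof (cases "y = 0")
    case False
    have "norm y * norm y \<le> norm (y\<^sup>\<star>) * norm y"
      using norm_mult_ineq[of "y\<^sup>\<star>" y] by (simp add: cstar_identity power2_eq_square)
    with False show ?thesis by simp
  qed simp
  show ?thesis using le[of x] le[of "x\<^sup>\<star>"] by (simp add: adj_adj)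
qed

lemma adj_mult_self_eq_0: "x\<^sup>\<star> * x = 0 \<longleftrightarrow> x = (0::'a::cstar_algebra)"
  using cstar_identity[of x] by auto

lemma mult_adj_self_eq_0: "x * x\<^sup>\<star> = 0 \<longleftrightarrow> x = (0::'a::cstar_algebra)"
  using adj_mult_self_eq_0[of "x\<^sup>\<star>"] norm_adj[of x] by (simp add: adj_adj) (metis norm_eq_zero norm_adj)

lemma bounded_linear_adj: "bounded_linear (adj :: 'a::cstar_algebra \<Rightarrow> 'a)"
  by (rule bounded_linear_intro[where K = 1]) (simp_all add: adj_add scaleR_scaleC adj_scaleC)

lemma bounded_linear_scaleC: "bounded_linear (\<lambda>x::'a::cstar_algebra. c *\<^sub>C x)"
  by (rule bounded_linear_intro[where K = "cmod c"])
    (simp_all add: scaleC_add_right scaleR_scaleC scaleC_scaleC norm_scaleC mult.commute)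

lemmas tendsto_adj = bounded_linear.tendsto[OF bounded_linear_adj]
lemmas tendsto_scaleC = bounded_linear.tendsto[OF bounded_linear_scaleC]
lemmas continuous_on_adj [continuous_intros] = bounded_linear.continuous_on[OF bounded_linear_adj]
lemmas continuous_on_scaleC [continuous_intros] = bounded_linear.continuous_on[OF bounded_linear_scaleC]

lemma cstar_subalgebraD:
  assumes "cstar_subalgebra B"
  shows "closed B" "0 \<in> B" "x \<in> B \<Longrightarrow> y \<in> B \<Longrightarrow> x + y \<in> B" "x \<in> B \<Longrightarrow> y \<in> B \<Longrightarrow> x * y \<in> B"
    "x \<in> B \<Longrightarrow> x\<^sup>\<star> \<in> B" "x \<in> B \<Longrightarrow> c *\<^sub>C x \<in> B"
  using assms by (auto simp: cstar_subalgebra_def)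

lemma cstar_subalgebra_sum: "cstar_subalgebra B \<Longrightarrow> (\<And>a. a \<in> A \<Longrightarrow> f a \<in> B) \<Longrightarrow> sum f A \<in> B"
  by (induction A rule: infinite_finite_induct) (auto simp: cstar_subalgebraD)

lemma cstar_subalgebra_hull: "cstar_subalgebra (cstar_subalgebra hull A)"
  by (rule hull_in) (auto simp: cstar_subalgebra_def intro!: closed_Inter)

lemma cstar_subalgebra_closure:
  fixes A :: "'a::cstar_algebra set"
  assumes "0 \<in> A" "\<And>x y. x \<in> A \<Longrightarrow> y \<in> A \<Longrightarrow> x + y \<in> A" "\<And>x y. x \<in> A \<Longrightarrow> y \<in> A \<Longrightarrow> x * y \<in> A"
    "\<And>x. x \<in> A \<Longrightarrow> x\<^sup>\<star> \<in> A" "\<And>x c. x \<in> A \<Longrightarrow> c *\<^sub>C x \<in> A"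
  shows "cstar_subalgebra (closure A)"
  unfolding cstar_subalgebra_def
proof (intro conjI ballI allI)
  show "0 \<in> closure A" using assms(1) closure_subset by blast
  fix x y assume "x \<in> closure A" "y \<in> closure A"
  then obtain f g where "\<And>n. f n \<in> A" "f \<longlonglongrightarrow> x" "\<And>n. g n \<in> A" "g \<longlonglongrightarrow> y"
    unfolding closure_sequential by blast
  then have "(\<lambda>n. f n + g n) \<longlonglongrightarrow> x + y" "\<And>n. f n + g n \<in> A"
    and "(\<lambda>n. f n * g n) \<longlonglongrightarrow> x * y" "\<And>n. f n * g n \<in> A"
    using assms by (auto intro: tendsto_add tendsto_mult)
  then show "x + y \<in> closure A" "x * y \<in> closure A"
    unfolding closure_sequential by (blast intro: exI[of _ "\<lambda>n. f n + g n"] exI[of _ "\<lambda>n. f n * g n"])+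
next
  fix x c assume "x \<in> closure A"
  then obtain f where "\<And>n. f n \<in> A" "f \<longlonglongrightarrow> x"
    unfolding closure_sequential by blast
  then have "(\<lambda>n. (f n)\<^sup>\<star>) \<longlonglongrightarrow> x\<^sup>\<star>" "\<And>n. (f n)\<^sup>\<star> \<in> A"
    and "(\<lambda>n. c *\<^sub>C f n) \<longlonglongrightarrow> c *\<^sub>C x" "\<And>n. c *\<^sub>C f n \<in> A"
    using assms by (auto intro: tendsto_adj tendsto_scaleC)
  then show "x\<^sup>\<star> \<in> closure A" "c *\<^sub>C x \<in> closure A"
    unfolding closure_sequential by (blast intro: exI[of _ "\<lambda>n. (f n)\<^sup>\<star>"] exI[of _ "\<lambda>n. c *\<^sub>C f n"])+
qed simp

lemma cstar_homD:
  assumes "cstar_hom \<phi>"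
  shows "continuous_on UNIV \<phi>" "\<phi> (x + y) = \<phi> x + \<phi> y" "\<phi> (x * y) = \<phi> x * \<phi> y"
    "\<phi> (x\<^sup>\<star>) = (\<phi> x)\<^sup>\<star>" "\<phi> (c *\<^sub>C x) = c *\<^sub>C \<phi> x" "\<phi> 0 = 0"
proof -
  show *: "continuous_on UNIV \<phi>" "\<phi> (x + y) = \<phi> x + \<phi> y" "\<phi> (x * y) = \<phi> x * \<phi> y"
    "\<phi> (x\<^sup>\<star>) = (\<phi> x)\<^sup>\<star>" "\<phi> (c *\<^sub>C x) = c *\<^sub>C \<phi> x" for c x y
    using assms by (auto simp: cstar_hom_def)
  show "\<phi> 0 = 0" using *(2)[of 0 0] by simp
qed

lemma cstar_hom_sum: "cstar_hom \<phi> \<Longrightarrow> \<phi> (sum f A) = (\<Sum>a\<in>A. \<phi> (f a))"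
  by (induction A rule: infinite_finite_induct) (auto simp: cstar_homD)

text \<open>
  The set on which two homomorphisms agree is a C*-subalgebra.
\<close>
lemma cstar_homs_eqI:
  assumes hull: "cstar_subalgebra hull X = UNIV" and hom: "cstar_hom \<phi>" "cstar_hom \<psi>"
    and eq: "\<And>x. x \<in> X \<Longrightarrow> \<phi> x = \<psi> x"
  shows "\<phi> = \<psi>"
proof -
  have "closed {x. \<phi> x = \<psi> x}"
    using hom by (intro closed_Collect_eq cstar_homD)
  then have "cstar_subalgebra {x. \<phi> x = \<psi> x}"
    using hom by (simp add: cstar_subalgebra_def cstar_homD)
  then have "cstar_subalgebra hull X \<subseteq> {x. \<phi> x = \<psi> x}"
    using eq by (intro hull_minimal) auto
  then show ?thesis using hull by auto
qed

section \<open>Homomorphisms from the universal property\<close>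

lemma poly_mapping_keys_adj:
  "Poly_Mapping.keys (x\<^sup>\<star>) \<subseteq> adj ` Poly_Mapping.keys (x :: ('v, 'e) free_star)"
  unfolding adj_poly_mapping_def
  by (rule order_trans[OF keys_sum]) (auto simp: keys_single split: if_splits)

lemma free_star_algebra_closed:
  shows "0 \<in> free_star_algebra G"
    and "x \<in> free_star_algebra G \<Longrightarrow> y \<in> free_star_algebra G \<Longrightarrow> x + y \<in> free_star_algebra G"
    and "x \<in> free_star_algebra G \<Longrightarrow> y \<in> free_star_algebra G \<Longrightarrow> x * y \<in> free_star_algebra G"
    and "x \<in> free_star_algebra G \<Longrightarrow> x\<^sup>\<star> \<in> free_star_algebra G"
    and "x \<in> free_star_algebra G \<Longrightarrow> Poly_Mapping.map ((*) c) x \<in> free_star_algebra G"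
    and "v \<in> verts G \<Longrightarrow> gen (Inl v) \<in> free_star_algebra G"
    and "e \<in> arcs G \<Longrightarrow> gen (Inr e) \<in> free_star_algebra G"
proof -
  define W where "W = {w :: ('a, 'b) word. w \<noteq> 0 \<and> fst ` set (letters w) \<subseteq> verts G <+> arcs G}"
  have F: "x \<in> free_star_algebra G \<longleftrightarrow> Poly_Mapping.keys x \<subseteq> W" for x
    by (auto simp: free_star_algebra_def W_def)
  have W: "w + w' \<in> W" "w\<^sup>\<star> \<in> W" if "w \<in> W" "w' \<in> W" for w w'
    using that by (cases w; cases w'; force simp: W_def plus_word_def zero_word_def adj_word_def)+
  show "0 \<in> free_star_algebra G" by (simp add: F)
  show "x \<in> free_star_algebra G \<Longrightarrow> y \<in> free_star_algebra G \<Longrightarrow> x + y \<in> free_star_algebra G"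
    unfolding F using keys_add[of x y] by blast
  show "x \<in> free_star_algebra G \<Longrightarrow> y \<in> free_star_algebra G \<Longrightarrow> x * y \<in> free_star_algebra G"
    unfolding F using keys_mult[of x y] W(1) by blast
  show "x \<in> free_star_algebra G \<Longrightarrow> x\<^sup>\<star> \<in> free_star_algebra G"
    unfolding F using poly_mapping_keys_adj[of x] W(2) by blast
  show "x \<in> free_star_algebra G \<Longrightarrow> Poly_Mapping.map ((*) c) x \<in> free_star_algebra G"
    unfolding F by (auto simp: in_keys_iff lookup_map_times)
  show "v \<in> verts G \<Longrightarrow> gen (Inl v) \<in> free_star_algebra G"
    "e \<in> arcs G \<Longrightarrow> gen (Inr e) \<in> free_star_algebra G"
    by (simp_all add: free_star_algebra_def gen_def zero_word_def InlI InrI)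
qed

lemma eval_mult_free_star_algebra:
  assumes "x \<in> free_star_algebra G" "y \<in> free_star_algebra G"
  shows "eval P S (x * y) = eval P S x * eval P S y"
  using assms by (intro eval_mult) (auto simp: free_star_algebra_def)

lemma closure_eval_image:
  assumes "graph_cstar_algebra G P S"
  shows "closure (eval P S ` free_star_algebra G) = UNIV"
proof -
  let ?A = "eval P S ` free_star_algebra G"
  have "cstar_subalgebra (closure ?A)"
  proof (rule cstar_subalgebra_closure)
    show "0 \<in> ?A" using free_star_algebra_closed(1) by force
    fix x y c assume "x \<in> ?A" "y \<in> ?A"
    then obtain x' y' where xy: "x = eval P S x'" "y = eval P S y'"
        "x' \<in> free_star_algebra G" "y' \<in> free_star_algebra G" by blast
    then show "x + y \<in> ?A" "x * y \<in> ?A" "x\<^sup>\<star> \<in> ?A" "c *\<^sub>C x \<in> ?A"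
      by (simp_all add: eval_add[symmetric] eval_mult_free_star_algebra[symmetric] eval_adj[symmetric]
          eval_scale[symmetric] free_star_algebra_closed imageI)
  qed
  moreover have "P ` verts G \<union> S ` arcs G \<subseteq> ?A"
    using free_star_algebra_closed(6,7)[of _ G] by (force simp: eval_gen[of P S, symmetric])
  ultimately have "cstar_subalgebra hull (P ` verts G \<union> S ` arcs G) \<subseteq> closure ?A"
    using closure_subset by (intro hull_minimal) blast+
  then show ?thesis using assms by (auto simp: graph_cstar_algebra_def)
qed

text \<open>
  The inequality of norms makes \<open>eval P S x \<mapsto> eval Q T x\<close> well defined and 1-Lipschitz on a dense
  subset. It extends by uniform continuity, and the algebraic identities extend because both sides are
  continuous.
\<close>
theorem universal_cstar_hom:
  fixes P :: "'v \<Rightarrow> 'a::cstar_algebra" and Q :: "'v \<Rightarrow> 'b::cstar_algebra"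
  assumes univ: "graph_cstar_algebra G P S" and ck: "cuntz_krieger_family G Q T"
  shows "\<exists>\<phi>. cstar_hom \<phi> \<and> (\<forall>v\<in>verts G. \<phi> (P v) = Q v) \<and> (\<forall>e\<in>arcs G. \<phi> (S e) = T e)"
proof -
  let ?F = "free_star_algebra G"
  define f where "f a = eval Q T (SOME x. x \<in> ?F \<and> eval P S x = a)" for a
  have diff: "norm (eval Q T x - eval Q T y) \<le> norm (eval P S x - eval P S y)"
    if "x \<in> ?F" "y \<in> ?F" for x y
  proof -
    have "x - y = x + Poly_Mapping.map ((*) (-1)) y"
      by (rule poly_mapping_eqI) (simp add: lookup_minus lookup_add lookup_map_times)
    then have "x - y \<in> ?F" using that by (simp only: free_star_algebra_closed)
    from norm_eval_le[OF univ ck this] show ?thesis by (simp add: eval_minus)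
  qed
  have f_eval: "f (eval P S x) = eval Q T x" if "x \<in> ?F" for x
  proof -
    let ?y = "SOME y. y \<in> ?F \<and> eval P S y = eval P S x"
    have "?y \<in> ?F \<and> eval P S ?y = eval P S x"
      by (rule someI[of _ x]) (use that in simp)
    then show ?thesis using diff[of ?y x] that by (simp add: f_def)
  qed
  have "uniformly_continuous_on (eval P S ` ?F) f"
  proof (rule lipschitz_on_uniformly_continuous)
    show "1-lipschitz_on (eval P S ` ?F) f"
      by (auto simp: lipschitz_on_def f_eval dist_norm diff)
  qed
  then obtain g where uc: "uniformly_continuous_on (closure (eval P S ` ?F)) g"
    and fg: "\<And>a. a \<in> eval P S ` ?F \<Longrightarrow> f a = g a"
    by (rule uniformly_continuous_on_extension_on_closure) blast
  have cont: "continuous_on UNIV g"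
    using uniformly_continuous_imp_continuous[OF uc] closure_eval_image[OF univ] by simp
  have g: "g (eval P S x) = eval Q T x" if "x \<in> ?F" for x
    using fg[of "eval P S x"] f_eval[OF that] that by simp
  have cont': "continuous_on UNIV (\<lambda>a. g (h a))" if "continuous_on UNIV h" for h
    using continuous_on_compose2[OF cont that] by simp
  \<comment> \<open>Identities between continuous maps need to be checked on the dense subset only.\<close>
  have ext: "h a = k a" if "continuous_on UNIV h" "continuous_on UNIV k"
    "\<And>x. x \<in> ?F \<Longrightarrow> h (eval P S x) = k (eval P S x)" for h k :: "'a \<Rightarrow> 'b" and a
  proof -
    have "closure (eval P S ` ?F) \<subseteq> {a. h a = k a}"
      using that by (intro closure_minimal closed_Collect_eq) auto
    then show ?thesis using closure_eval_image[OF univ] by auto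
  qed
  have "cstar_hom g"
    unfolding cstar_hom_def
  proof (intro conjI allI)
    fix a b c
    show "g (a\<^sup>\<star>) = (g a)\<^sup>\<star>"
      by (rule ext[of "\<lambda>a. g (a\<^sup>\<star>)"])
        (intro cont' continuous_intros cont | simp add: eval_adj[symmetric] g free_star_algebra_closed)+
    show "g (c *\<^sub>C a) = c *\<^sub>C g a"
      by (rule ext[of "\<lambda>a. g (c *\<^sub>C a)"])
        (intro cont' continuous_intros cont | simp add: eval_scale[symmetric] g free_star_algebra_closed)+
    have "g (a + eval P S y) = g a + g (eval P S y)" if "y \<in> ?F" for a y
      by (rule ext[of "\<lambda>a. g (a + eval P S y)"])
        (intro cont' continuous_intros cont
          | simp add: eval_add[symmetric] g free_star_algebra_closed that)+
    then show "g (a + b) = g a + g b"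
      by - (rule ext[of "\<lambda>b. g (a + b)"], (intro cont' continuous_intros cont | simp)+)
    have "g (a * eval P S y) = g a * g (eval P S y)" if "y \<in> ?F" for a y
      by (rule ext[of "\<lambda>a. g (a * eval P S y)"])
        (intro cont' continuous_intros cont
          | simp add: eval_mult_free_star_algebra[symmetric] g free_star_algebra_closed that)+
    then show "g (a * b) = g a * g b"
      by - (rule ext[of "\<lambda>b. g (a * b)"], (intro cont' continuous_intros cont | simp)+)
  qed (rule cont)
  moreover have "g (P v) = Q v" if "v \<in> verts G" for v
    using g[OF free_star_algebra_closed(6)[OF that]] by (simp add: eval_gen)
  moreover have "g (S e) = T e" if "e \<in> arcs G" for e
    using g[OF free_star_algebra_closed(7)[OF that]] by (simp add: eval_gen)
  ultimately show ?thesis by blast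
qed

section \<open>Paths in a directed graph\<close>

definition path_append :: "('v, 'e) path \<Rightarrow> ('v, 'e) path \<Rightarrow> ('v, 'e) path" where
  "path_append \<mu> \<nu> = (fst \<mu>, snd \<mu> @ snd \<nu>)"

context wf_digraph
begin

lemma paths_iff: "\<mu> \<in> paths G n \<longleftrightarrow> length (snd \<mu>) = n \<and> awalk (fst \<mu>) (snd \<mu>) (path_range G \<mu>)"
  by (cases \<mu>) (auto simp: paths_def path_range_def)

lemma paths_0: "\<alpha> \<in> paths G 0 \<longleftrightarrow> (\<exists>v\<in>verts G. \<alpha> = (v, []))"
  by (cases \<alpha>) (auto simp: paths_def awalk_Nil_iff)

lemma paths_verts:
  assumes "\<alpha> \<in> paths G n"
  shows "fst \<alpha> \<in> verts G" "path_range G \<alpha> \<in> verts G"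
  using assms unfolding paths_iff by (auto intro: awalk_hd_in_verts awalk_last_in_verts)

lemma path_range_Nil [simp]: "path_range G (v, []) = v"
  by (simp add: path_range_def)

lemma path_cons_paths:
  "e \<in> arcs G \<Longrightarrow> \<alpha> \<in> paths G n \<Longrightarrow> fst \<alpha> = head G e \<Longrightarrow> path_cons G e \<alpha> \<in> paths G (Suc n)"
  by (auto simp: paths_def path_cons_def awalk_Cons_iff)

lemma path_range_cons: "fst \<alpha> = head G e \<Longrightarrow> path_range G (path_cons G e \<alpha>) = path_range G \<alpha>"
  by (simp add: path_range_def path_cons_def)

lemma fst_path_cons [simp]: "fst (path_cons G e \<alpha>) = tail G e"
  by (simp add: path_cons_def)

lemma path_cons_eq_iff:
  "fst \<alpha> = head G e \<Longrightarrow> fst \<beta> = head G f \<Longrightarrow>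
    path_cons G e \<alpha> = path_cons G f \<beta> \<longleftrightarrow> e = f \<and> \<alpha> = \<beta>"
  by (auto simp: path_cons_def prod_eq_iff)

lemma paths_SucE:
  assumes "\<mu> \<in> paths G (Suc n)"
  obtains e \<alpha> where "e \<in> arcs G" "\<alpha> \<in> paths G n" "fst \<alpha> = head G e" "\<mu> = path_cons G e \<alpha>"
proof -
  from assms obtain e es where es: "snd \<mu> = e # es" by (cases "snd \<mu>") (auto simp: paths_def)
  show ?thesis
    by (rule that[of e "(head G e, es)"])
      (use assms es in \<open>cases \<mu>; auto simp: paths_def path_cons_def awalk_Cons_iff\<close>)+
qed

lemma paths_induct [consumes 1, case_names Nil Cons]:
  assumes "\<mu> \<in> paths G n"
    and "\<And>v. v \<in> verts G \<Longrightarrow> Q 0 (v, [])"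
    and "\<And>n e \<alpha>. e \<in> arcs G \<Longrightarrow> \<alpha> \<in> paths G n \<Longrightarrow> fst \<alpha> = head G e \<Longrightarrow> Q n \<alpha> \<Longrightarrow> Q (Suc n) (path_cons G e \<alpha>)"
  shows "Q n \<mu>"
  using assms(1)
proof (induction n arbitrary: \<mu>)
  case 0
  then show ?case using assms(2) by (auto simp: paths_0)
next
  case (Suc n)
  from Suc.prems show ?case by (rule paths_SucE) (auto intro: assms(3) Suc.IH)
qed

lemma path_append_paths:
  assumes "\<mu> \<in> paths G m" "\<nu> \<in> paths G n" "fst \<nu> = path_range G \<mu>"
  shows "path_append \<mu> \<nu> \<in> paths G (m + n)" "path_range G (path_append \<mu> \<nu>) = path_range G \<nu>"
  using assms by (auto simp: paths_iff path_append_def path_range_def awlast_append)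

lemma paths_addE:
  assumes "\<mu> \<in> paths G (m + n)"
  obtains \<alpha> \<nu> where "\<alpha> \<in> paths G m" "\<nu> \<in> paths G n" "fst \<nu> = path_range G \<alpha>" "\<mu> = path_append \<alpha> \<nu>"
proof -
  let ?\<alpha> = "(fst \<mu>, take m (snd \<mu>))"
  let ?\<nu> = "(path_range G ?\<alpha>, drop m (snd \<mu>))"
  have "awalk (fst \<mu>) (take m (snd \<mu>) @ drop m (snd \<mu>)) (path_range G \<mu>)" "length (snd \<mu>) = m + n"
    using assms by (simp_all add: paths_iff)
  then have "?\<alpha> \<in> paths G m" "?\<nu> \<in> paths G n"
    unfolding awalk_append_iff by (auto simp: paths_iff path_range_def)
  then show ?thesis
    by (rule that) (simp_all add: path_append_def)
qed

lemma path_snoc_eq_append: "path_snoc \<beta> g = path_append \<beta> (v, [g])"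
  by (simp add: path_snoc_def path_append_def)

lemma arc_path: "g \<in> arcs G \<Longrightarrow> (tail G g, [g]) \<in> paths G 1"
  by (auto simp: paths_def awalk_Nil_iff awalk_Cons_iff)

lemma path_snoc_paths:
  assumes "\<beta> \<in> paths G n" "g \<in> arcs G" "tail G g = path_range G \<beta>"
  shows "path_snoc \<beta> g \<in> paths G (Suc n)"
  using path_append_paths(1)[OF assms(1) arc_path[OF assms(2)]] assms(3)
  by (simp add: path_snoc_eq_append[of _ _ "tail G g"])

lemma path_snocE:
  assumes "\<mu> \<in> paths G (Suc n)"
  obtains \<beta> g where "\<beta> \<in> paths G n" "g \<in> arcs G" "tail G g = path_range G \<beta>" "\<mu> = path_snoc \<beta> g"
proof -
  have "\<mu> \<in> paths G (n + 1)" using assms by simp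
  then obtain \<alpha> \<nu> where "\<alpha> \<in> paths G n" "\<nu> \<in> paths G 1" "fst \<nu> = path_range G \<alpha>" "\<mu> = path_append \<alpha> \<nu>"
    by (rule paths_addE)
  moreover from this(2) have "\<nu> \<in> paths G (Suc 0)" by simp
  then obtain g where "g \<in> arcs G" "\<nu> = (tail G g, [g])"
    by (rule paths_SucE) (auto simp: paths_0 path_cons_def)
  ultimately show ?thesis
    using that path_snoc_eq_append[of \<alpha> g] by simp
qed

lemma path_snoc_eq_iff [simp]: "path_snoc \<beta> g = path_snoc \<beta>' g' \<longleftrightarrow> \<beta> = \<beta>' \<and> g = g'"
  by (auto simp: path_snoc_def prod_eq_iff)

lemma sum_paths_Suc:
  assumes "finite (paths G n)" "\<And>v. v \<in> verts G \<Longrightarrow> finite (out_arcs G v)"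
  shows "(\<Sum>\<mu>\<in>paths G (Suc n). f \<mu>) = (\<Sum>\<beta>\<in>paths G n. \<Sum>g\<in>out_arcs G (path_range G \<beta>). f (path_snoc \<beta> g))"
proof -
  have "(\<Sum>\<beta>\<in>paths G n. \<Sum>g\<in>out_arcs G (path_range G \<beta>). f (path_snoc \<beta> g))
      = (\<Sum>(\<beta>, g)\<in>Sigma (paths G n) (\<lambda>\<beta>. out_arcs G (path_range G \<beta>)). f (path_snoc \<beta> g))"
    using assms paths_verts(2) by (intro sum.Sigma) auto
  also have "\<dots> = (\<Sum>\<mu>\<in>paths G (Suc n). f \<mu>)"
  proof -
    have "bij_betw (\<lambda>(\<beta>, g). path_snoc \<beta> g) (Sigma (paths G n) (\<lambda>\<beta>. out_arcs G (path_range G \<beta>)))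
        (paths G (Suc n))"
      unfolding bij_betw_def
    proof
      show "(\<lambda>(\<beta>, g). path_snoc \<beta> g) ` Sigma (paths G n) (\<lambda>\<beta>. out_arcs G (path_range G \<beta>)) = paths G (Suc n)"
      proof (intro equalityI subsetI)
        fix \<mu> assume "\<mu> \<in> paths G (Suc n)"
        then show "\<mu> \<in> (\<lambda>(\<beta>, g). path_snoc \<beta> g) ` Sigma (paths G n) (\<lambda>\<beta>. out_arcs G (path_range G \<beta>))"
          by (rule path_snocE) force
      qed (auto intro: path_snoc_paths)
    qed (auto simp: inj_on_def)
    from sum.reindex_bij_betw[OF this, of f] show ?thesis by (simp add: case_prod_beta')
  qed
  finally show ?thesis by simp
qed

end

lemma (in fin_digraph) finite_paths [simp]: "finite (paths G n)"
proof (rule finite_subset)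
  show "paths G n \<subseteq> verts G \<times> {es. set es \<subseteq> arcs G \<and> length es = n}"
    by (auto simp: paths_def awalk_def)
  show "finite (verts G \<times> {es. set es \<subseteq> arcs G \<and> length es = n})"
    by (simp add: finite_lists_length_eq)
qed

lemma (in wf_digraph) paths_from_nonempty:
  assumes no_sinks: "\<And>v. v \<in> verts G \<Longrightarrow> out_arcs G v \<noteq> {}" and "v \<in> verts G"
  shows "paths_from G n v \<noteq> {}"
  using assms(2)
proof (induction n arbitrary: v)
  case 0
  then show ?case by (auto simp: paths_from_def paths_0)
next
  case (Suc n)
  then obtain e where e: "e \<in> arcs G" "tail G e = v" using no_sinks by force
  then obtain \<alpha> where "\<alpha> \<in> paths_from G n (head G e)"
    using Suc.IH[of "head G e"] by auto
  with e have "path_cons G e \<alpha> \<in> paths_from G (Suc n) v"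
    by (simp add: paths_from_def path_cons_paths)
  then show ?case by blast
qed

section \<open>The Cuntz--Krieger relations for paths\<close>

locale graph_algebra = fin_digraph G for G :: "('v, 'e) pre_digraph" +
  fixes P :: "'v \<Rightarrow> 'a::cstar_algebra" and S :: "'e \<Rightarrow> 'a"
  assumes no_sinks: "v \<in> verts G \<Longrightarrow> out_arcs G v \<noteq> {}"
    and univ: "graph_cstar_algebra G P S"
begin

lemma cuntz_krieger: "cuntz_krieger_family G P S"
  using univ by (simp add: graph_cstar_algebra_def)

lemma generates: "cstar_subalgebra hull (P ` verts G \<union> S ` arcs G) = UNIV"
  using univ by (simp add: graph_cstar_algebra_def)

lemma finite_out_arcs [simp]: "finite (out_arcs G v)"
  by (simp add: out_arcs_def)

lemma P_nonzero: "v \<in> verts G \<Longrightarrow> P v \<noteq> 0"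
  by (rule vertex_projection_nonzero[OF wf_digraph _ univ]) (simp_all add: no_sinks)

lemma P_adj: "v \<in> verts G \<Longrightarrow> (P v)\<^sup>\<star> = P v"
  and P_mult_P: "v \<in> verts G \<Longrightarrow> w \<in> verts G \<Longrightarrow> P v * P w = (if v = w then P v else 0)"
  and adj_S_mult_S: "e \<in> arcs G \<Longrightarrow> f \<in> arcs G \<Longrightarrow> (S e)\<^sup>\<star> * S f = (if e = f then P (head G e) else 0)"
  and sum_out_arcs: "v \<in> verts G \<Longrightarrow> (\<Sum>e\<in>out_arcs G v. S e * (S e)\<^sup>\<star>) = P v"
  and P_mult_SS: "e \<in> arcs G \<Longrightarrow> P (tail G e) * (S e * (S e)\<^sup>\<star>) = S e * (S e)\<^sup>\<star>"
proof -
  have P: "\<forall>v\<in>verts G. (P v)\<^sup>\<star> = P v \<and> P v * P v = P v" "\<forall>v\<in>verts G. \<forall>w\<in>verts G. v \<noteq> w \<longrightarrow> P v * P w = 0"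
    and S: "\<forall>e\<in>arcs G. (S e)\<^sup>\<star> * S e = P (head G e)" "\<forall>e\<in>arcs G. \<forall>f\<in>arcs G. e \<noteq> f \<longrightarrow> (S e)\<^sup>\<star> * S f = 0"
      "\<forall>e\<in>arcs G. P (tail G e) * (S e * (S e)\<^sup>\<star>) = S e * (S e)\<^sup>\<star>"
    and sum: "\<forall>v\<in>verts G. finite (out_arcs G v) \<and> out_arcs G v \<noteq> {} \<longrightarrow> P v = (\<Sum>e\<in>out_arcs G v. S e * (S e)\<^sup>\<star>)"
    using cuntz_krieger[unfolded cuntz_krieger_mod_def right_minus_eq] by - (elim conjE, assumption)+
  show "v \<in> verts G \<Longrightarrow> (P v)\<^sup>\<star> = P v"
    "v \<in> verts G \<Longrightarrow> w \<in> verts G \<Longrightarrow> P v * P w = (if v = w then P v else 0)"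
    using P by simp_all
  show "e \<in> arcs G \<Longrightarrow> f \<in> arcs G \<Longrightarrow> (S e)\<^sup>\<star> * S f = (if e = f then P (head G e) else 0)"
    using S(1,2) by simp
  show "e \<in> arcs G \<Longrightarrow> P (tail G e) * (S e * (S e)\<^sup>\<star>) = S e * (S e)\<^sup>\<star>"
    using S(3) by blast
  show "v \<in> verts G \<Longrightarrow> (\<Sum>e\<in>out_arcs G v. S e * (S e)\<^sup>\<star>) = P v"
    using sum[rule_format, of v] no_sinks[of v] finite_out_arcs[of v] by simp
qed

text \<open>
  Since \<open>(S e)\<^sup>\<star> * S e\<close> is the projection \<open>P (head G e)\<close>, the element \<open>x = S e - S e * P (head G e)\<close>
  satisfies \<open>x\<^sup>\<star> * x = 0\<close>. The relation \<open>S e = S e * (S e)\<^sup>\<star> * S e\<close> used for the other side follows from this.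
\<close>
lemma S_mult_P:
  assumes e: "e \<in> arcs G" and v: "v \<in> verts G"
  shows "S e * P v = (if v = head G e then S e else 0)"
proof -
  have "(S e - S e * P (head G e))\<^sup>\<star> * (S e - S e * P (head G e)) = 0"
    using e by (simp add: adj_minus adj_mult P_adj algebra_simps adj_S_mult_S P_mult_P mult.assoc[symmetric])
  then have *: "S e * P (head G e) = S e"
    by (simp add: adj_mult_self_eq_0)
  then have "S e * P v = S e * (P (head G e) * P v)" by (simp add: mult.assoc[symmetric])
  then show ?thesis using e v * by (simp add: P_mult_P)
qed

lemma P_mult_S:
  assumes e: "e \<in> arcs G" and v: "v \<in> verts G"
  shows "P v * S e = (if v = tail G e then S e else 0)"
proof -
  have S: "S e * (S e)\<^sup>\<star> * S e = S e"
    using e S_mult_P[of e "head G e"] by (simp add: mult.assoc adj_S_mult_S)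
  have *: "P (tail G e) * S e = S e"
    using P_mult_SS[OF e] S by (metis mult.assoc)
  then have "P v * S e = P v * P (tail G e) * S e" by (simp add: mult.assoc)
  then show ?thesis using e v * by (simp add: P_mult_P)
qed

definition unit :: 'a where "unit = (\<Sum>v\<in>verts G. P v)"

lemma unit_mult_P: "v \<in> verts G \<Longrightarrow> unit * P v = P v" "v \<in> verts G \<Longrightarrow> P v * unit = P v"
  by (simp_all add: unit_def sum_distrib_left sum_distrib_right P_mult_P)

lemma unit_mult_S: "e \<in> arcs G \<Longrightarrow> unit * S e = S e" "e \<in> arcs G \<Longrightarrow> S e * unit = S e"
  by (simp_all add: unit_def sum_distrib_left sum_distrib_right P_mult_S S_mult_P)

lemma unit_adj: "unit\<^sup>\<star> = unit"
  by (simp add: unit_def adj_sum P_adj)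

text \<open>
  The elements on which the sum of all vertex projections acts as an identity form a C*-subalgebra,
  which contains the generators.
\<close>
lemma unit_mult: "unit * x = x" "x * unit = x"
proof -
  have "cstar_subalgebra {x. unit * x = x \<and> x * unit = x}"
    unfolding cstar_subalgebra_def
  proof (intro conjI ballI allI)
    show "closed {x. unit * x = x \<and> x * unit = x}"
      by (intro closed_Collect_conj closed_Collect_eq continuous_intros)
    fix x y c assume x: "x \<in> {x. unit * x = x \<and> x * unit = x}"
    then have "(unit * x)\<^sup>\<star> = x\<^sup>\<star>" "(x * unit)\<^sup>\<star> = x\<^sup>\<star>" by simp_all
    then show "x\<^sup>\<star> \<in> {x. unit * x = x \<and> x * unit = x}" by (simp add: adj_mult unit_adj)
    show "c *\<^sub>C x \<in> {x. unit * x = x \<and> x * unit = x}"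
      using x by (simp add: mult_scaleC_left mult_scaleC_right)
    assume y: "y \<in> {x. unit * x = x \<and> x * unit = x}"
    show "x + y \<in> {x. unit * x = x \<and> x * unit = x}" using x y by (simp add: algebra_simps)
    have "unit * (x * y) = x * y" "x * y * unit = x * y"
      using x y by (simp_all add: mult.assoc[symmetric]) (simp add: mult.assoc)
    then show "x * y \<in> {x. unit * x = x \<and> x * unit = x}" by simp
  qed simp
  then have "cstar_subalgebra hull (P ` verts G \<union> S ` arcs G) \<subseteq> {x. unit * x = x \<and> x * unit = x}"
    by (intro hull_minimal) (auto simp: unit_mult_P unit_mult_S)
  then show "unit * x = x" "x * unit = x" using generates by auto
qed

lemma is_identity_iff: "is_identity i \<longleftrightarrow> i = unit"
  unfolding is_identity_def using unit_mult by metis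

abbreviation Sp :: "('v, 'e) path \<Rightarrow> 'a" where "Sp \<equiv> path_elt P S"

lemma Sp_vertex [simp]: "Sp (v, []) = P v"
  by (simp add: path_elt_def)

lemma Sp_cons:
  assumes "e \<in> arcs G" "fst \<alpha> = head G e"
  shows "Sp (path_cons G e \<alpha>) = S e * Sp \<alpha>"
  using assms S_mult_P[of e "head G e"] by (cases "snd \<alpha>") (simp_all add: path_elt_def path_cons_def)

lemma Sp_mult_P:
  assumes "\<alpha> \<in> paths G n" "v \<in> verts G"
  shows "Sp \<alpha> * P v = (if v = path_range G \<alpha> then Sp \<alpha> else 0)"
  using assms(1)
  by (induction rule: paths_induct)
    (use assms(2) in \<open>simp_all add: P_mult_P Sp_cons path_range_cons mult.assoc\<close>)

lemma P_mult_Sp: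
  assumes "\<alpha> \<in> paths G n" "v \<in> verts G"
  shows "P v * Sp \<alpha> = (if v = fst \<alpha> then Sp \<alpha> else 0)"
  using assms(1)
  by (cases rule: paths_induct)
    (use assms(2) in \<open>simp_all add: P_mult_P Sp_cons P_mult_S mult.assoc[symmetric]\<close>)

lemma Sp_append:
  assumes "\<mu> \<in> paths G m" "\<nu> \<in> paths G n" "fst \<nu> = path_range G \<mu>"
  shows "Sp (path_append \<mu> \<nu>) = Sp \<mu> * Sp \<nu>"
  using assms(1,3)
proof (induction rule: paths_induct)
  case (Nil v)
  then show ?case using P_mult_Sp[OF assms(2)] by (cases \<nu>) (auto simp: path_append_def)
next
  case (Cons m e \<alpha>)
  then have "Sp (path_append (path_cons G e \<alpha>) \<nu>) = Sp (path_cons G e (path_append \<alpha> \<nu>))"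
    by (simp add: path_append_def path_cons_def)
  then show ?case
    using Cons by (subst (asm) Sp_cons) (simp_all add: path_append_def Sp_cons mult.assoc path_range_cons)
qed

text \<open>
  For paths of equal length the elements \<open>S\<^sub>\<alpha> * S\<^sub>\<beta>\<^sup>\<star>\<close> multiply like matrix units, up to the projection at the
  common range.
\<close>
lemma adj_Sp_mult_Sp:
  assumes "\<alpha> \<in> paths G n" "\<beta> \<in> paths G n"
  shows "(Sp \<alpha>)\<^sup>\<star> * Sp \<beta> = (if \<alpha> = \<beta> then P (path_range G \<alpha>) else 0)"
  using assms
proof (induction arbitrary: \<beta> rule: paths_induct)
  case (Nil v)
  then show ?case by (auto simp: paths_0 P_adj P_mult_P split: if_splits)
next
  case (Cons n e \<alpha>)
  from Cons.prems obtain f \<gamma> where f: "f \<in> arcs G" "\<gamma> \<in> paths G n" "fst \<gamma> = head G f" "\<beta> = path_cons G f \<gamma>"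
    by (rule paths_SucE)
  have "(Sp (path_cons G e \<alpha>))\<^sup>\<star> * Sp \<beta> = (Sp \<alpha>)\<^sup>\<star> * ((S e)\<^sup>\<star> * S f) * Sp \<gamma>"
    using f Cons.hyps by (simp add: Sp_cons adj_mult mult.assoc)
  also have "\<dots> = (if e = f then (Sp \<alpha>)\<^sup>\<star> * (P (head G e) * Sp \<gamma>) else 0)"
    using f Cons.hyps by (simp add: adj_S_mult_S mult.assoc)
  also have "\<dots> = (if e = f then (Sp \<alpha>)\<^sup>\<star> * Sp \<gamma> else 0)"
    using f Cons.hyps P_mult_Sp[OF f(2)] by simp
  also have "\<dots> = (if e = f \<and> \<alpha> = \<gamma> then P (path_range G \<alpha>) else 0)"
    using Cons.IH[OF f(2)] by auto
  finally show ?case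
    using f Cons.hyps by (simp add: path_cons_eq_iff path_range_cons)
qed

lemma Sp_nonzero: "\<alpha> \<in> paths G n \<Longrightarrow> Sp \<alpha> \<noteq> 0"
  using adj_Sp_mult_Sp[of \<alpha> n \<alpha>] P_nonzero paths_verts(2)[of \<alpha> n] by auto

lemma Sp_eq_iff: "\<alpha> \<in> paths G n \<Longrightarrow> \<beta> \<in> paths G n \<Longrightarrow> Sp \<alpha> = Sp \<beta> \<longleftrightarrow> \<alpha> = \<beta>"
  using adj_Sp_mult_Sp[of \<alpha> n \<alpha>] adj_Sp_mult_Sp[of \<alpha> n \<beta>] P_nonzero paths_verts(2)[of \<alpha> n]
  by (cases "\<alpha> = \<beta>") auto

abbreviation Pp :: "('v, 'e) path \<Rightarrow> 'a" where "Pp \<mu> \<equiv> Sp \<mu> * (Sp \<mu>)\<^sup>\<star>"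

lemma Pp_mult_Pp:
  assumes "\<alpha> \<in> paths G n" "\<beta> \<in> paths G n"
  shows "Pp \<alpha> * Pp \<beta> = (if \<alpha> = \<beta> then Pp \<alpha> else 0)"
proof -
  have "Pp \<alpha> * Pp \<beta> = Sp \<alpha> * ((Sp \<alpha>)\<^sup>\<star> * Sp \<beta>) * (Sp \<beta>)\<^sup>\<star>" by (simp add: mult.assoc)
  then show ?thesis
    using assms by (simp add: adj_Sp_mult_Sp Sp_mult_P paths_verts)
qed

lemma Sp_snoc:
  assumes "\<beta> \<in> paths G n" "g \<in> arcs G" "tail G g = path_range G \<beta>"
  shows "Sp (path_snoc \<beta> g) = Sp \<beta> * S g"
  using Sp_append[OF assms(1) arc_path[OF assms(2)]] assms(3)
  by (simp add: path_snoc_eq_append[of _ _ "tail G g"]) (simp add: path_elt_def)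

text \<open>
  The absence of sinks is what makes every path projection split over the one-edge extensions.
\<close>
lemma Pp_eq_sum_snoc:
  assumes "\<beta> \<in> paths G n"
  shows "Pp \<beta> = (\<Sum>g\<in>out_arcs G (path_range G \<beta>). Pp (path_snoc \<beta> g))"
proof -
  have "(\<Sum>g\<in>out_arcs G (path_range G \<beta>). Pp (path_snoc \<beta> g))
      = (\<Sum>g\<in>out_arcs G (path_range G \<beta>). Sp \<beta> * (S g * (S g)\<^sup>\<star>) * (Sp \<beta>)\<^sup>\<star>)"
    using assms by (intro sum.cong refl) (simp add: Sp_snoc adj_mult mult.assoc)
  also have "\<dots> = Sp \<beta> * P (path_range G \<beta>) * (Sp \<beta>)\<^sup>\<star>"
    using assms by (simp add: sum_distrib_left[symmetric] sum_distrib_right[symmetric] sum_out_arcs paths_verts)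
  finally show ?thesis using assms by (simp add: Sp_mult_P paths_verts)
qed

lemma sum_Pp: "(\<Sum>\<mu>\<in>paths G n. Pp \<mu>) = unit"
proof (induction n)
  case 0
  have "bij_betw (\<lambda>v. (v, [])) (verts G) (paths G 0)"
    by (auto simp: bij_betw_def inj_on_def paths_0)
  from sum.reindex_bij_betw[OF this, of Pp] show ?case
    by (simp add: unit_def P_adj P_mult_P)
next
  case (Suc n)
  then show ?case by (simp add: sum_paths_Suc Pp_eq_sum_snoc[symmetric])
qed

lemma mult_unit_expand: "x = (\<Sum>\<mu>\<in>paths G n. x * Sp \<mu> * (Sp \<mu>)\<^sup>\<star>)"
  using unit_mult(2)[of x] by (simp add: sum_Pp[of n, symmetric] sum_distrib_left mult.assoc)

end

section \<open>The permutation of a permutative unitary\<close>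

locale permutative_unitary = graph_algebra G P S
  for G :: "('v, 'e) pre_digraph" and P :: "'v \<Rightarrow> 'a::cstar_algebra" and S :: "'e \<Rightarrow> 'a" +
  fixes k :: nat and u :: 'a
  assumes k: "k \<ge> 1"
    and u: "u \<in> permutative_unitaries G P S k \<inter> vertex_unitaries G P"
begin

lemma unitary: "u\<^sup>\<star> * u = unit" "u * u\<^sup>\<star> = unit"
  using u by (auto simp: permutative_unitaries_def is_unitary_def is_identity_iff)

lemma u_commutes: "v \<in> verts G \<Longrightarrow> u * P v = P v * u"
  using u by (auto simp: vertex_unitaries_def)

text \<open>
  The matrix entries of \<open>u\<close> are vertex projections or zero. Only pairs with the same range enter \<open>X\<close>: if
  the ranges differ, \<open>S\<^sub>\<alpha> * S\<^sub>\<beta>\<^sup>\<star> = 0\<close>.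
\<close>
lemma matrix_of_u:
  obtains X where
    "\<And>\<alpha> \<beta>. \<alpha> \<in> paths G k \<Longrightarrow> \<beta> \<in> paths G k \<Longrightarrow>
      (Sp \<alpha>)\<^sup>\<star> * u * Sp \<beta> = (if (\<alpha>, \<beta>) \<in> X then P (path_range G \<alpha>) else 0)"
    "\<And>\<alpha> \<beta>. (\<alpha>, \<beta>) \<in> X \<Longrightarrow> \<alpha> \<in> paths G k \<and> \<beta> \<in> paths G k \<and> path_range G \<alpha> = path_range G \<beta>"
proof -
  from u obtain Y where Y: "Y \<subseteq> paths G k \<times> paths G k"
    and u_eq: "u = (\<Sum>(\<alpha>, \<beta>)\<in>Y. Sp \<alpha> * (Sp \<beta>)\<^sup>\<star>)"
    by (auto simp: permutative_unitaries_def)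
  have fin: "finite Y" using Y by (rule finite_subset) simp
  let ?X = "{(\<alpha>, \<beta>) \<in> Y. path_range G \<alpha> = path_range G \<beta>}"
  have "(Sp \<alpha>)\<^sup>\<star> * u * Sp \<beta> = (if (\<alpha>, \<beta>) \<in> ?X then P (path_range G \<alpha>) else 0)"
    if \<alpha>: "\<alpha> \<in> paths G k" and \<beta>: "\<beta> \<in> paths G k" for \<alpha> \<beta>
  proof -
    have "(Sp \<alpha>)\<^sup>\<star> * u * Sp \<beta> = (\<Sum>(\<gamma>, \<delta>)\<in>Y. ((Sp \<alpha>)\<^sup>\<star> * Sp \<gamma>) * ((Sp \<delta>)\<^sup>\<star> * Sp \<beta>))"
      unfolding u_eq by (simp add: sum_distrib_left sum_distrib_right mult.assoc split_beta)
    also have "\<dots> = (\<Sum>p\<in>Y. if (\<alpha>, \<beta>) = p then P (path_range G \<alpha>) * P (path_range G \<beta>) else 0)"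
    proof (intro sum.cong refl)
      fix p assume "p \<in> Y"
      moreover obtain \<gamma> \<delta> where p: "p = (\<gamma>, \<delta>)" by (cases p)
      ultimately have "\<gamma> \<in> paths G k" "\<delta> \<in> paths G k" using Y by auto
      then show "(case p of (\<gamma>, \<delta>) \<Rightarrow> ((Sp \<alpha>)\<^sup>\<star> * Sp \<gamma>) * ((Sp \<delta>)\<^sup>\<star> * Sp \<beta>))
          = (if (\<alpha>, \<beta>) = p then P (path_range G \<alpha>) * P (path_range G \<beta>) else 0)"
        using \<alpha> \<beta> unfolding p by (simp add: adj_Sp_mult_Sp)
    qed
    also have "\<dots> = (if (\<alpha>, \<beta>) \<in> ?X then P (path_range G \<alpha>) else 0)"
      using \<alpha> \<beta> by (subst sum.delta'[OF fin]) (auto simp: P_mult_P paths_verts)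
    finally show ?thesis .
  qed
  then show ?thesis
    by (rule that) (use Y in auto)
qed

text \<open>
  The matrix of \<open>u\<close> has entries 0 and 1, and \<open>u\<^sup>\<star> * u = 1\<close> says that its columns are orthonormal: each column
  contains a single 1, and different columns have theirs in different rows. As the index set is finite,
  it is a permutation matrix. The permutation preserves sources because \<open>u\<close> commutes with the \<open>P\<^sub>v\<close>.
\<close>
lemma permutation_exists:
  "\<exists>\<sigma>. \<sigma> permutes paths G k \<and>
     (\<forall>\<alpha>\<in>paths G k. fst (\<sigma> \<alpha>) = fst \<alpha> \<and> path_range G (\<sigma> \<alpha>) = path_range G \<alpha>) \<and>
     u = (\<Sum>\<alpha>\<in>paths G k. Sp (\<sigma> \<alpha>) * (Sp \<alpha>)\<^sup>\<star>)"
proof -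
  obtain X where
    entry: "\<And>\<alpha> \<beta>. \<alpha> \<in> paths G k \<Longrightarrow> \<beta> \<in> paths G k \<Longrightarrow>
      (Sp \<alpha>)\<^sup>\<star> * u * Sp \<beta> = (if (\<alpha>, \<beta>) \<in> X then P (path_range G \<alpha>) else 0)"
    and X: "\<And>\<alpha> \<beta>. (\<alpha>, \<beta>) \<in> X \<Longrightarrow> \<alpha> \<in> paths G k \<and> \<beta> \<in> paths G k \<and> path_range G \<alpha> = path_range G \<beta>"
    using matrix_of_u by blast
  \<comment> \<open>The inner product of the columns \<open>\<beta>\<close> and \<open>\<gamma>\<close>; a count of common ones can be compared with 0 or 1
    because the vertex projections are nonzero.\<close>
  have column: "real (card {\<alpha>. (\<alpha>, \<beta>) \<in> X \<and> (\<alpha>, \<gamma>) \<in> X}) *\<^sub>R P (path_range G \<beta>)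
      = (if \<beta> = \<gamma> then P (path_range G \<beta>) else 0)"
    if \<beta>: "\<beta> \<in> paths G k" and \<gamma>: "\<gamma> \<in> paths G k" for \<beta> \<gamma>
  proof -
    have "(Sp \<beta>)\<^sup>\<star> * Sp \<gamma> = (Sp \<beta>)\<^sup>\<star> * u\<^sup>\<star> * (\<Sum>\<alpha>\<in>paths G k. Pp \<alpha>) * u * Sp \<gamma>"
      by (simp add: sum_Pp unit_mult) (simp add: mult.assoc unitary unit_mult flip: mult.assoc[of _ u])
    also have "\<dots> = (\<Sum>\<alpha>\<in>paths G k. ((Sp \<alpha>)\<^sup>\<star> * u * Sp \<beta>)\<^sup>\<star> * ((Sp \<alpha>)\<^sup>\<star> * u * Sp \<gamma>))"
      by (simp add: sum_distrib_left sum_distrib_right adj_mult adj_adj mult.assoc)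
    also have "\<dots> = (\<Sum>\<alpha>\<in>paths G k. if \<alpha> \<in> {\<alpha>. (\<alpha>, \<beta>) \<in> X \<and> (\<alpha>, \<gamma>) \<in> X} then P (path_range G \<beta>) else 0)"
      using X by (intro sum.cong refl) (auto simp: entry \<beta> \<gamma> P_adj P_mult_P paths_verts)
    also have "\<dots> = (\<Sum>\<alpha>\<in>{\<alpha>. (\<alpha>, \<beta>) \<in> X \<and> (\<alpha>, \<gamma>) \<in> X}. P (path_range G \<beta>))"
      using X by (intro sum.mono_neutral_cong_right) (simp, blast, auto)
    also have "\<dots> = real (card {\<alpha>. (\<alpha>, \<beta>) \<in> X \<and> (\<alpha>, \<gamma>) \<in> X}) *\<^sub>R P (path_range G \<beta>)"
      by (rule sum_constant_scaleR)
    finally show ?thesis using adj_Sp_mult_Sp[OF \<beta> \<gamma>] by simp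
  qed
  have unique: "\<exists>!\<alpha>. (\<alpha>, \<beta>) \<in> X" if \<beta>: "\<beta> \<in> paths G k" for \<beta>
  proof -
    have "(real (card {\<alpha>. (\<alpha>, \<beta>) \<in> X}) - 1) *\<^sub>R P (path_range G \<beta>) = 0"
      using column[OF \<beta> \<beta>] by (simp add: scaleR_left_diff_distrib)
    then have "card {\<alpha>. (\<alpha>, \<beta>) \<in> X} = 1"
      using P_nonzero[OF paths_verts(2)[OF \<beta>]] by simp
    then obtain \<alpha> where "{\<alpha>. (\<alpha>, \<beta>) \<in> X} = {\<alpha>}" by (rule card_1_singletonE)
    then have "(\<alpha>', \<beta>) \<in> X \<longleftrightarrow> \<alpha>' = \<alpha>" for \<alpha>'
      by (metis (mono_tags) mem_Collect_eq singleton_iff)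
    then show ?thesis by (intro ex1I[of _ \<alpha>]) simp_all
  qed
  have inj: "\<beta> = \<gamma>" if "(\<alpha>, \<beta>) \<in> X" "(\<alpha>, \<gamma>) \<in> X" for \<alpha> \<beta> \<gamma>
  proof (rule ccontr)
    assume "\<beta> \<noteq> \<gamma>"
    have \<beta>: "\<beta> \<in> paths G k" and \<gamma>: "\<gamma> \<in> paths G k" using that X by auto
    have "finite {\<alpha>. (\<alpha>, \<beta>) \<in> X \<and> (\<alpha>, \<gamma>) \<in> X}"
      by (rule finite_subset[of _ "paths G k"]) (use X in blast, simp)
    moreover have "\<alpha> \<in> {\<alpha>. (\<alpha>, \<beta>) \<in> X \<and> (\<alpha>, \<gamma>) \<in> X}" using that by blast
    ultimately have "card {\<alpha>. (\<alpha>, \<beta>) \<in> X \<and> (\<alpha>, \<gamma>) \<in> X} \<noteq> 0"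
      unfolding card_eq_0_iff by blast
    with column[OF \<beta> \<gamma>] \<open>\<beta> \<noteq> \<gamma>\<close> P_nonzero[OF paths_verts(2)[OF \<beta>]] show False by simp
  qed
  define \<sigma> where "\<sigma> \<beta> = (if \<beta> \<in> paths G k then THE \<alpha>. (\<alpha>, \<beta>) \<in> X else \<beta>)" for \<beta>
  have \<sigma>: "(\<sigma> \<beta>, \<beta>) \<in> X" if "\<beta> \<in> paths G k" for \<beta>
    using theI'[OF unique[OF that]] that by (simp add: \<sigma>_def)
  have \<sigma>_iff: "(\<alpha>, \<beta>) \<in> X \<longleftrightarrow> \<alpha> = \<sigma> \<beta>" if "\<beta> \<in> paths G k" for \<alpha> \<beta>
    using unique[OF that] \<sigma>[OF that] by blast
  have \<sigma>_paths: "\<sigma> \<beta> \<in> paths G k" "path_range G (\<sigma> \<beta>) = path_range G \<beta>" if "\<beta> \<in> paths G k" for \<beta>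
    using X[OF \<sigma>[OF that]] by auto
  have permutes: "\<sigma> permutes paths G k"
  proof (rule bij_imp_permutes)
    have "inj_on \<sigma> (paths G k)" using \<sigma> inj by (metis inj_onI)
    moreover have "\<sigma> ` paths G k = paths G k"
      by (rule endo_inj_surj) (use \<sigma>_paths \<open>inj_on \<sigma> (paths G k)\<close> in auto)
    ultimately show "bij_betw \<sigma> (paths G k) (paths G k)" by (simp add: bij_betw_def)
  qed (simp add: \<sigma>_def)
  have u_Sp: "u * Sp \<beta> = Sp (\<sigma> \<beta>)" if \<beta>: "\<beta> \<in> paths G k" for \<beta>
  proof -
    have "u * Sp \<beta> = (\<Sum>\<alpha>\<in>paths G k. Pp \<alpha>) * u * Sp \<beta>" by (simp add: sum_Pp unit_mult)
    also have "\<dots> = (\<Sum>\<alpha>\<in>paths G k. Sp \<alpha> * ((Sp \<alpha>)\<^sup>\<star> * u * Sp \<beta>))"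
      by (simp add: sum_distrib_right mult.assoc)
    also have "\<dots> = (\<Sum>\<alpha>\<in>paths G k. if \<sigma> \<beta> = \<alpha> then Sp \<alpha> else 0)"
      by (intro sum.cong refl) (auto simp: entry \<beta> \<sigma>_iff Sp_mult_P paths_verts)
    finally show ?thesis by (simp add: \<sigma>_paths \<beta>)
  qed
  have "fst (\<sigma> \<beta>) = fst \<beta>" if \<beta>: "\<beta> \<in> paths G k" for \<beta>
  proof (rule ccontr)
    assume "fst (\<sigma> \<beta>) \<noteq> fst \<beta>"
    have "Sp (\<sigma> \<beta>) = u * (P (fst \<beta>) * Sp \<beta>)" using \<beta> by (simp add: P_mult_Sp paths_verts u_Sp)
    also have "\<dots> = P (fst \<beta>) * (u * Sp \<beta>)"
      using \<beta> by (simp add: u_commutes paths_verts flip: mult.assoc)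
    also have "\<dots> = P (fst \<beta>) * Sp (\<sigma> \<beta>)" using \<beta> by (simp add: u_Sp)
    also have "\<dots> = 0"
      using P_mult_Sp[OF \<sigma>_paths(1)[OF \<beta>] paths_verts(1)[OF \<beta>]] \<open>fst (\<sigma> \<beta>) \<noteq> fst \<beta>\<close> by simp
    finally show False using Sp_nonzero \<sigma>_paths \<beta> by blast
  qed
  moreover have "u = (\<Sum>\<beta>\<in>paths G k. Sp (\<sigma> \<beta>) * (Sp \<beta>)\<^sup>\<star>)"
    using mult_unit_expand[of u k] by (simp add: u_Sp)
  ultimately show ?thesis using permutes \<sigma>_paths by blast
qed

lemma u_mult_Sp_sum:
  assumes "u = (\<Sum>\<alpha>\<in>paths G k. Sp (\<sigma> \<alpha>) * (Sp \<alpha>)\<^sup>\<star>)" "\<sigma> permutes paths G k"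
    "\<forall>\<alpha>\<in>paths G k. path_range G (\<sigma> \<alpha>) = path_range G \<alpha>" "\<beta> \<in> paths G k"
  shows "u * Sp \<beta> = Sp (\<sigma> \<beta>)"
proof -
  have "u * Sp \<beta> = (\<Sum>\<alpha>\<in>paths G k. Sp (\<sigma> \<alpha>) * ((Sp \<alpha>)\<^sup>\<star> * Sp \<beta>))"
    by (subst assms(1)) (simp add: sum_distrib_right mult.assoc)
  also have "\<dots> = (\<Sum>\<alpha>\<in>paths G k. if \<beta> = \<alpha> then Sp (\<sigma> \<beta>) else 0)"
  proof (intro sum.cong refl)
    fix \<alpha> assume \<alpha>: "\<alpha> \<in> paths G k"
    have "\<sigma> \<beta> \<in> paths G k" using assms(2,4) by (simp add: permutes_in_image)
    from Sp_mult_P[OF this paths_verts(2)[OF this]]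
    show "Sp (\<sigma> \<alpha>) * ((Sp \<alpha>)\<^sup>\<star> * Sp \<beta>) = (if \<beta> = \<alpha> then Sp (\<sigma> \<beta>) else 0)"
      using assms(3,4) \<alpha> by (auto simp: adj_Sp_mult_Sp)
  qed
  finally show ?thesis using assms(4) by simp
qed

abbreviation \<sigma> :: "('v, 'e) path \<Rightarrow> ('v, 'e) path" where "\<sigma> \<equiv> path_perm G P S k u"

text \<open>
  Uniqueness holds since \<open>u * S\<^sub>\<alpha> = S\<^sub>\<sigma>\<^sub>(\<^sub>\<alpha>\<^sub>)\<close> and paths of equal length are determined by their partial
  isometries.
\<close>
lemma path_perm:
  shows path_perm_permutes: "\<sigma> permutes paths G k"
    and fst_path_perm: "\<alpha> \<in> paths G k \<Longrightarrow> fst (\<sigma> \<alpha>) = fst \<alpha>"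
    and path_range_path_perm: "\<alpha> \<in> paths G k \<Longrightarrow> path_range G (\<sigma> \<alpha>) = path_range G \<alpha>"
    and u_mult_Sp: "\<alpha> \<in> paths G k \<Longrightarrow> u * Sp \<alpha> = Sp (\<sigma> \<alpha>)"
proof -
  have "\<exists>!\<sigma>. \<sigma> permutes paths G k \<and>
     (\<forall>\<alpha>\<in>paths G k. fst (\<sigma> \<alpha>) = fst \<alpha> \<and> path_range G (\<sigma> \<alpha>) = path_range G \<alpha>) \<and>
     u = (\<Sum>\<alpha>\<in>paths G k. Sp (\<sigma> \<alpha>) * (Sp \<alpha>)\<^sup>\<star>)" (is "\<exists>!\<sigma>. ?Q \<sigma>")
  proof (rule ex_ex1I)
    fix \<sigma> \<tau> assume \<sigma>: "?Q \<sigma>" and \<tau>: "?Q \<tau>"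
    show "\<sigma> = \<tau>"
    proof
      fix \<alpha>
      show "\<sigma> \<alpha> = \<tau> \<alpha>"
      proof (cases "\<alpha> \<in> paths G k")
        case True
        have "u * Sp \<alpha> = Sp (\<sigma> \<alpha>)" "u * Sp \<alpha> = Sp (\<tau> \<alpha>)"
          by (rule u_mult_Sp_sum; use \<sigma> \<tau> True in simp)+
        then have "Sp (\<sigma> \<alpha>) = Sp (\<tau> \<alpha>)" by simp
        moreover have "\<sigma> \<alpha> \<in> paths G k" "\<tau> \<alpha> \<in> paths G k"
          using True \<sigma> \<tau> by (auto simp: permutes_in_image)
        ultimately show ?thesis by (simp add: Sp_eq_iff)
      next
        case False
        then have "\<sigma> \<alpha> = \<alpha>" "\<tau> \<alpha> = \<alpha>" using \<sigma> \<tau> by (blast intro: permutes_not_in)+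
        then show ?thesis by simp
      qed
    qed
  qed (rule permutation_exists)
  then have *: "?Q \<sigma>" unfolding path_perm_def by (rule theI')
  then show "\<sigma> permutes paths G k" by simp
  show "\<alpha> \<in> paths G k \<Longrightarrow> fst (\<sigma> \<alpha>) = fst \<alpha>" "\<alpha> \<in> paths G k \<Longrightarrow> path_range G (\<sigma> \<alpha>) = path_range G \<alpha>"
    using * by simp_all
  show "\<alpha> \<in> paths G k \<Longrightarrow> u * Sp \<alpha> = Sp (\<sigma> \<alpha>)"
    by (rule u_mult_Sp_sum) (use * in simp_all)
qed

lemma path_perm_in_paths: "\<sigma> \<alpha> \<in> paths G k \<longleftrightarrow> \<alpha> \<in> paths G k"
  by (rule permutes_in_image[OF path_perm_permutes])

section \<open>The maps on shorter paths and their compositions\<close>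

abbreviation f :: "'e \<Rightarrow> ('v, 'e) path \<rightharpoonup> ('v, 'e) path" where "f \<equiv> f_map G P S k u"

lemma f_map_SomeE:
  assumes e: "e \<in> arcs G" and \<alpha>: "\<alpha> \<in> paths_from G (k - 1) (head G e)"
  obtains \<beta> g where "f e \<alpha> = Some \<beta>" "\<beta> \<in> paths_from G (k - 1) (tail G e)" "g \<in> arcs G"
    "tail G g = path_range G \<beta>" "\<sigma> (path_cons G e \<alpha>) = path_snoc \<beta> g"
proof -
  have k': "Suc (k - 1) = k" using k by simp
  have e\<alpha>: "path_cons G e \<alpha> \<in> paths G k"
    using path_cons_paths[OF e, of \<alpha> "k - 1"] \<alpha> k' by (simp add: paths_from_def)
  then have "\<sigma> (path_cons G e \<alpha>) \<in> paths G (Suc (k - 1))"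
    unfolding k' by (simp add: path_perm_in_paths)
  then obtain \<beta> g where \<beta>: "\<beta> \<in> paths G (k - 1)" "g \<in> arcs G" "tail G g = path_range G \<beta>"
    "\<sigma> (path_cons G e \<alpha>) = path_snoc \<beta> g"
    by (rule path_snocE)
  moreover have "fst \<beta> = tail G e"
    using fst_path_perm[OF e\<alpha>] \<beta>(4) by (simp add: path_snoc_def)
  moreover from this have "f e \<alpha> = Some \<beta>"
    using \<alpha> \<beta> unfolding f_map_def by (auto simp: paths_from_def intro!: the_equality)
  ultimately show ?thesis using that by (simp add: paths_from_def)
qed

lemma f_map_None: "\<alpha> \<notin> paths_from G (k - 1) (head G e) \<Longrightarrow> f e \<alpha> = None"
  by (simp add: f_map_def)

lemma f_comp_simps [simp]:
  "f_comp G P S k u [] = Some" "f_comp G P S k u (e # es) = f e \<circ>\<^sub>m f_comp G P S k u es"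
  by (simp_all add: f_comp_def)

lemma f_comp_Some_range:
  assumes "es \<noteq> []" "set es \<subseteq> arcs G" "f_comp G P S k u es \<alpha> = Some \<beta>"
  shows "\<beta> \<in> paths_from G (k - 1) (tail G (hd es))"
proof -
  obtain e es' where es: "es = e # es'" using assms(1) by (cases es) auto
  then obtain \<gamma> where \<gamma>: "f_comp G P S k u es' \<alpha> = Some \<gamma>" "f e \<gamma> = Some \<beta>"
    using assms(3) by (auto simp: map_comp_Some_iff)
  then have "\<gamma> \<in> paths_from G (k - 1) (head G e)" using f_map_None[of \<gamma> e] by (cases "\<gamma> \<in> paths_from G (k - 1) (head G e)") auto
  from f_map_SomeE[OF _ this] show ?thesis using \<gamma>(2) es assms(2) by (metis list.sel(1) list.set_intros(1) option.inject subsetD)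
qed

text \<open>
  The sets \<open>paths_from G (k - 1) v\<close> are disjoint for different \<open>v\<close>, so the maps of two edges compose only
  if the edges are consecutive, and then the composition is total.
\<close>
lemma dom_f_comp:
  assumes "es \<noteq> []" "set es \<subseteq> arcs G"
  shows "dom (f_comp G P S k u es)
    = (if awalk (tail G (hd es)) es (head G (last es)) then paths_from G (k - 1) (head G (last es)) else {})"
  using assms
proof (induction es rule: list_nonempty_induct)
  case (single e)
  have "f_comp G P S k u [e] = f e" by (rule ext) (simp add: map_comp_def)
  moreover have "dom (f e) = paths_from G (k - 1) (head G e)"
  proof (rule set_eqI)
    fix \<alpha> show "\<alpha> \<in> dom (f e) \<longleftrightarrow> \<alpha> \<in> paths_from G (k - 1) (head G e)"
    proof (cases "\<alpha> \<in> paths_from G (k - 1) (head G e)")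
      case True
      with single have "\<exists>\<beta>. f e \<alpha> = Some \<beta>" by (auto elim: f_map_SomeE[of e \<alpha>])
      with True show ?thesis by (simp add: domIff)
    qed (simp add: domIff f_map_None)
  qed
  ultimately show ?case using single by (simp add: awalk_Cons_iff awalk_Nil_iff)
next
  case (cons e es)
  let ?n = "k - 1"
  have walk_iff: "awalk (tail G e) (e # es) (head G (last es))
      \<longleftrightarrow> head G e = tail G (hd es) \<and> awalk (tail G (hd es)) es (head G (last es))"
    using cons.hyps cons.prems by (cases es) (auto simp: awalk_Cons_iff)
  have IH: "dom (f_comp G P S k u es)
    = (if awalk (tail G (hd es)) es (head G (last es)) then paths_from G ?n (head G (last es)) else {})"
    using cons.IH cons.prems by simp
  have "\<alpha> \<in> dom (f_comp G P S k u (e # es))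
      \<longleftrightarrow> head G e = tail G (hd es) \<and> \<alpha> \<in> dom (f_comp G P S k u es)" for \<alpha>
  proof (cases "f_comp G P S k u es \<alpha>")
    case None
    then show ?thesis by (simp add: domIff map_comp_def)
  next
    case (Some \<beta>)
    then have \<beta>: "\<beta> \<in> paths_from G ?n (tail G (hd es))"
      using f_comp_Some_range cons.hyps cons.prems by simp
    have "f e \<beta> \<noteq> None \<longleftrightarrow> head G e = tail G (hd es)"
    proof
      assume "f e \<beta> \<noteq> None"
      then have "\<beta> \<in> paths_from G ?n (head G e)"
        by (rule contrapos_np) (rule f_map_None)
      with \<beta> show "head G e = tail G (hd es)" by (simp add: paths_from_def)
    next
      assume "head G e = tail G (hd es)"
      with \<beta> cons.prems show "f e \<beta> \<noteq> None" by (auto elim: f_map_SomeE[of e \<beta>])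
    qed
    then show ?thesis using Some by (auto simp: domIff map_comp_def)
  qed
  then have "dom (f_comp G P S k u (e # es))
      = (if head G e = tail G (hd es) then dom (f_comp G P S k u es) else {})"
    by (intro set_eqI) (cases "head G e = tail G (hd es)"; simp del: f_comp_simps)
  then show ?case using IH walk_iff cons.hyps by simp
qed

end

section \<open>Condition (b) and partial orders\<close>

context permutative_unitary
begin

abbreviation pairs :: "(('v, 'e) path \<times> ('v, 'e) path) set" where
  "pairs \<equiv> path_pairs G (k - 1)"

lemma finite_pairs: "finite pairs"
  unfolding path_pairs_def paths_from_def by auto

text \<open>
  Pairs are ordered with the smaller one first: one of the maps takes \<open>y\<close> to \<open>x\<close>.
\<close>
definition descents :: "(('v, 'e) path \<times> ('v, 'e) path) rel" where
  "descents = {(x, y). fst y \<noteq> snd y \<and>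
     (\<exists>e\<in>arcs G. f e (fst y) = Some (fst x) \<and> f e (snd y) = Some (snd x))}"

lemma f_map_eq_SomeD:
  assumes "e \<in> arcs G" "f e \<alpha> = Some \<beta>"
  shows "\<alpha> \<in> paths_from G (k - 1) (head G e)" "\<beta> \<in> paths_from G (k - 1) (tail G e)"
proof -
  show *: "\<alpha> \<in> paths_from G (k - 1) (head G e)"
    using assms(2) f_map_None by (metis option.distinct(1))
  show "\<beta> \<in> paths_from G (k - 1) (tail G e)"
    by (rule f_map_SomeE[OF assms(1) *]) (use assms(2) in auto)
qed

lemma descents_subset: "descents \<subseteq> pairs \<times> pairs"
proof
  fix p assume "p \<in> descents"
  then obtain x y e where p: "p = (x, y)" and e: "e \<in> arcs G"
    and f: "f e (fst y) = Some (fst x)" "f e (snd y) = Some (snd x)"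
    by (auto simp: descents_def)
  have "x \<in> paths_from G (k - 1) (tail G e) \<times> paths_from G (k - 1) (tail G e)"
    "y \<in> paths_from G (k - 1) (head G e) \<times> paths_from G (k - 1) (head G e)"
    using f_map_eq_SomeD[OF e f(1)] f_map_eq_SomeD[OF e f(2)] by (auto simp: mem_Times_iff)
  then show "p \<in> pairs \<times> pairs"
    unfolding p path_pairs_def using e head_in_verts tail_in_verts by blast
qed

text \<open>
  If a composition of maps separates \<open>\<alpha>\<close> and \<open>\<beta>\<close>, so do all its partial compositions, and each further
  map lowers the rank of the pair.
\<close>
lemma condition_b_if_rank_decreases:
  fixes rank :: "('v, 'e) path \<times> ('v, 'e) path \<Rightarrow> nat"
  assumes decreases: "\<And>x y. (x, y) \<in> descents \<Longrightarrow> rank x < rank y"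
    and bound: "\<And>x. x \<in> pairs \<Longrightarrow> rank x \<le> N"
  shows "condition_b G P S k u"
  unfolding condition_b_def
proof (intro exI[of _ "Suc N"] conjI allI impI)
  fix es assume "length es = Suc N \<and> set es \<subseteq> arcs G"
  then have es: "es \<noteq> []" "set es \<subseteq> arcs G" "length es = Suc N" by auto
  let ?c = "f_comp G P S k u"
  have rank: "rank (\<alpha>', \<beta>') + length es \<le> rank (\<alpha>, \<beta>)"
    if "?c es \<alpha> = Some \<alpha>'" "?c es \<beta> = Some \<beta>'" "\<alpha>' \<noteq> \<beta>'" "set es \<subseteq> arcs G" for es \<alpha> \<beta> \<alpha>' \<beta>'
    using that
  proof (induction es arbitrary: \<alpha>' \<beta>')
    case (Cons e es)
    then obtain \<gamma> \<delta> where "?c es \<alpha> = Some \<gamma>" "f e \<gamma> = Some \<alpha>'" "?c es \<beta> = Some \<delta>" "f e \<delta> = Some \<beta>'"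
      by (auto simp: map_comp_Some_iff)
    moreover from this have "\<gamma> \<noteq> \<delta>" using Cons.prems by auto
    moreover have "((\<alpha>', \<beta>'), (\<gamma>, \<delta>)) \<in> descents"
      using calculation Cons.prems by (auto simp: descents_def)
    ultimately show ?case using Cons.IH[of \<gamma> \<delta>] decreases Cons.prems by fastforce
  qed simp
  show "dom (?c es) = {} \<or> (dom (?c es) = paths_from G (k - 1) (head G (last es)) \<and> (\<exists>\<beta>. ran (?c es) = {\<beta>}))"
  proof (cases "dom (?c es) = {}")
    case False
    then have dom: "dom (?c es) = paths_from G (k - 1) (head G (last es))"
      using dom_f_comp[OF es(1,2)] by (auto split: if_splits)
    have last: "head G (last es) \<in> verts G" using es by (auto intro!: head_in_verts)
    obtain \<alpha> \<alpha>' where \<alpha>: "?c es \<alpha> = Some \<alpha>'" using False by (auto simp: dom_def)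
    have eq: "\<beta>' = \<alpha>'" if "?c es \<beta> = Some \<beta>'" for \<beta> \<beta>'
    proof (rule ccontr)
      assume "\<beta>' \<noteq> \<alpha>'"
      then have "rank (\<alpha>', \<beta>') + Suc N \<le> rank (\<alpha>, \<beta>)" using rank[OF \<alpha> that] es by simp
      moreover have "(\<alpha>, \<beta>) \<in> pairs"
        using dom domI[of "?c es", OF \<alpha>] domI[of "?c es", OF that] last by (auto simp: path_pairs_def)
      ultimately show False using bound[of "(\<alpha>, \<beta>)"] by simp
    qed
    have "\<alpha>' \<in> ran (?c es)" using \<alpha> by (rule ranI)
    moreover have "ran (?c es) \<subseteq> {\<alpha>'}" unfolding ran_def using eq by blast
    ultimately have "ran (?c es) = {\<alpha>'}" by blast
    with dom show ?thesis by blast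
  qed simp
qed simp

text \<open>
  The number of elements strictly below a pair is a rank for \<open>condition_b_if_rank_decreases\<close>.
\<close>
lemma condition_b_if_order:
  assumes order: "partial_order_on pairs r" and descent: "descent_condition G P S k u r"
  shows "condition_b G P S k u"
proof (rule condition_b_if_rank_decreases)
  let ?below = "\<lambda>x. {y \<in> pairs. (y, x) \<in> r \<and> y \<noteq> x}"
  show "card (?below x) \<le> card pairs" for x by (rule card_mono[OF finite_pairs]) auto
  fix x y assume xy: "(x, y) \<in> descents"
  obtain \<alpha> \<beta> \<alpha>' \<beta>' where x: "x = (\<alpha>', \<beta>')" and y: "y = (\<alpha>, \<beta>)" by (cases x, cases y)
  with xy obtain e where *: "\<alpha> \<noteq> \<beta>" "e \<in> arcs G" "f e \<alpha> = Some \<alpha>'" "f e \<beta> = Some \<beta>'"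
    by (auto simp: descents_def)
  have "\<alpha> \<in> paths_from G (k - 1) (head G e)" "\<beta> \<in> paths_from G (k - 1) (head G e)"
    using * f_map_eq_SomeD by blast+
  with descent * have "(x, y) \<in> r \<and> x \<noteq> y"
    unfolding descent_condition_def Let_def x y by (metis option.sel)
  then have "(x, y) \<in> r" "x \<noteq> y" by simp_all
  moreover have "trans r" "antisym r" using order by (auto dest: partial_order_onD)
  ultimately have "?below x \<subseteq> ?below y" by (auto dest: transD antisymD)
  moreover have "x \<in> ?below y" "x \<notin> ?below x"
    using xy descents_subset \<open>(x, y) \<in> r\<close> \<open>x \<noteq> y\<close> by auto
  ultimately have "?below x \<subset> ?below y" by blast
  then show "card (?below x) < card (?below y)"
    by (rule psubset_card_mono[rotated]) (rule finite_subset[OF _ finite_pairs], auto)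
qed

lemma relpow_descentsD:
  assumes "(x, (\<alpha>, \<beta>)) \<in> descents ^^ n"
  shows "\<exists>es. length es = n \<and> set es \<subseteq> arcs G \<and>
    f_comp G P S k u es \<alpha> = Some (fst x) \<and> f_comp G P S k u es \<beta> = Some (snd x)"
  using assms
proof (induction n arbitrary: x)
  case 0
  then show ?case by simp
next
  case (Suc n)
  from relpow_Suc_D2[OF Suc.prems] obtain y where y: "(x, y) \<in> descents" "(y, (\<alpha>, \<beta>)) \<in> descents ^^ n"
    by blast
  from Suc.IH[OF y(2)] obtain es where "length es = n" "set es \<subseteq> arcs G"
    "f_comp G P S k u es \<alpha> = Some (fst y)" "f_comp G P S k u es \<beta> = Some (snd y)" by blast
  moreover from y(1) obtain e where "e \<in> arcs G" "f e (fst y) = Some (fst x)" "f e (snd y) = Some (snd x)"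
    by (auto simp: descents_def)
  ultimately show ?case by (intro exI[of _ "e # es"]) (simp add: map_comp_Some_iff)
qed

text \<open>
  Following a cycle backwards gives descents of every length. The last step of one of length \<open>m + 1\<close>
  starts from an off-diagonal pair, which is the image of a pair under a composition of \<open>m\<close> maps.
\<close>
lemma acyclic_descents:
  assumes "condition_b G P S k u"
  shows "acyclic descents"
proof (rule acyclicI, rule allI, rule notI)
  fix x assume x: "(x, x) \<in> descents\<^sup>+"
  obtain m where m: "m > 0"
    and ran: "\<And>es. length es = m \<Longrightarrow> set es \<subseteq> arcs G \<Longrightarrow>
      dom (f_comp G P S k u es) = {} \<or> (\<exists>\<beta>. ran (f_comp G P S k u es) = {\<beta>})"
    using assms unfolding condition_b_def by blast
  have cycle: "\<exists>y. (x, y) \<in> descents \<and> (y, y) \<in> descents\<^sup>+" if "(x, x) \<in> descents\<^sup>+" for x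
    using that by (metis tranclD rtrancl_into_trancl1)
  have "\<exists>y. (x, y) \<in> descents ^^ n \<and> (y, y) \<in> descents\<^sup>+" for n
  proof (induction n)
    case 0
    then show ?case using x by auto
  next
    case (Suc n)
    then show ?case using cycle by (metis relpow_Suc_I)
  qed
  then obtain y where "(x, y) \<in> descents ^^ Suc m" by blast
  from relpow_Suc_D2[OF this] obtain z where z: "(x, z) \<in> descents" "(z, y) \<in> descents ^^ m" by blast
  obtain es where es: "length es = m" "set es \<subseteq> arcs G"
    "f_comp G P S k u es (fst y) = Some (fst z)" "f_comp G P S k u es (snd y) = Some (snd z)"
    using relpow_descentsD[of z "fst y" "snd y" m] z(2) by auto
  have "fst z \<in> ran (f_comp G P S k u es)" "snd z \<in> ran (f_comp G P S k u es)"
    "dom (f_comp G P S k u es) \<noteq> {}"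
    using es(3,4) by (auto intro: ranI)
  with ran[OF es(1,2)] have "fst z = snd z" by auto
  with z(1) show False by (auto simp: descents_def)
qed

text \<open>
  In the order generated by the descents, a pair is minimal if and only if no descent starts at it.
\<close>
lemma order_if_condition_b:
  assumes "condition_b G P S k u"
  shows "\<exists>r. partial_order_on pairs r \<and> minimality_condition G (k - 1) r \<and> descent_condition G P S k u r"
proof (intro exI conjI)
  let ?r = "descents\<^sup>+ \<union> Id_on pairs"
  have sub: "descents\<^sup>+ \<subseteq> pairs \<times> pairs" by (rule trancl_subset_Sigma[OF descents_subset])
  have acyclic: "(x, x) \<notin> descents\<^sup>+" for x
    using acyclic_descents[OF assms] unfolding acyclic_def by blast
  have antisym: "antisym ?r"
    using acyclic by (auto intro!: antisymI dest: trancl_trans)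
  show "partial_order_on pairs ?r"
    unfolding partial_order_on_def preorder_on_def
    using sub antisym by (auto simp: refl_on_def intro!: transI dest: trancl_trans)
  have below: "\<exists>z. (z, x) \<in> descents" if "(y, x) \<in> ?r" "y \<noteq> x" for x y
    using that by (elim UnE) (blast dest: tranclD2, blast)
  have minimal_iff: "minimal_in pairs ?r x \<longleftrightarrow> x \<in> pairs \<and> (\<forall>z. (z, x) \<notin> descents)" for x
  proof
    assume "minimal_in pairs ?r x"
    then show "x \<in> pairs \<and> (\<forall>z. (z, x) \<notin> descents)"
      using acyclic descents_subset unfolding minimal_in_def by blast
  next
    assume "x \<in> pairs \<and> (\<forall>z. (z, x) \<notin> descents)"
    then show "minimal_in pairs ?r x"
      using below unfolding minimal_in_def by blast
  qed
  have descent_iff: "(\<exists>z. (z, (\<alpha>, \<beta>)) \<in> descents) \<longleftrightarrow> \<alpha> \<noteq> \<beta> \<and> (\<exists>e\<in>arcs G. head G e = v)"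
    if v: "\<alpha> \<in> paths_from G (k - 1) v" "\<beta> \<in> paths_from G (k - 1) v" for \<alpha> \<beta> v
  proof
    assume "\<exists>z. (z, (\<alpha>, \<beta>)) \<in> descents"
    then obtain e \<alpha>' where "\<alpha> \<noteq> \<beta>" "e \<in> arcs G" "f e \<alpha> = Some \<alpha>'" by (auto simp: descents_def)
    then show "\<alpha> \<noteq> \<beta> \<and> (\<exists>e\<in>arcs G. head G e = v)"
      using f_map_eq_SomeD(1)[of e \<alpha> \<alpha>'] v(1) by (auto simp: paths_from_def)
  next
    assume "\<alpha> \<noteq> \<beta> \<and> (\<exists>e\<in>arcs G. head G e = v)"
    then obtain e where e: "\<alpha> \<noteq> \<beta>" "e \<in> arcs G" "head G e = v" by blast
    obtain \<alpha>' where "f e \<alpha> = Some \<alpha>'" using f_map_SomeE[OF e(2), of \<alpha>] v e by metis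
    moreover obtain \<beta>' where "f e \<beta> = Some \<beta>'" using f_map_SomeE[OF e(2), of \<beta>] v e by metis
    ultimately have "((\<alpha>', \<beta>'), (\<alpha>, \<beta>)) \<in> descents" using e by (auto simp: descents_def)
    then show "\<exists>z. (z, (\<alpha>, \<beta>)) \<in> descents" by (rule exI)
  qed
  show "minimality_condition G (k - 1) ?r"
    unfolding minimality_condition_def
  proof (intro conjI ballI allI impI)
    fix v x assume v: "v \<in> verts G - head G ` arcs G" and x: "x \<in> paths_from G (k - 1) v \<times> paths_from G (k - 1) v"
    obtain \<alpha> \<beta> where x_eq: "x = (\<alpha>, \<beta>)" by (cases x)
    then have \<alpha>\<beta>: "\<alpha> \<in> paths_from G (k - 1) v" "\<beta> \<in> paths_from G (k - 1) v" using x by auto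
    have "x \<in> pairs" using v x unfolding path_pairs_def by blast
    moreover have "\<forall>z. (z, x) \<notin> descents"
      using descent_iff[OF \<alpha>\<beta>] v unfolding x_eq by blast
    ultimately show "minimal_in pairs ?r x" unfolding minimal_iff by blast
  next
    fix \<alpha> assume "\<alpha> \<in> paths G (k - 1)"
    then have \<alpha>: "\<alpha> \<in> paths_from G (k - 1) (fst \<alpha>)" "fst \<alpha> \<in> verts G" by (auto simp: paths_from_def paths_verts)
    then have "(\<alpha>, \<alpha>) \<in> pairs" unfolding path_pairs_def by blast
    then show "minimal_in pairs ?r (\<alpha>, \<alpha>)"
      using descent_iff[OF \<alpha>(1) \<alpha>(1)] unfolding minimal_iff by blast
  next
    fix x assume min: "minimal_in pairs ?r x"
    obtain \<alpha> \<beta> where x: "x = (\<alpha>, \<beta>)" by (cases x)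
    from min have "x \<in> pairs" unfolding minimal_iff by blast
    then obtain v where v: "v \<in> verts G" "\<alpha> \<in> paths_from G (k - 1) v" "\<beta> \<in> paths_from G (k - 1) v"
      unfolding path_pairs_def x by blast
    have "\<alpha> = \<beta> \<or> v \<notin> head G ` arcs G"
      using min descent_iff[OF v(2,3)] unfolding minimal_iff x by blast
    then show "(\<exists>v\<in>verts G - head G ` arcs G. x \<in> paths_from G (k - 1) v \<times> paths_from G (k - 1) v) \<or>
      (\<exists>\<alpha>\<in>paths G (k - 1). x = (\<alpha>, \<alpha>))"
      using v unfolding x paths_from_def by blast
  qed
  show "descent_condition G P S k u ?r"
    unfolding descent_condition_def Let_def
  proof (intro ballI impI)
    fix e \<alpha> \<beta> assume e: "e \<in> arcs G" and \<alpha>: "\<alpha> \<in> paths_from G (k - 1) (head G e)"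
      and \<beta>: "\<beta> \<in> paths_from G (k - 1) (head G e)" and "\<alpha> \<noteq> \<beta>"
    obtain \<alpha>' where \<alpha>': "f e \<alpha> = Some \<alpha>'" by (rule f_map_SomeE[OF e \<alpha>])
    obtain \<beta>' where \<beta>': "f e \<beta> = Some \<beta>'" by (rule f_map_SomeE[OF e \<beta>])
    have "((\<alpha>', \<beta>'), (\<alpha>, \<beta>)) \<in> descents"
      using e \<alpha>' \<beta>' \<open>\<alpha> \<noteq> \<beta>\<close> by (auto simp: descents_def)
    then have "((\<alpha>', \<beta>'), (\<alpha>, \<beta>)) \<in> descents\<^sup>+" by (rule r_into_trancl)
    then show "((the (f e \<alpha>), the (f e \<beta>)), (\<alpha>, \<beta>)) \<in> ?r \<and> (the (f e \<alpha>), the (f e \<beta>)) \<noteq> (\<alpha>, \<beta>)"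
      using acyclic[of "(\<alpha>, \<beta>)"] \<alpha>' \<beta>' by auto
  qed
qed

end

section \<open>Norms of combinations of orthogonal projections\<close>

text \<open>
  A point of the disc of radius \<open>M\<close> is the midpoint of two points of the bounding circle: for \<open>c\<close> with
  modulus \<open>M * cos \<phi>\<close>, rotate the direction of \<open>c\<close> by \<open>\<phi>\<close> both ways.
\<close>
lemma unit_complex_average:
  assumes "cmod c \<le> M"
  obtains z w where "cmod z = 1" "cmod w = 1" "c = of_real (M / 2) * (z + w)"
proof (cases "M = 0")
  case True
  then show ?thesis using assms by (intro that[of 1 "-1"]) auto
next
  case False
  then have M: "M > 0" using assms by (smt (verit) norm_ge_zero)
  define r where "r = cmod c / M"
  have r: "0 \<le> r" "r \<le> 1" using assms M by (auto simp: r_def)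
  define \<theta> where "\<theta> = Arg c"
  define \<phi> where "\<phi> = arccos r"
  have "cos \<phi> = r" using r by (simp add: \<phi>_def)
  then have "cis (\<theta> + \<phi>) + cis (\<theta> - \<phi>) = of_real (2 * r) * cis \<theta>"
    by (simp add: complex_eq_iff cos_add cos_diff sin_add sin_diff)
  moreover have "c = of_real (M * r) * cis \<theta>"
    using M rcis_cmod_Arg[of c] by (simp add: r_def \<theta>_def rcis_def)
  ultimately show ?thesis
    by (intro that[of "cis (\<theta> + \<phi>)" "cis (\<theta> - \<phi>)"]) simp_all
qed

locale orthogonal_projections =
  fixes A :: "'i set" and Q :: "'i \<Rightarrow> 'a::cstar_algebra"
  assumes finite: "finite A"
    and adj: "i \<in> A \<Longrightarrow> (Q i)\<^sup>\<star> = Q i"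
    and mult: "i \<in> A \<Longrightarrow> j \<in> A \<Longrightarrow> Q i * Q j = (if i = j then Q i else 0)"
    and nonzero: "i \<in> A \<Longrightarrow> Q i \<noteq> 0"
begin

lemma combination_mult:
  "(\<Sum>i\<in>A. c i *\<^sub>C Q i) * (\<Sum>i\<in>A. d i *\<^sub>C Q i) = (\<Sum>i\<in>A. (c i * d i) *\<^sub>C Q i)"
proof -
  have "(\<Sum>i\<in>A. c i *\<^sub>C Q i) * (\<Sum>i\<in>A. d i *\<^sub>C Q i)
      = (\<Sum>i\<in>A. \<Sum>j\<in>A. if i = j then (c i * d i) *\<^sub>C Q i else 0)"
    unfolding sum_product
    by (intro sum.cong refl) (simp add: mult_scaleC_left mult_scaleC_right scaleC_scaleC mult mult.commute)
  then show ?thesis by (simp add: finite)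
qed

lemma combination_adj: "(\<Sum>i\<in>A. c i *\<^sub>C Q i)\<^sup>\<star> = (\<Sum>i\<in>A. cnj (c i) *\<^sub>C Q i)"
  by (simp add: adj_sum adj_scaleC adj)

lemma norm_unimodular_combination_le:
  assumes "\<And>i. i \<in> A \<Longrightarrow> cmod (z i) = 1"
  shows "norm (\<Sum>i\<in>A. z i *\<^sub>C Q i) \<le> 1"
proof -
  let ?U = "\<Sum>i\<in>A. z i *\<^sub>C Q i" and ?q = "\<Sum>i\<in>A. 1 *\<^sub>C Q i"
  have "norm (?q\<^sup>\<star> * ?q) = norm ?q"
    by (subst combination_adj, subst combination_mult) simp
  then have "(norm ?q)\<^sup>2 = norm ?q" by (simp only: cstar_identity)
  then have "norm ?q \<le> 1" by (auto simp: power2_eq_square)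
  moreover have "cnj (z i) * z i = 1" if "i \<in> A" for i
    using assms[OF that] complex_norm_square[of "z i"] by (simp add: mult.commute)
  then have "?U\<^sup>\<star> * ?U = ?q"
    unfolding combination_adj combination_mult by (intro sum.cong refl) simp
  then have "(norm ?U)\<^sup>2 = norm ?q" by (metis cstar_identity)
  ultimately have "(norm ?U)\<^sup>2 \<le> 1\<^sup>2" by simp
  then show ?thesis by (rule power2_le_imp_le) simp
qed

text \<open>
  This would follow from spectral theory; here the combination is written as \<open>M\<close> times the mean of two
  combinations with coefficients of modulus 1. Those are partial isometries, hence contractions.
\<close>
lemma norm_combination_le:
  assumes M: "0 \<le> M" and c: "\<And>i. i \<in> A \<Longrightarrow> cmod (c i) \<le> M"
  shows "norm (\<Sum>i\<in>A. c i *\<^sub>C Q i) \<le> M"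
proof -
  define a where "a = complex_of_real (M / 2)"
  have a: "cmod a = M / 2" using M by (simp add: a_def norm_divide)
  have "\<exists>z w. cmod z = 1 \<and> cmod w = 1 \<and> c i = a * (z + w)" if "i \<in> A" for i
    using unit_complex_average[OF c[OF that]] unfolding a_def by metis
  then obtain z w where z: "\<And>i. i \<in> A \<Longrightarrow> cmod (z i) = 1" and w: "\<And>i. i \<in> A \<Longrightarrow> cmod (w i) = 1"
    and c_eq: "\<And>i. i \<in> A \<Longrightarrow> c i = a * (z i + w i)" by metis
  have "(\<Sum>i\<in>A. c i *\<^sub>C Q i) = (\<Sum>i\<in>A. a *\<^sub>C (z i *\<^sub>C Q i) + a *\<^sub>C (w i *\<^sub>C Q i))"
    by (intro sum.cong refl) (simp add: c_eq distrib_left scaleC_add_left scaleC_scaleC)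
  also have "\<dots> = a *\<^sub>C ((\<Sum>i\<in>A. z i *\<^sub>C Q i) + (\<Sum>i\<in>A. w i *\<^sub>C Q i))"
    by (simp only: sum.distrib scaleC_add_right scaleC_sum)
  also have "norm \<dots> \<le> M / 2 * (norm (\<Sum>i\<in>A. z i *\<^sub>C Q i) + norm (\<Sum>i\<in>A. w i *\<^sub>C Q i))"
    unfolding norm_scaleC a using M by (intro mult_left_mono norm_triangle_ineq) simp
  also have "\<dots> \<le> M / 2 * (1 + 1)"
    using M by (intro mult_left_mono add_mono norm_unimodular_combination_le z w) auto
  finally show ?thesis by simp
qed

lemma cmod_coefficient_le:
  assumes "i \<in> A"
  shows "cmod (c i) \<le> norm (\<Sum>i\<in>A. c i *\<^sub>C Q i)"
proof -
  let ?a = "\<Sum>i\<in>A. c i *\<^sub>C Q i"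
  have "?a * Q i = (\<Sum>j\<in>A. if i = j then c i *\<^sub>C Q i else 0)"
    unfolding sum_distrib_right using assms by (intro sum.cong refl) (auto simp: mult_scaleC_left mult)
  then have "?a * Q i = c i *\<^sub>C Q i" using assms by (simp add: finite)
  then have "cmod (c i) * norm (Q i) \<le> norm ?a * norm (Q i)"
    using norm_mult_ineq[of ?a "Q i"] by (simp add: norm_scaleC)
  then show ?thesis using nonzero[OF assms] by simp
qed

end

lemma norm_combination_eq:
  assumes "orthogonal_projections A Q" "orthogonal_projections A R"
  shows "norm (\<Sum>i\<in>A. c i *\<^sub>C Q i) = norm (\<Sum>i\<in>A. c i *\<^sub>C R i)"
  using assms
  by (intro antisym orthogonal_projections.norm_combination_le norm_ge_zero
      orthogonal_projections.cmod_coefficient_le)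

section \<open>The diagonal subalgebra as a closure of finite-dimensional algebras\<close>

context graph_algebra
begin

abbreviation D :: "'a set" where "D \<equiv> diagonal_algebra G P S"

definition D_level :: "nat \<Rightarrow> 'a set" where
  "D_level n = range (\<lambda>c. \<Sum>\<mu>\<in>paths G n. c \<mu> *\<^sub>C Pp \<mu>)"

lemma Pp_adj: "(Pp \<mu>)\<^sup>\<star> = Pp \<mu>"
  by (simp add: adj_mult adj_adj)

lemma Pp_nonzero: "\<mu> \<in> paths G n \<Longrightarrow> Pp \<mu> \<noteq> 0"
  by (simp add: mult_adj_self_eq_0 Sp_nonzero)

lemma orthogonal_projections_Pp: "orthogonal_projections (paths G n) Pp"
  by standard (simp_all add: Pp_adj Pp_mult_Pp Pp_nonzero)

lemma D_levelI: "(\<Sum>\<mu>\<in>paths G n. c \<mu> *\<^sub>C Pp \<mu>) \<in> D_level n"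
  unfolding D_level_def by (rule range_eqI[of _ _ c]) (rule refl)

lemma D_level_Suc: "D_level n \<subseteq> D_level (Suc n)"
proof
  fix x assume "x \<in> D_level n"
  then obtain c where x: "x = (\<Sum>\<beta>\<in>paths G n. c \<beta> *\<^sub>C Pp \<beta>)" by (auto simp: D_level_def)
  have "x = (\<Sum>\<mu>\<in>paths G (Suc n). c (fst \<mu>, butlast (snd \<mu>)) *\<^sub>C Pp \<mu>)"
    unfolding x sum_paths_Suc[OF finite_paths finite_out_arcs]
    by (intro sum.cong refl, subst Pp_eq_sum_snoc) (simp_all add: scaleC_sum path_snoc_def)
  then show "x \<in> D_level (Suc n)"
    using D_levelI[of "\<lambda>\<mu>. c (fst \<mu>, butlast (snd \<mu>))" "Suc n"] by simp
qed

lemma D_level_mono: "m \<le> n \<Longrightarrow> D_level m \<subseteq> D_level n"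
  using D_level_Suc by (rule lift_Suc_mono_le)

lemma Pp_in_D_level: assumes "\<mu> \<in> paths G n" shows "Pp \<mu> \<in> D_level n"
proof -
  have "(\<Sum>\<nu>\<in>paths G n. (if \<mu> = \<nu> then 1 else 0) *\<^sub>C Pp \<nu>) = (\<Sum>\<nu>\<in>paths G n. if \<mu> = \<nu> then Pp \<nu> else 0)"
    by (intro sum.cong refl) simp
  also have "\<dots> = Pp \<mu>" using assms by simp
  finally show ?thesis using D_levelI[of "\<lambda>\<nu>. if \<mu> = \<nu> then 1 else 0" n] by simp
qed

lemma cstar_subalgebra_D: "cstar_subalgebra D"
  unfolding diagonal_algebra_def by (rule cstar_subalgebra_hull)

lemma Pp_in_D: "\<mu> \<in> paths G n \<Longrightarrow> Pp \<mu> \<in> D"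
  unfolding diagonal_algebra_def by (rule hull_inc) blast

lemma D_eq_closure: "D = closure (\<Union>n. D_level n)"
proof
  let ?U = "\<Union>n. D_level n"
  have "cstar_subalgebra (closure ?U)"
  proof (rule cstar_subalgebra_closure)
    show "0 \<in> ?U" using D_levelI[of "\<lambda>_. 0" 0] by auto
    fix x assume "x \<in> ?U"
    then obtain m where m: "x \<in> D_level m" by blast
    then obtain c where c: "x = (\<Sum>\<mu>\<in>paths G m. c \<mu> *\<^sub>C Pp \<mu>)" by (auto simp: D_level_def)
    show "x\<^sup>\<star> \<in> ?U"
      unfolding c orthogonal_projections.combination_adj[OF orthogonal_projections_Pp]
      by (rule UN_I[OF UNIV_I], rule D_levelI)
    show "a *\<^sub>C x \<in> ?U" for a
      unfolding c scaleC_sum scaleC_scaleC by (rule UN_I[OF UNIV_I], rule D_levelI)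
    fix y assume "y \<in> ?U"
    then obtain n where n: "y \<in> D_level n" by blast
    have "x \<in> D_level (max m n)" "y \<in> D_level (max m n)"
      using m n D_level_mono[of m "max m n"] D_level_mono[of n "max m n"] by auto
    then obtain c d where c: "x = (\<Sum>\<mu>\<in>paths G (max m n). c \<mu> *\<^sub>C Pp \<mu>)"
      and d: "y = (\<Sum>\<mu>\<in>paths G (max m n). d \<mu> *\<^sub>C Pp \<mu>)" by (auto simp: D_level_def)
    have "x + y = (\<Sum>\<mu>\<in>paths G (max m n). (c \<mu> + d \<mu>) *\<^sub>C Pp \<mu>)"
      unfolding c d by (simp add: scaleC_add_left sum.distrib)
    then show "x + y \<in> ?U" using D_levelI[of "\<lambda>\<mu>. c \<mu> + d \<mu>" "max m n"] by auto
    show "x * y \<in> ?U"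
      unfolding c d orthogonal_projections.combination_mult[OF orthogonal_projections_Pp]
      by (rule UN_I[OF UNIV_I], rule D_levelI)
  qed
  then show "D \<subseteq> closure ?U"
    unfolding diagonal_algebra_def
    using Pp_in_D_level closure_subset by (intro hull_minimal) blast+
  have "?U \<subseteq> D"
    unfolding D_level_def
    by (auto intro!: cstar_subalgebra_sum[OF cstar_subalgebra_D] cstar_subalgebraD(6)[OF cstar_subalgebra_D] Pp_in_D)
  then show "closure ?U \<subseteq> D"
    using cstar_subalgebraD(1)[OF cstar_subalgebra_D] by (rule closure_minimal)
qed

text \<open>
  Projections of short paths are sums of those of long ones, so it suffices to check paths of length at
  least \<open>N\<close>.
\<close>
lemma D_subset_closed_subspace:
  assumes "closed W" "0 \<in> W" "\<And>x y. x \<in> W \<Longrightarrow> y \<in> W \<Longrightarrow> x + y \<in> W"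
    "\<And>x c. x \<in> W \<Longrightarrow> c *\<^sub>C x \<in> W"
    and long: "\<And>n \<mu>. \<mu> \<in> paths G (N + n) \<Longrightarrow> Pp \<mu> \<in> W"
  shows "D \<subseteq> W"
  unfolding D_eq_closure
proof (rule closure_minimal[OF _ assms(1)], safe)
  fix x n assume "x \<in> D_level n"
  then have "x \<in> D_level (N + n)" using D_level_mono[of n "N + n"] by auto
  then obtain c where x: "x = (\<Sum>\<mu>\<in>paths G (N + n). c \<mu> *\<^sub>C Pp \<mu>)" by (auto simp: D_level_def)
  have "(\<Sum>\<mu>\<in>A. c \<mu> *\<^sub>C Pp \<mu>) \<in> W" if "A \<subseteq> paths G (N + n)" for A
    using that by (induction A rule: infinite_finite_induct) (auto intro: assms)
  then show "x \<in> W" unfolding x by blast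
qed

lemma linear_image_in_D:
  fixes h :: "'a \<Rightarrow> 'a"
  assumes "continuous_on UNIV h" "\<And>x y. h (x + y) = h x + h y" "\<And>x c. h (c *\<^sub>C x) = c *\<^sub>C h x"
    and "\<And>n \<mu>. \<mu> \<in> paths G (N + n) \<Longrightarrow> h (Pp \<mu>) \<in> D" and "d \<in> D"
  shows "h d \<in> D"
proof -
  have "h 0 = 0" using assms(2)[of 0 0] by simp
  note D = cstar_subalgebraD[OF cstar_subalgebra_D]
  have "D \<subseteq> h -` D"
  proof (rule D_subset_closed_subspace)
    show "closed (h -` D)" by (rule closed_vimage[OF D(1) assms(1)])
    show "Pp \<mu> \<in> h -` D" if "\<mu> \<in> paths G (N + n)" for n \<mu> using assms(4)[OF that] by simp
  qed (simp_all add: assms(2,3) \<open>h 0 = 0\<close> D(2,3,6))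
  then show ?thesis using assms(5) by auto
qed

text \<open>
  Conjugation by \<open>S\<^sub>e\<close> turns \<open>P\<^sub>\<mu>\<close> into the projection of the path \<open>e\<mu>\<close>, or into 0 if \<open>\<mu>\<close> does not start at the
  range of \<open>e\<close>.
\<close>
lemma S_conjugate_in_D:
  assumes e: "e \<in> arcs G" and "d \<in> D"
  shows "S e * d * (S e)\<^sup>\<star> \<in> D"
  using _ _ _ _ assms(2)
proof (rule linear_image_in_D[where N = 0])
  show "continuous_on UNIV (\<lambda>d. S e * d * (S e)\<^sup>\<star>)" by (intro continuous_intros)
  fix n \<mu> assume "\<mu> \<in> paths G (0 + n)"
  then have \<mu>: "\<mu> \<in> paths G n" by simp
  show "S e * Pp \<mu> * (S e)\<^sup>\<star> \<in> D"
  proof (cases "fst \<mu> = head G e")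
    case True
    have "S e * Pp \<mu> * (S e)\<^sup>\<star> = Pp (path_cons G e \<mu>)"
      using e True by (simp add: Sp_cons adj_mult mult.assoc)
    then show ?thesis using Pp_in_D path_cons_paths[OF e \<mu> True] by simp
  next
    case False
    have "S e * Sp \<mu> = S e * (P (head G e) * Sp \<mu>)"
      using S_mult_P[OF e, of "head G e"] e by (simp flip: mult.assoc)
    also have "\<dots> = 0" using False P_mult_Sp[OF \<mu>, of "head G e"] e by simp
    finally have "S e * Pp \<mu> * (S e)\<^sup>\<star> = 0" by (simp flip: mult.assoc)
    then show ?thesis by (simp add: cstar_subalgebraD[OF cstar_subalgebra_D])
  qed
qed (simp_all add: algebra_simps mult_scaleC_left mult_scaleC_right)

end

section \<open>The endomorphism on the diagonal subalgebra\<close>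

context permutative_unitary
begin

abbreviation \<Lambda> :: "'a \<Rightarrow> 'a" where "\<Lambda> \<equiv> lambda_endo G P S u"

text \<open>
  Existence: as \<open>u\<close> is unitary and commutes with the vertex projections, the elements \<open>u * S\<^sub>e\<close> satisfy
  the Cuntz--Krieger relations together with the \<open>P\<^sub>v\<close>. Uniqueness: the generators determine a
  homomorphism.
\<close>
lemma lambda_endo:
  shows cstar_hom_lambda: "cstar_hom \<Lambda>"
    and lambda_S: "e \<in> arcs G \<Longrightarrow> \<Lambda> (S e) = u * S e"
    and lambda_P: "v \<in> verts G \<Longrightarrow> \<Lambda> (P v) = P v"
proof -
  let ?Q = "\<lambda>\<phi>. cstar_hom \<phi> \<and> (\<forall>i. is_identity i \<longrightarrow> \<phi> i = i) \<and>
     (\<forall>e\<in>arcs G. \<phi> (S e) = u * S e) \<and> (\<forall>v\<in>verts G. \<phi> (P v) = P v)"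
  have "cuntz_krieger_family G P (\<lambda>e. u * S e)"
    unfolding cuntz_krieger_mod_def right_minus_eq
  proof (intro conjI ballI impI)
    have *: "(u * S e)\<^sup>\<star> * (u * S f) = (S e)\<^sup>\<star> * S f" for e f
      using unitary(1) unit_mult by (metis adj_mult mult.assoc)
    have **: "(u * S e) * (u * S e)\<^sup>\<star> = u * (S e * (S e)\<^sup>\<star>) * u\<^sup>\<star>" for e
      by (simp add: adj_mult mult.assoc)
    fix e assume e: "e \<in> arcs G"
    show "(u * S e)\<^sup>\<star> * (u * S e) = P (head G e)"
      using e by (simp add: * adj_S_mult_S)
    show "(u * S e)\<^sup>\<star> * (u * S f) = 0" if "f \<in> arcs G" "e \<noteq> f" for f
      using e that by (simp add: * adj_S_mult_S)
    have "P (tail G e) * (u * (S e * (S e)\<^sup>\<star>) * u\<^sup>\<star>) = u * (P (tail G e) * (S e * (S e)\<^sup>\<star>)) * u\<^sup>\<star>"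
      using u_commutes[of "tail G e"] e by (simp flip: mult.assoc)
    then show "P (tail G e) * (u * S e * (u * S e)\<^sup>\<star>) = u * S e * (u * S e)\<^sup>\<star>"
      using e unfolding ** by (simp add: P_mult_SS)
  next
    fix v assume v: "v \<in> verts G"
    have "(\<Sum>e\<in>out_arcs G v. u * S e * (u * S e)\<^sup>\<star>) = u * (\<Sum>e\<in>out_arcs G v. S e * (S e)\<^sup>\<star>) * u\<^sup>\<star>"
      by (simp add: sum_distrib_left sum_distrib_right adj_mult mult.assoc)
    also have "\<dots> = P v * (u * u\<^sup>\<star>)" using v by (simp add: sum_out_arcs u_commutes mult.assoc)
    finally show "P v = (\<Sum>e\<in>out_arcs G v. u * S e * (u * S e)\<^sup>\<star>)" by (simp add: unitary unit_mult)
  qed (simp_all add: P_adj P_mult_P)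
  from universal_cstar_hom[OF univ this] obtain \<phi> where \<phi>: "cstar_hom \<phi>"
    "\<forall>v\<in>verts G. \<phi> (P v) = P v" "\<forall>e\<in>arcs G. \<phi> (S e) = u * S e" by blast
  then have "?Q \<phi>" by (auto simp: is_identity_iff unit_def cstar_hom_sum)
  moreover have "\<psi> = \<phi>" if "?Q \<psi>" for \<psi>
    using that \<phi> by (intro cstar_homs_eqI[OF generates]) auto
  ultimately have "?Q \<Lambda>" unfolding lambda_endo_def by (rule theI)
  then show "cstar_hom \<Lambda>" "e \<in> arcs G \<Longrightarrow> \<Lambda> (S e) = u * S e" "v \<in> verts G \<Longrightarrow> \<Lambda> (P v) = P v"
    by blast+
qed

lemmas lambda_hom = cstar_homD[OF cstar_hom_lambda]

lemma lambda_minus: "\<Lambda> (x - y) = \<Lambda> x - \<Lambda> y"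
  using lambda_hom(2)[of "x - y" y] by simp

lemma lambda_unit: "\<Lambda> unit = unit"
  by (simp add: unit_def cstar_hom_sum[OF cstar_hom_lambda] lambda_P)

text \<open>
  If \<open>\<mu>\<close> has length at least \<open>k\<close>, conjugation by \<open>u\<close> applies \<open>\<sigma>\<close> to the first \<open>k\<close> edges of \<open>\<mu>\<close>.
\<close>
lemma u_conjugate_in_D:
  assumes "d \<in> D"
  shows "u * d * u\<^sup>\<star> \<in> D"
  using _ _ _ _ assms
proof (rule linear_image_in_D[where N = k])
  show "continuous_on UNIV (\<lambda>d. u * d * u\<^sup>\<star>)" by (intro continuous_intros)
  fix n \<mu> assume "\<mu> \<in> paths G (k + n)"
  then obtain \<alpha> \<nu> where \<alpha>: "\<alpha> \<in> paths G k" and \<nu>: "\<nu> \<in> paths G n"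
    and *: "fst \<nu> = path_range G \<alpha>" "\<mu> = path_append \<alpha> \<nu>"
    by (rule paths_addE)
  have \<sigma>: "\<sigma> \<alpha> \<in> paths G k" "fst \<nu> = path_range G (\<sigma> \<alpha>)"
    using \<alpha> * by (simp_all add: path_perm_in_paths path_range_path_perm)
  have "u * Sp \<mu> = Sp (path_append (\<sigma> \<alpha>) \<nu>)"
    using Sp_append[OF \<alpha> \<nu> *(1)] Sp_append[OF \<sigma>(1) \<nu> \<sigma>(2)] u_mult_Sp[OF \<alpha>]
    by (simp add: * mult.assoc[symmetric])
  then have "u * Pp \<mu> * u\<^sup>\<star> = Pp (path_append (\<sigma> \<alpha>) \<nu>)"
    by (metis adj_mult mult.assoc)
  then show "u * Pp \<mu> * u\<^sup>\<star> \<in> D"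
    using Pp_in_D path_append_paths(1)[OF \<sigma>(1) \<nu> \<sigma>(2)] by simp
qed (simp_all add: algebra_simps mult_scaleC_left mult_scaleC_right)

text \<open>
  The image of \<open>P\<^sub>e\<^sub>\<alpha>\<close> arises from the image of \<open>P\<^sub>\<alpha>\<close> by conjugating first with \<open>S\<^sub>e\<close> and then with \<open>u\<close>, so
  induction on the length of the path applies.
\<close>
lemma lambda_in_D:
  assumes "d \<in> D"
  shows "\<Lambda> d \<in> D"
  using lambda_hom(1,2,5) _ assms
proof (rule linear_image_in_D[where N = 0])
  fix n \<mu> assume "\<mu> \<in> paths G (0 + n)"
  then have "\<mu> \<in> paths G n" by simp
  then show "\<Lambda> (Pp \<mu>) \<in> D"
  proof (induction rule: paths_induct)
    case (Nil v)
    then have "(v, []) \<in> paths G 0" by (simp add: paths_0)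
    from Pp_in_D[OF this] show ?case using Nil by (simp add: lambda_hom lambda_P)
  next
    case (Cons n e \<alpha>)
    then have "\<Lambda> (Pp (path_cons G e \<alpha>)) = u * (S e * \<Lambda> (Pp \<alpha>) * (S e)\<^sup>\<star>) * u\<^sup>\<star>"
      by (simp add: Sp_cons lambda_hom lambda_S adj_mult mult.assoc)
    then show ?case using Cons by (simp add: u_conjugate_in_D S_conjugate_in_D)
  qed
qed

lemma orthogonal_projections_lambda_Pp: "orthogonal_projections (paths G n) (\<lambda>\<mu>. \<Lambda> (Pp \<mu>))"
proof
  fix \<mu> \<nu> assume \<mu>: "\<mu> \<in> paths G n" and \<nu>: "\<nu> \<in> paths G n"
  have "\<Lambda> (Pp \<mu>) * \<Lambda> (Pp \<nu>) = \<Lambda> (Pp \<mu> * Pp \<nu>)" by (simp only: lambda_hom)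
  then show "\<Lambda> (Pp \<mu>) * \<Lambda> (Pp \<nu>) = (if \<mu> = \<nu> then \<Lambda> (Pp \<mu>) else 0)"
    using Pp_mult_Pp[OF \<mu> \<nu>] by (simp only: lambda_hom(6) split: if_split) simp
next
  fix \<mu> assume \<mu>: "\<mu> \<in> paths G n"
  have "(\<Lambda> (Sp \<mu>))\<^sup>\<star> * \<Lambda> (Sp \<mu>) = \<Lambda> ((Sp \<mu>)\<^sup>\<star> * Sp \<mu>)" by (simp only: lambda_hom)
  also have "\<dots> = P (path_range G \<mu>)" using \<mu> by (simp add: adj_Sp_mult_Sp lambda_P paths_verts)
  finally have "\<Lambda> (Sp \<mu>) \<noteq> 0" using P_nonzero paths_verts(2)[OF \<mu>] by auto
  then show "\<Lambda> (Pp \<mu>) \<noteq> 0" by (simp add: lambda_hom mult_adj_self_eq_0)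
qed (simp_all add: Pp_adj flip: lambda_hom(4))

text \<open>
  On each level of \<open>D\<close>, both sides are the norm of a combination of nonzero orthogonal projections with
  the same coefficients.
\<close>
lemma norm_lambda_D:
  assumes "d \<in> D"
  shows "norm (\<Lambda> d) = norm d"
proof -
  have "closed {d. norm (\<Lambda> d) = norm d}"
    by (intro closed_Collect_eq continuous_intros lambda_hom(1))
  moreover have "norm (\<Lambda> x) = norm x" if "x \<in> D_level n" for x n
  proof -
    from that obtain c where x: "x = (\<Sum>\<mu>\<in>paths G n. c \<mu> *\<^sub>C Pp \<mu>)" by (auto simp: D_level_def)
    have "\<Lambda> x = (\<Sum>\<mu>\<in>paths G n. c \<mu> *\<^sub>C \<Lambda> (Pp \<mu>))"
      unfolding x by (simp only: cstar_hom_sum[OF cstar_hom_lambda] lambda_hom(5))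
    then show ?thesis
      unfolding x using norm_combination_eq[OF orthogonal_projections_lambda_Pp orthogonal_projections_Pp]
      by simp
  qed
  ultimately have "closure (\<Union>n. D_level n) \<subseteq> {d. norm (\<Lambda> d) = norm d}"
    by (intro closure_minimal) auto
  then show ?thesis using assms by (auto simp: D_eq_closure)
qed

lemma diff_in_D:
  assumes "x \<in> D" "y \<in> D"
  shows "x - y \<in> D"
proof -
  have "x - y = x + (-1) *\<^sub>C y" using scaleR_scaleC[of "-1" y] by simp
  then show ?thesis using assms cstar_subalgebraD(3,6)[OF cstar_subalgebra_D] by metis
qed

text \<open>
  An isometric image of a complete set is complete.
\<close>
lemma closed_lambda_image_D: "closed (\<Lambda> ` D)"
  unfolding closed_sequential_limits
proof (intro allI impI, elim conjE)
  fix f y assume "\<forall>n. f n \<in> \<Lambda> ` D" and lim: "f \<longlonglongrightarrow> y"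
  then have "\<forall>n. \<exists>d. d \<in> D \<and> f n = \<Lambda> d" by blast
  then obtain d where d: "\<And>n. d n \<in> D" "\<And>n. f n = \<Lambda> (d n)" by metis
  have "dist (d m) (d n) = dist (f m) (f n)" for m n
    using norm_lambda_D[OF diff_in_D[OF d(1) d(1)]] by (simp add: dist_norm d(2) lambda_minus)
  then have "Cauchy d"
    using LIMSEQ_imp_Cauchy[OF lim] by (simp add: Cauchy_def)
  then have "convergent d" by (rule Cauchy_convergent)
  then obtain x where x: "d \<longlonglongrightarrow> x" unfolding convergent_def by blast
  have "x \<in> D"
    using cstar_subalgebraD(1)[OF cstar_subalgebra_D] d(1) x by (rule closed_sequentially)
  moreover have "(\<lambda>n. \<Lambda> (d n)) \<longlonglongrightarrow> \<Lambda> x"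
    using continuous_on_tendsto_compose[OF lambda_hom(1) x] by simp
  then have "f \<longlonglongrightarrow> \<Lambda> x" by (simp add: d(2)[abs_def])
  then have "y = \<Lambda> x" using lim LIMSEQ_unique by blast
  ultimately show "y \<in> \<Lambda> ` D" by blast
qed

section \<open>Condition (b) makes the endomorphism surjective on the diagonal\<close>

text \<open>
  The defining property of the map \<open>f e\<close> in terms of operators: \<open>u * S\<^sub>e * S\<^sub>\<beta> = S\<^sub>\<gamma> * S\<^sub>g\<close>, so the range of
  \<open>\<lambda>\<^sub>u(S\<^sub>e) * P\<^sub>\<beta>\<close> lies below \<open>P\<^sub>\<gamma>\<close>.
\<close>
lemma lambda_S_mult_Pp:
  assumes e: "e \<in> arcs G" and f: "f e \<beta> = Some \<gamma>"
  shows "Pp \<gamma> * \<Lambda> (S e) * Pp \<beta> = \<Lambda> (S e) * Pp \<beta>"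
proof -
  have \<beta>: "\<beta> \<in> paths_from G (k - 1) (head G e)" by (rule f_map_eq_SomeD(1)[OF e f])
  then have \<beta>': "\<beta> \<in> paths G (k - 1)" "fst \<beta> = head G e" by (auto simp: paths_from_def)
  obtain \<gamma>' g where \<gamma>': "f e \<beta> = Some \<gamma>'" "\<gamma>' \<in> paths_from G (k - 1) (tail G e)"
    and g': "g \<in> arcs G" "tail G g = path_range G \<gamma>'" "\<sigma> (path_cons G e \<beta>) = path_snoc \<gamma>' g"
    by (rule f_map_SomeE[OF e \<beta>])
  have "\<gamma>' = \<gamma>" using f \<gamma>'(1) by simp
  then have g: "\<gamma> \<in> paths G (k - 1)" "g \<in> arcs G" "tail G g = path_range G \<gamma>"
    "\<sigma> (path_cons G e \<beta>) = path_snoc \<gamma> g"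
    using \<gamma>'(2) g' by (simp_all add: paths_from_def)
  have "path_cons G e \<beta> \<in> paths G (Suc (k - 1))" using e \<beta>' by (intro path_cons_paths)
  then have cons: "path_cons G e \<beta> \<in> paths G k" using k by simp
  have "\<Lambda> (S e) * Sp \<beta> = u * Sp (path_cons G e \<beta>)"
    using e \<beta>' by (simp add: lambda_S Sp_cons mult.assoc)
  also have "\<dots> = Sp \<gamma> * S g" using cons g by (simp add: u_mult_Sp Sp_snoc)
  finally have eq: "\<Lambda> (S e) * Sp \<beta> = Sp \<gamma> * S g" .
  have "Pp \<gamma> * Sp \<gamma> = Sp \<gamma>"
    using g(1) by (simp add: mult.assoc adj_Sp_mult_Sp Sp_mult_P paths_verts)
  then have "Pp \<gamma> * (\<Lambda> (S e) * Sp \<beta>) = \<Lambda> (S e) * Sp \<beta>"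
    unfolding eq by (simp flip: mult.assoc)
  then have "Pp \<gamma> * (\<Lambda> (S e) * Sp \<beta>) * (Sp \<beta>)\<^sup>\<star> = \<Lambda> (S e) * Sp \<beta> * (Sp \<beta>)\<^sup>\<star>" by simp
  then show ?thesis by (simp add: mult.assoc)
qed

lemma lambda_Sp_mult_Pp:
  assumes "\<mu> \<in> paths G n" "\<beta> \<in> paths_from G (k - 1) (path_range G \<mu>)"
    "f_comp G P S k u (snd \<mu>) \<beta> = Some \<gamma>"
  shows "Pp \<gamma> * \<Lambda> (Sp \<mu>) * Pp \<beta> = \<Lambda> (Sp \<mu>) * Pp \<beta>"
  using assms
proof (induction arbitrary: \<gamma> rule: paths_induct)
  case (Nil v)
  then have "P v * Pp \<beta> = Pp \<beta>" "\<gamma> = \<beta>" "\<beta> \<in> paths G (k - 1)"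
    using P_mult_Sp[of \<beta> "k - 1" v] by (auto simp: paths_from_def simp flip: mult.assoc)
  then show ?case using Nil Pp_mult_Pp[of \<beta> "k - 1" \<beta>] by (simp add: lambda_P mult.assoc)
next
  case (Cons n e \<alpha>)
  then obtain \<delta> where \<delta>: "f_comp G P S k u (snd \<alpha>) \<beta> = Some \<delta>" "f e \<delta> = Some \<gamma>"
    by (auto simp: path_cons_def map_comp_Some_iff)
  have IH: "Pp \<delta> * \<Lambda> (Sp \<alpha>) * Pp \<beta> = \<Lambda> (Sp \<alpha>) * Pp \<beta>"
    using Cons.IH \<delta>(1) Cons.prems Cons.hyps by (simp add: path_range_cons)
  have "Pp \<gamma> * \<Lambda> (Sp (path_cons G e \<alpha>)) * Pp \<beta> = Pp \<gamma> * \<Lambda> (S e) * (\<Lambda> (Sp \<alpha>) * Pp \<beta>)"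
    using Cons.hyps by (simp add: Sp_cons lambda_hom mult.assoc)
  also have "\<dots> = (Pp \<gamma> * \<Lambda> (S e) * Pp \<delta>) * \<Lambda> (Sp \<alpha>) * Pp \<beta>"
    by (subst IH[symmetric]) (simp add: mult.assoc)
  also have "\<dots> = \<Lambda> (S e) * (Pp \<delta> * \<Lambda> (Sp \<alpha>) * Pp \<beta>)"
    using lambda_S_mult_Pp[OF Cons.hyps(1) \<delta>(2)] by (simp add: mult.assoc)
  also have "\<dots> = \<Lambda> (Sp (path_cons G e \<alpha>)) * Pp \<beta>"
    unfolding IH using Cons.hyps by (simp add: Sp_cons lambda_hom mult.assoc)
  finally show ?case .
qed

text \<open>
  When the composition along \<open>\<mu>\<close> is constant with value \<open>\<gamma>\<close>, summing \<open>lambda_Sp_mult_Pp\<close> over all \<open>\<beta>\<close> shows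
  that \<open>\<lambda>\<^sub>u(P\<^sub>\<mu>)\<close> lies below \<open>P\<^sub>\<gamma>\<close>. So \<open>P\<^sub>\<alpha>\<close> is the sum of those \<open>\<lambda>\<^sub>u(P\<^sub>\<mu>)\<close> for which \<open>\<gamma> = \<alpha>\<close>.
\<close>
lemma short_Pp_in_lambda_image:
  assumes b: "condition_b G P S k u" and \<alpha>: "\<alpha> \<in> paths G (k - 1)"
  shows "Pp \<alpha> \<in> \<Lambda> ` D"
proof -
  obtain m where m: "m > 0" and const: "\<And>es. length es = m \<Longrightarrow> set es \<subseteq> arcs G \<Longrightarrow>
      dom (f_comp G P S k u es) = {} \<or> (\<exists>\<beta>. ran (f_comp G P S k u es) = {\<beta>})"
    using b unfolding condition_b_def by blast
  have absorb: "Pp \<alpha> * \<Lambda> (Pp \<mu>) = \<Lambda> (Pp \<mu>) \<or> Pp \<alpha> * \<Lambda> (Pp \<mu>) = 0" if \<mu>: "\<mu> \<in> paths G m" for \<mu>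
  proof -
    let ?c = "f_comp G P S k u (snd \<mu>)" and ?r = "path_range G \<mu>"
    have walk: "awalk (fst \<mu>) (snd \<mu>) ?r" "length (snd \<mu>) = m" using \<mu> by (simp_all add: paths_iff)
    then have ne: "snd \<mu> \<noteq> []" and arcs: "set (snd \<mu>) \<subseteq> arcs G" using m by auto
    have ends: "fst \<mu> = tail G (hd (snd \<mu>))" "?r = head G (last (snd \<mu>))"
      using walk(1) ne by (cases "snd \<mu>"; simp add: awalk_Cons_iff path_range_def awalk_verts_conv)+
    have dom: "dom ?c = paths_from G (k - 1) ?r"
      using dom_f_comp[OF ne arcs] walk(1) ends by simp
    have r: "?r \<in> verts G" by (rule paths_verts(2)[OF \<mu>])
    have "paths_from G (k - 1) ?r \<noteq> {}" using paths_from_nonempty[OF no_sinks r] .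
    then obtain \<gamma> where \<gamma>: "ran ?c = {\<gamma>}" using const[OF walk(2) arcs] dom by auto
    then have "\<gamma> \<in> ran ?c" by simp
    then obtain \<beta> where "?c \<beta> = Some \<gamma>" by (auto simp: ran_def)
    then have \<gamma>_path: "\<gamma> \<in> paths G (k - 1)"
      using f_comp_Some_range[OF ne arcs] by (simp add: paths_from_def)
    have each: "Pp \<gamma> * \<Lambda> (Sp \<mu>) * Pp \<beta> = \<Lambda> (Sp \<mu>) * Pp \<beta>" if \<beta>: "\<beta> \<in> paths G (k - 1)" for \<beta>
    proof (cases "fst \<beta> = ?r")
      case True
      then have "\<beta> \<in> dom ?c" using \<beta> dom by (simp add: paths_from_def)
      then obtain \<gamma>' where "?c \<beta> = Some \<gamma>'" by auto
      moreover from this have "\<gamma>' = \<gamma>" using \<gamma> ranI[of ?c \<beta> \<gamma>'] by simp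
      ultimately show ?thesis
        using lambda_Sp_mult_Pp[OF \<mu>, of \<beta> \<gamma>] \<beta> True by (simp add: paths_from_def)
    next
      case False
      have "\<Lambda> (Sp \<mu>) = \<Lambda> (Sp \<mu>) * P ?r"
        using Sp_mult_P[OF \<mu> r] r by (metis lambda_hom(3) lambda_P)
      moreover have "P ?r * Pp \<beta> = 0" using P_mult_Sp[OF \<beta> r] False by (simp flip: mult.assoc)
      ultimately have "\<Lambda> (Sp \<mu>) * Pp \<beta> = 0" by (metis mult.assoc mult_zero_right)
      then show ?thesis by (simp add: mult.assoc)
    qed
    have "Pp \<gamma> * \<Lambda> (Sp \<mu>) = (\<Sum>\<beta>\<in>paths G (k - 1). Pp \<gamma> * \<Lambda> (Sp \<mu>) * Pp \<beta>)"
      by (simp add: sum_Pp unit_mult flip: sum_distrib_left)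
    also have "\<dots> = \<Lambda> (Sp \<mu>)"
      by (simp add: each sum_Pp unit_mult flip: sum_distrib_left)
    finally have "Pp \<gamma> * \<Lambda> (Pp \<mu>) = \<Lambda> (Pp \<mu>)"
      by (simp add: lambda_hom flip: mult.assoc)
    then have "Pp \<alpha> * \<Lambda> (Pp \<mu>) = Pp \<alpha> * Pp \<gamma> * \<Lambda> (Pp \<mu>)" by (simp add: mult.assoc)
    then show ?thesis
      using Pp_mult_Pp[OF \<alpha> \<gamma>_path] \<open>Pp \<gamma> * \<Lambda> (Pp \<mu>) = \<Lambda> (Pp \<mu>)\<close> by (auto split: if_splits)
  qed
  have "Pp \<alpha> = Pp \<alpha> * \<Lambda> unit" by (simp add: lambda_unit unit_mult)
  also have "\<dots> = (\<Sum>\<mu>\<in>paths G m. Pp \<alpha> * \<Lambda> (Pp \<mu>))"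
    by (simp add: sum_Pp[of m, symmetric] cstar_hom_sum[OF cstar_hom_lambda] sum_distrib_left)
  also have "\<dots> = (\<Sum>\<mu>\<in>paths G m. \<Lambda> (if Pp \<alpha> * \<Lambda> (Pp \<mu>) = 0 then 0 else Pp \<mu>))"
    using absorb by (intro sum.cong refl) (auto simp: lambda_hom(6))
  also have "\<dots> = \<Lambda> (\<Sum>\<mu>\<in>paths G m. if Pp \<alpha> * \<Lambda> (Pp \<mu>) = 0 then 0 else Pp \<mu>)"
    by (simp only: cstar_hom_sum[OF cstar_hom_lambda])
  also have "\<dots> \<in> \<Lambda> ` D"
    using cstar_subalgebraD(2)[OF cstar_subalgebra_D] Pp_in_D
    by (intro imageI cstar_subalgebra_sum[OF cstar_subalgebra_D]) auto
  finally show ?thesis .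
qed

text \<open>
  Write the first \<open>k\<close> edges of \<open>\<mu>\<close> as \<open>\<sigma>(e\<alpha>)\<close> and let \<open>\<nu>\<close> be the rest. Then \<open>S\<^sub>\<mu> = u * S\<^sub>e * S\<^sub>\<alpha> * S\<^sub>\<nu>\<close>, so \<open>P\<^sub>\<mu>\<close> is
  the conjugate by \<open>\<lambda>\<^sub>u(S\<^sub>e)\<close> of the projection of the path \<open>\<alpha>\<nu>\<close>, which is one edge shorter.
\<close>
lemma Pp_in_lambda_image:
  assumes b: "condition_b G P S k u" and "\<mu> \<in> paths G (k - 1 + n)"
  shows "Pp \<mu> \<in> \<Lambda> ` D"
  using assms(2)
proof (induction n arbitrary: \<mu>)
  case 0
  then show ?case using short_Pp_in_lambda_image[OF b] by simp
next
  case (Suc n)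
  then have "\<mu> \<in> paths G (k + n)" using k by simp
  then obtain \<alpha>' \<nu> where \<alpha>': "\<alpha>' \<in> paths G k" and \<nu>: "\<nu> \<in> paths G n"
    and *: "fst \<nu> = path_range G \<alpha>'" "\<mu> = path_append \<alpha>' \<nu>"
    by (rule paths_addE)
  obtain \<beta> where \<beta>: "\<beta> \<in> paths G k" "\<sigma> \<beta> = \<alpha>'"
    using permutes_image[OF path_perm_permutes] \<alpha>' by (metis imageE)
  then have "\<beta> \<in> paths G (Suc (k - 1))" using k by simp
  then obtain e \<alpha> where e: "e \<in> arcs G" and \<alpha>: "\<alpha> \<in> paths G (k - 1)" "fst \<alpha> = head G e"
    and \<beta>_eq: "\<beta> = path_cons G e \<alpha>" by (rule paths_SucE)
  have \<nu>_fst: "fst \<nu> = path_range G \<alpha>"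
    using * \<beta> path_range_path_perm[OF \<beta>(1)] path_range_cons[OF \<alpha>(2)] by (simp add: \<beta>_eq)
  have "Sp \<mu> = u * Sp \<beta> * Sp \<nu>"
    using Sp_append[OF \<alpha>' \<nu> *(1)] u_mult_Sp[OF \<beta>(1)] * \<beta> by simp
  also have "\<dots> = \<Lambda> (S e) * Sp (path_append \<alpha> \<nu>)"
    using Sp_append[OF \<alpha>(1) \<nu> \<nu>_fst] e \<alpha> by (simp add: \<beta>_eq Sp_cons lambda_S mult.assoc)
  finally have "Pp \<mu> = \<Lambda> (S e) * Pp (path_append \<alpha> \<nu>) * (\<Lambda> (S e))\<^sup>\<star>"
    by (simp add: adj_mult mult.assoc)
  moreover obtain d where d: "d \<in> D" "Pp (path_append \<alpha> \<nu>) = \<Lambda> d"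
    using Suc.IH[OF path_append_paths(1)[OF \<alpha>(1) \<nu> \<nu>_fst]] by blast
  ultimately have "Pp \<mu> = \<Lambda> (S e * d * (S e)\<^sup>\<star>)" by (simp add: lambda_hom)
  then show ?case using S_conjugate_in_D[OF e d(1)] by blast
qed

theorem lambda_automorphism_of_D:
  assumes b: "condition_b G P S k u"
  shows "cstar_automorphism_on D \<Lambda>"
proof -
  note D = cstar_subalgebraD[OF cstar_subalgebra_D]
  have "inj_on \<Lambda> D"
  proof (rule inj_onI)
    fix x y assume "x \<in> D" "y \<in> D" "\<Lambda> x = \<Lambda> y"
    then show "x = y" using norm_lambda_D[OF diff_in_D, of x y] by (simp add: lambda_minus)
  qed
  moreover have "D \<subseteq> \<Lambda> ` D"
  proof (rule D_subset_closed_subspace[OF closed_lambda_image_D])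
    show "0 \<in> \<Lambda> ` D" using D(2) lambda_hom(6) by force
    show "x + y \<in> \<Lambda> ` D" if "x \<in> \<Lambda> ` D" "y \<in> \<Lambda> ` D" for x y
      using that D(3) by (auto simp flip: lambda_hom(2))
    show "c *\<^sub>C x \<in> \<Lambda> ` D" if "x \<in> \<Lambda> ` D" for x c
      using that D(6) by (auto simp flip: lambda_hom(5))
    show "Pp \<mu> \<in> \<Lambda> ` D" if "\<mu> \<in> paths G (k - 1 + n)" for n \<mu>
      using Pp_in_lambda_image[OF b that] .
  qed
  then have "\<Lambda> ` D = D" using lambda_in_D by blast
  ultimately show ?thesis
    by (simp add: cstar_automorphism_on_def bij_betw_def cstar_subalgebra_D lambda_hom)
qed

end

section \<open>The characterization of Condition (b)\<close>

theorem lemma6p1: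
  fixes G :: "('v, 'e) pre_digraph"
    and P :: "'v \<Rightarrow> 'a::cstar_algebra" and S :: "'e \<Rightarrow> 'a"
    and k :: nat and u :: 'a
  assumes "fin_digraph G"
    and "\<forall>v\<in>verts G. out_arcs G v \<noteq> {}"
    and "every_loop_has_exit G"
    and "graph_cstar_algebra G P S"
    and "k \<ge> 1"
    and "u \<in> permutative_unitaries G P S k \<inter> vertex_unitaries G P"
  shows "(condition_b G P S k u \<longleftrightarrow>
           (\<exists>r. partial_order_on (path_pairs G (k - 1)) r \<and>
                minimality_condition G (k - 1) r \<and>
                descent_condition G P S k u r)) \<and>
         (condition_b G P S k u \<longrightarrow>
           cstar_automorphism_on (diagonal_algebra G P S) (lambda_endo G P S u))"
proof -
  interpret fin_digraph G by fact
  interpret permutative_unitary G P S k u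
    by standard (use assms in auto)
  show ?thesis
    using order_if_condition_b condition_b_if_order lambda_automorphism_of_D by blast
qed

end
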